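(* Assume $\alpha\in\ell^8$ and $(S-1)\alpha\in\ell^2$. Then $$\int_0^{2\pi}(1-\cos\theta)^2(1+\cos\theta)^2\log w(\theta)\frac{d\theta}{2\pi}>-\infty\iff\alpha\in\ell^6.$$
   Context: $\mu$ is a probability measure with infinite support on the unit circle (identified with $[0,2\pi]$ via $e^{i\theta}\mapsto\theta$), with Lebesgue decomposition $d\mu(\theta)=w(\theta)\frac{d\theta}{2\pi}+d\mu_s(\theta)$. $\Phi_n$ are its monic orthogonal polynomials, and its sequence of Verblunsky coefficients is $\alpha=(\alpha_n)_{n\ge0}$, $\alpha_n=-\overline{\Phi_{n+1}(0)}\in\mathbb{D}$. $S$ is the left shift on sequences, $(S\alpha)_n=\alpha_{n+1}$. The integral is well defined in $[-\infty,\infty)$. *)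

theory Defs
  imports "HOL-Analysis.Analysis" "HOL-Probability.Probability" "HOL-Computational_Algebra.Polynomial"
begin

text \<open>The normalized measure $d\theta/2\pi$ on $[0,2\pi]$, and its image on the unit circle.\<close>

definition arc_measure :: "real measure" where
  "arc_measure = uniform_measure lborel {0..2 * pi}"

definition circle_measure :: "complex measure" where
  "circle_measure = distr arc_measure borel cis"

definition measure_support :: "'a::topological_space measure \<Rightarrow> 'a set" where
  "measure_support \<mu> = {z. \<forall>U. open U \<and> z \<in> U \<longrightarrow> emeasure \<mu> U > 0}"

text \<open>A measure on the unit circle is a Borel measure on the complex plane that gives no mass
  to the complement of the circle.\<close>

definition nontrivial_circle_prob :: "complex measure \<Rightarrow> bool" where
  "nontrivial_circle_prob \<mu> \<longleftrightarrow>
     prob_space \<mu> \<and> sets \<mu> = sets borel \<and> (AE z in \<mu>. z \<in> sphere 0 1) \<and>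
     infinite (measure_support \<mu>)"

text \<open>\<open>d\<mu> = w d\<theta>/2\<pi> + d\<mu>\<^sub>s\<close>, with the density \<open>w\<close> a function of the angle and
  \<open>\<mu>\<^sub>s\<close> singular to normalized arc length. Only the values of \<open>w\<close> on $[0,2\pi]$ matter.\<close>

definition lebesgue_decomposition ::
    "complex measure \<Rightarrow> (real \<Rightarrow> real) \<Rightarrow> complex measure \<Rightarrow> bool" where
  "lebesgue_decomposition \<mu> w \<mu>s \<longleftrightarrow>
     w \<in> borel_measurable borel \<and> (\<forall>\<theta>\<in>{0..2 * pi}. 0 \<le> w \<theta>) \<and>
     sets \<mu>s = sets borel \<and>
     (\<forall>A\<in>sets borel. emeasure \<mu> A =
        emeasure (distr (density arc_measure (\<lambda>\<theta>. ennreal (w \<theta>))) borel cis) A + emeasure \<mu>s A) \<and>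
     (\<exists>N\<in>sets borel. emeasure circle_measure N = 0 \<and> emeasure \<mu>s (- N) = 0)"

definition is_monic_OP :: "complex measure \<Rightarrow> nat \<Rightarrow> complex poly \<Rightarrow> bool" where
  "is_monic_OP \<mu> n p \<longleftrightarrow> degree p = n \<and> lead_coeff p = 1 \<and>
     (\<forall>k<n. (\<integral>z. cnj (z ^ k) * poly p z \<partial>\<mu>) = 0)"

text \<open>The description is proper for probability measures of infinite support on the circle,
  since then the monomials are linearly independent in $L^2(\mu)$.\<close>

definition monic_OP :: "complex measure \<Rightarrow> nat \<Rightarrow> complex poly" where
  "monic_OP \<mu> n = (THE p. is_monic_OP \<mu> n p)"

definition verblunsky :: "complex measure \<Rightarrow> nat \<Rightarrow> complex" where
  "verblunsky \<mu> n = - cnj (poly (monic_OP \<mu> (Suc n)) 0)"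

definition left_shift :: "(nat \<Rightarrow> 'a) \<Rightarrow> nat \<Rightarrow> 'a" where
  "left_shift a = (\<lambda>n. a (Suc n))"

definition little_l :: "nat \<Rightarrow> (nat \<Rightarrow> 'a::real_normed_vector) set" where
  "little_l p = {a. summable (\<lambda>n. norm (a n) ^ p)}"

text \<open>The library function \<open>ln\<close> has \<open>ln 0 = 0\<close>, and the Bochner integral of a
  non-integrable function is \<open>0\<close>. Here the logarithm of \<open>0\<close> is \<open>-\<infinity>\<close>, and the integral is the
  difference of the integrals of the positive and negative parts, which is the usual extended
  value whenever one of the two is finite.\<close>

definition log_ext :: "real \<Rightarrow> ereal" where
  "log_ext x = (if x \<le> 0 then - \<infinity> else ereal (ln x))"

definition integral_ext :: "'a measure \<Rightarrow> ('a \<Rightarrow> ereal) \<Rightarrow> ereal" where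
  "integral_ext M f =
     enn2ereal (\<integral>\<^sup>+x. e2ennreal (f x) \<partial>M) - enn2ereal (\<integral>\<^sup>+x. e2ennreal (- f x) \<partial>M)"

end

theory Submission
  imports Defs "HOL-Complex_Analysis.Complex_Analysis"
begin

text \<open>
  Let $w_n$ be the density of the $n$-th Bernstein--Szego approximation of $\mu$; it is the inverse
  of the squared modulus of the orthonormal polynomial of degree $n$ on the circle, and the measure
  it defines has the moments of $\mu$ up to order $n$. The weight is $\sin^4\theta$, and
  $Z_n = \int \sin^4\theta \, \log w_n$ is bounded below iff the entropy of $w$ is finite: from
  $\log x \le x$ applied to $w / w_n$ one gets $\int \sin^4\theta \, \log w \le Z_n + 1$, and from
  $\log x \le x$ applied to $g w_n$ one gets
  $\int \sin^4\theta \, \log g \le \int \sin^4\theta \, g \, d\mu - \inf_n Z_n$, first for trigonometric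
  polynomials $g > 0$ and by approximation for bounded Borel functions, in particular for truncations
  of $1/w$ that are $1$ on the carrier of the singular part.

  On the other side $Z_{n+1} - Z_n$ is an explicit function of $\alpha_{n-4},\dots,\alpha_n$, since
  $\Phi_{n+1}^* = \Phi_n^* (1 - \alpha_n b_n)$ with $b_n = z \Phi_n / \Phi_n^*$, and $\sin^4\theta$ only sees
  Taylor coefficients up to order $4$. It is a sum of real parts of monomials with as many factors
  $\alpha$ as $\bar\alpha$. If the differences are square summable, replacing all shifts of $\alpha$ by
  $\alpha_n$ changes the partial sums by a bounded amount, because the first order terms telescope.
  On the diagonal the step is $-2 |\alpha_n|^6 + O(|\alpha_n|^8)$.
\<close>

section \<open>Orthogonal polynomials and the Szego recursion\<close>

text \<open>The density w may vanish and mu may have a singular part, so the entropy of w cannot be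
  expanded directly; w_n is positive and continuous, and its entropy is a finite sum of increments.
  Only boundedness of Z_n is tracked, never its limit: errors may be additive constants, which is
  why partial sums are merely kept bounded. The weight has Fourier coefficients 6/16, -4/16, 1/16 at
  the orders 0, +-2, +-4. As b_n vanishes at 0, a power b_n^k with k > 4 is invisible to it, so the
  series of ln (1 - a_n b_n) contributes four terms only. The recursion b_(n+1) = z (b_n - cnj a_n)
  / (1 - a_n b_n) has an outer factor z, hence four steps erase all older coefficients from the
  Taylor polynomial of order 4: this is the origin of the window of five. With t = |a_n|^2 the
  orders t and t^2 on the diagonal cancel against those of ln (1 - t). The delicate direction is
  from bounded Z_n back to w, since w_n need not converge to w pointwise; testing against g moves
  the question to mu, whose moments agree with those of the approximations exactly.\<close>

fun Phi Phis :: "(nat \<Rightarrow> complex) \<Rightarrow> nat \<Rightarrow> complex poly" where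
  "Phi a 0 = 1"
| "Phis a 0 = 1"
| "Phi a (Suc n) = pCons 0 (Phi a n) - smult (cnj (a n)) (Phis a n)"
| "Phis a (Suc n) = Phis a n - smult (a n) (pCons 0 (Phi a n))"

lemma coeff_Phi_Phis_above: "(\<forall>i>n. coeff (Phi a n) i = 0) \<and> (\<forall>i>n. coeff (Phis a n) i = 0)"
proof (induction n)
  case (Suc n)
  then show ?case by (auto simp: coeff_pCons split: nat.split)
qed auto

lemma coeff_Phi_top: "coeff (Phi a n) n = 1"
  using coeff_Phi_Phis_above by (induction n) auto

lemma degree_Phi: "degree (Phi a n) = n"
  by (metis coeff_Phi_Phis_above coeff_Phi_top degree_le le_degree nle_le zero_neq_one)

text \<open>Identifies \<open>Phis\<close> with the reversed polynomial, which the recursion defines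
  only implicitly. On the circle conjugation is inversion, and it swaps the two lines of the
  recursion up to a power of z.\<close>

lemma poly_Phis_circle:
  assumes "cmod z = 1"
  shows "poly (Phis a n) z = z ^ n * cnj (poly (Phi a n) z)"
proof (induction n)
  case (Suc n)
  have z: "z * cnj z = 1" using assms by (simp add: complex_norm_square[symmetric])
  have P: "poly (Phi a n) z = z ^ n * cnj (poly (Phis a n) z)"
  proof -
    have "z ^ n * cnj (poly (Phis a n) z) = (z * cnj z) ^ n * poly (Phi a n) z"
      by (simp add: Suc power_mult_distrib)
    then show ?thesis by (simp add: z)
  qed
  have "z ^ Suc n * cnj (poly (Phi a (Suc n)) z) =
      (z * cnj z) * (z ^ n * cnj (poly (Phi a n) z)) - a n * z * (z ^ n * cnj (poly (Phis a n) z))"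
    by (simp add: algebra_simps)
  also have "\<dots> = poly (Phis a (Suc n)) z"
    unfolding P[symmetric] Suc[symmetric] z by simp
  finally show ?case ..
qed auto

lemma norm_Phis_circle: "cmod z = 1 \<Longrightarrow> cmod (poly (Phis a n) z) = cmod (poly (Phi a n) z)"
  by (simp add: poly_Phis_circle norm_mult norm_power)

text \<open>The identity behind the pseudohyperbolic metric: for |a| < 1 the map from u / v to (u -
  cnj a v) / (v - a u) preserves the unit disc. The form without quotients lets it run alongside the
  proof that the denominators do not vanish.\<close>

lemma blaschke_identity:
  fixes a u v :: complex
  shows "(cmod (v - a * u))\<^sup>2 - (cmod (u - cnj a * v))\<^sup>2 = (1 - (cmod a)\<^sup>2) * ((cmod v)\<^sup>2 - (cmod u)\<^sup>2)"
  by (simp only: cmod_power2) (simp add: power2_eq_square algebra_simps)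

text \<open>The two claims carry each other through the induction: v nonzero and |u| <= |v| make v -
  a u nonzero, and \<open>blaschke_identity\<close> passes the inequality on. Together they say that
  z Phi_n / Phis_n is bounded by 1 on the closed disc.\<close>

lemma Phis_nonzero_and_bound:
  assumes "\<And>i. cmod (a i) < 1" and "cmod z \<le> 1"
  shows "poly (Phis a n) z \<noteq> 0 \<and> cmod (z * poly (Phi a n) z) \<le> cmod (poly (Phis a n) z)"
proof (induction n)
  case 0 then show ?case using assms by simp
next
  case (Suc n)
  define u where "u = z * poly (Phi a n) z"
  define v where "v = poly (Phis a n) z"
  have uv: "v \<noteq> 0" "cmod u \<le> cmod v" using Suc by (auto simp: u_def v_def)
  have Q: "poly (Phis a (Suc n)) z = v - a n * u" and P: "poly (Phi a (Suc n)) z = u - cnj (a n) * v"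
    by (auto simp: u_def v_def)
  have "cmod (a n * u) \<le> cmod (a n) * cmod v" using uv by (simp add: norm_mult mult_left_mono)
  also have "\<dots> < cmod v" using assms(1)[of n] uv by simp
  finally have ne: "v - a n * u \<noteq> 0" by auto
  have "(cmod u)\<^sup>2 \<le> (cmod v)\<^sup>2" using uv by (simp add: power_mono)
  moreover have "(cmod (a n))\<^sup>2 \<le> 1" using assms(1)[of n] by (simp add: power_le_one)
  ultimately have "0 \<le> (1 - (cmod (a n))\<^sup>2) * ((cmod v)\<^sup>2 - (cmod u)\<^sup>2)" by simp
  then have "(cmod (u - cnj (a n) * v))\<^sup>2 \<le> (cmod (v - a n * u))\<^sup>2"
    using blaschke_identity[of v "a n" u] by linarith
  then have le: "cmod (u - cnj (a n) * v) \<le> cmod (v - a n * u)" by (rule power2_le_imp_le) simp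
  have "cmod z * cmod (u - cnj (a n) * v) \<le> 1 * cmod (u - cnj (a n) * v)"
    using assms(2) by (intro mult_right_mono) auto
  then show ?case unfolding P Q using ne le by (simp add: norm_mult)
qed

text \<open>Covers mu, the Bernstein-Szego measures and normalized arc length at once; the mass of a
  Bernstein-Szego measure is itself computed inside this locale.\<close>

locale circle_meas = finite_measure M for M :: "complex measure" +
  assumes sets_M: "sets M = sets borel" and AE_circle: "AE z in M. cmod z = 1"
begin

lemma space_M [simp]: "space M = UNIV"
  using sets_eq_imp_space_eq[OF sets_M] by simp

lemma borel_measurable_M: "f \<in> borel_measurable borel \<Longrightarrow> f \<in> borel_measurable M"
  using measurable_cong_sets[OF sets_M refl] by blast

lemma integrable_cont:
  fixes f :: "complex \<Rightarrow> 'b::{banach,second_countable_topology}"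
  assumes "continuous_on UNIV f"
  shows "integrable M f"
proof -
  have "compact (f ` sphere 0 1)"
    using assms by (intro compact_continuous_image) (auto intro: continuous_on_subset)
  then obtain B where B: "\<And>z. cmod z = 1 \<Longrightarrow> norm (f z) \<le> B"
    by (force dest: compact_imp_bounded simp: bounded_iff)
  have "f \<in> borel_measurable M"
    using assms by (intro borel_measurable_M borel_measurable_continuous_onI)
  moreover have "AE z in M. norm (f z) \<le> B"
    using AE_circle by eventually_elim (rule B)
  ultimately show ?thesis by (rule integrable_const_bound[rotated])
qed

lemma integral_cong_circle:
  fixes f g :: "complex \<Rightarrow> 'b::{banach,second_countable_topology}"
  assumes "continuous_on UNIV f" "continuous_on UNIV g" "\<And>z. cmod z = 1 \<Longrightarrow> f z = g z"
  shows "(\<integral>z. f z \<partial>M) = (\<integral>z. g z \<partial>M)"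
proof (rule integral_cong_AE)
  show "AE z in M. f z = g z" using AE_circle by eventually_elim (rule assms(3))
qed (use assms in \<open>auto intro: borel_measurable_M borel_measurable_continuous_onI\<close>)

definition orth :: "nat \<Rightarrow> complex poly \<Rightarrow> bool" where
  "orth n p \<longleftrightarrow> (\<forall>k<n. (\<integral>z. cnj (z ^ k) * poly p z \<partial>M) = 0)"

lemma orth_poly:
  assumes "orth n p" and "\<And>i. i \<ge> n \<Longrightarrow> coeff q i = 0"
  shows "(\<integral>z. cnj (poly q z) * poly p z \<partial>M) = 0"
proof -
  have *: "cnj (poly q z) * poly p z = (\<Sum>i\<le>degree q. cnj (coeff q i) * (cnj (z ^ i) * poly p z))" for z
    by (simp add: poly_altdef sum_distrib_right mult.assoc)
  have "(\<integral>z. cnj (poly q z) * poly p z \<partial>M)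
      = (\<Sum>i\<le>degree q. (\<integral>z. cnj (coeff q i) * (cnj (z ^ i) * poly p z) \<partial>M))"
    unfolding * by (rule Bochner_Integration.integral_sum) (auto intro!: integrable_cont continuous_intros)
  also have "\<dots> = (\<Sum>i\<le>degree q. cnj (coeff q i) * (\<integral>z. (cnj (z ^ i) * poly p z) \<partial>M))"
    by simp
  also have "\<dots> = 0"
    using assms by (intro sum.neutral) (metis complex_cnj_zero mult_eq_0_iff not_le orth_def)
  finally show ?thesis .
qed

text \<open>On the circle z^(-i) Phis_n is the conjugate of z^(-(n-i)) Phi_n, so orthogonality of
  Phi_n to 1, ..., z^(n-1) reflects to orthogonality of Phis_n to z, ..., z^n.\<close>

lemma orth_Phis:
  assumes "orth n (Phi a n)" "1 \<le> i" "i \<le> n"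
  shows "(\<integral>z. cnj (z ^ i) * poly (Phis a n) z \<partial>M) = 0"
proof -
  have "(\<integral>z. cnj (z ^ i) * poly (Phis a n) z \<partial>M)
      = (\<integral>z. cnj (cnj (z ^ (n - i)) * poly (Phi a n) z) \<partial>M)"
  proof (rule integral_cong_circle)
    fix z :: complex assume z: "cmod z = 1"
    have zz: "cnj z * z = 1" using z by (simp add: complex_norm_square[symmetric] mult.commute)
    have "cnj (z ^ i) * z ^ n = (cnj z * z) ^ i * z ^ (n - i)"
      using assms(3) by (simp add: power_mult_distrib flip: power_add)
    then have "cnj (z ^ i) * z ^ n = z ^ (n - i)" by (simp add: zz)
    then show "cnj (z ^ i) * poly (Phis a n) z = cnj (cnj (z ^ (n - i)) * poly (Phi a n) z)"
      by (simp add: poly_Phis_circle[OF z] mult.assoc[symmetric])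
  qed (auto intro!: continuous_intros)
  also have "\<dots> = cnj (\<integral>z. cnj (z ^ (n - i)) * poly (Phi a n) z \<partial>M)" by (rule Bochner_Integration.integral_cnj)
  also have "\<dots> = 0" using assms by (simp add: orth_def)
  finally show ?thesis .
qed

text \<open>The inverse Szego recursion Phi_(n+1) + cnj a_n Phis_(n+1) = (1 - |a_n|^2) z Phi_n
  expresses Phi_n through level n + 1. It serves the Bernstein-Szego measures, where the top degree
  is accessible directly and the lower ones follow from it.\<close>

lemma orth_down:
  assumes "orth (Suc n) (Phi a (Suc n))" "cmod (a n) < 1"
  shows "orth n (Phi a n)"
  unfolding orth_def
proof (intro allI impI)
  fix i assume i: "i < n"
  define r where "r = 1 - a n * cnj (a n)"
  have r: "r \<noteq> 0"
  proof
    assume "r = 0"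
    then have "complex_of_real ((cmod (a n))\<^sup>2) = 1" by (simp only: complex_norm_square r_def) simp
    then have "(cmod (a n))\<^sup>2 = 1" using of_real_eq_1_iff by blast
    then show False using assms(2) norm_ge_zero[of "a n"] by (auto simp only: power2_eq_1_iff)
  qed
  have "r * (\<integral>z. cnj (z ^ i) * poly (Phi a n) z \<partial>M)
      = (\<integral>z. r * (cnj (z ^ i) * poly (Phi a n) z) \<partial>M)" by simp
  also have "\<dots> = (\<integral>z. cnj (z ^ Suc i) * poly (Phi a (Suc n)) z
                     + cnj (a n) * (cnj (z ^ Suc i) * poly (Phis a (Suc n)) z) \<partial>M)"
  proof (rule integral_cong_circle)
    fix z :: complex assume z: "cmod z = 1"
    have zz: "cnj z * z = 1" using z by (simp add: complex_norm_square[symmetric] mult.commute)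
    have e: "poly (Phi a (Suc n)) z + cnj (a n) * poly (Phis a (Suc n)) z = r * z * poly (Phi a n) z"
      by (simp add: r_def algebra_simps)
    have "cnj (z ^ Suc i) * poly (Phi a (Suc n)) z + cnj (a n) * (cnj (z ^ Suc i) * poly (Phis a (Suc n)) z)
      = cnj (z ^ Suc i) * (poly (Phi a (Suc n)) z + cnj (a n) * poly (Phis a (Suc n)) z)"
      by (simp only: distrib_left mult.left_commute)
    also have "\<dots> = (cnj z * z) * (r * (cnj (z ^ i) * poly (Phi a n) z))"
      unfolding e by simp
    finally show "r * (cnj (z ^ i) * poly (Phi a n) z) = cnj (z ^ Suc i) * poly (Phi a (Suc n)) z
       + cnj (a n) * (cnj (z ^ Suc i) * poly (Phis a (Suc n)) z)" by (simp add: zz)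
  qed (auto intro!: continuous_intros)
  also have "\<dots> = (\<integral>z. cnj (z ^ Suc i) * poly (Phi a (Suc n)) z \<partial>M)
       + (\<integral>z. cnj (a n) * (cnj (z ^ Suc i) * poly (Phis a (Suc n)) z) \<partial>M)"
    by (intro Bochner_Integration.integral_add integrable_cont continuous_intros)
  also have "\<dots> = 0"
    using assms(1) i orth_Phis[OF assms(1), of "Suc i"]
    by (simp only: integral_mult_right_zero) (simp add: orth_def del: power_Suc Phi.simps Phis.simps)
  finally show "(\<integral>z. cnj (z ^ i) * poly (Phi a n) z \<partial>M) = 0" using r by simp
qed

definition sqnorm :: "complex poly \<Rightarrow> real" where
  "sqnorm p = (\<integral>z. (cmod (poly p z))\<^sup>2 \<partial>M)"

lemma integral_cnj_mult_self: "(\<integral>z. cnj (poly p z) * poly p z \<partial>M) = complex_of_real (sqnorm p)"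
  by (simp add: sqnorm_def integral_complex_of_real[symmetric] mult.commute[of "cnj _"] complex_norm_square[symmetric] del: integral_complex_of_real of_real_power)

text \<open>Pythagoras for z Phi_n = Phi_(n+1) + cnj a_n Phis_n: \<open>Phis a n\<close> has degree
  at most n and so is orthogonal to Phi_(n+1), and on the circle z Phi_n and Phis_n have the same
  modulus as Phi_n.\<close>

lemma sqnorm_Phi_Suc:
  assumes "orth (Suc n) (Phi a (Suc n))"
  shows "sqnorm (Phi a (Suc n)) = (1 - (cmod (a n))\<^sup>2) * sqnorm (Phi a n)"
proof -
  let ?P = "\<lambda>z. poly (Phi a n) z" and ?Q = "\<lambda>z. poly (Phis a n) z" and ?P' = "\<lambda>z. poly (Phi a (Suc n)) z"
  have "(\<integral>z. cnj (poly (smult (cnj (a n)) (Phis a n)) z) * ?P' z \<partial>M) = 0"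
    using coeff_Phi_Phis_above[of n a] by (intro orth_poly[OF assms]) auto
  then have 0: "(\<integral>z. Re (cnj (cnj (a n) * ?Q z) * ?P' z) \<partial>M) = 0"
    by (subst integral_Re) (auto intro!: integrable_cont continuous_intros simp del: Phi.simps)
  have "sqnorm (Phi a n) = (\<integral>z. (cmod (?P' z))\<^sup>2 + ((cmod (a n))\<^sup>2 * (cmod (?P z))\<^sup>2
      + 2 * Re (cnj (cnj (a n) * ?Q z) * ?P' z)) \<partial>M)"
    unfolding sqnorm_def
  proof (rule integral_cong_circle)
    fix z :: complex assume z: "cmod z = 1"
    have 1: "z * ?P z = ?P' z + cnj (a n) * ?Q z" by simp
    have 2: "(cmod (x + y))\<^sup>2 = (cmod x)\<^sup>2 + (cmod y)\<^sup>2 + 2 * Re (cnj y * x)" for x y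
      by (simp only: cmod_power2) (simp add: power2_eq_square algebra_simps)
    have "(cmod (?P z))\<^sup>2 = (cmod (z * ?P z))\<^sup>2" by (simp add: norm_mult z)
    also have "\<dots> = (cmod (?P' z))\<^sup>2 + (cmod (cnj (a n) * ?Q z))\<^sup>2 + 2 * Re (cnj (cnj (a n) * ?Q z) * ?P' z)"
      unfolding 1 2 ..
    finally show "(cmod (?P z))\<^sup>2 = (cmod (?P' z))\<^sup>2 + ((cmod (a n))\<^sup>2 * (cmod (?P z))\<^sup>2
      + 2 * Re (cnj (cnj (a n) * ?Q z) * ?P' z))"
      by (simp add: norm_mult power_mult_distrib norm_Phis_circle[OF z] del: Phi.simps)
  qed (auto intro!: continuous_intros)
  also have "\<dots> = sqnorm (Phi a (Suc n)) + ((cmod (a n))\<^sup>2 * sqnorm (Phi a n)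
      + 2 * (\<integral>z. Re (cnj (cnj (a n) * ?Q z) * ?P' z) \<partial>M))"
  proof -
    have i1: "integrable M (\<lambda>z. (cmod (?P' z))\<^sup>2)" by (intro integrable_cont continuous_intros)
    have i2: "integrable M (\<lambda>z. (cmod (a n))\<^sup>2 * (cmod (?P z))\<^sup>2)" by (intro integrable_cont continuous_intros)
    have i3: "integrable M (\<lambda>z. 2 * Re (cnj (cnj (a n) * ?Q z) * ?P' z))" by (intro integrable_cont continuous_intros)
    show ?thesis
      unfolding sqnorm_def
      by (simp only: Bochner_Integration.integral_add[OF i1 Bochner_Integration.integrable_add[OF i2 i3]]
        Bochner_Integration.integral_add[OF i2 i3] integral_mult_right_zero)
  qed
  finally have "sqnorm (Phi a n) = sqnorm (Phi a (Suc n)) + ((cmod (a n))\<^sup>2 * sqnorm (Phi a n) + 2 * 0)"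
    unfolding 0 .
  then show ?thesis by (simp add: left_diff_distrib del: Phi.simps)
qed

lemma sqnorm_Phi:
  assumes "\<And>k. k \<le> n \<Longrightarrow> orth k (Phi a k)"
  shows "sqnorm (Phi a n) = (\<Prod>j<n. 1 - (cmod (a j))\<^sup>2) * measure M UNIV"
  using assms
proof (induction n)
  case 0 then show ?case by (simp add: sqnorm_def)
next
  case (Suc n)
  have "sqnorm (Phi a (Suc n)) = (1 - (cmod (a n))\<^sup>2) * sqnorm (Phi a n)"
    using Suc.prems by (intro sqnorm_Phi_Suc) blast
  then show ?case using Suc by (simp add: mult_ac del: Phi.simps)
qed

text \<open>By reflection the integral is the conjugate of the pairing of z^n with Phi_n, and z^n
  differs from the monic Phi_n by a polynomial of lower degree.\<close>

lemma integral_Phis: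
  assumes "orth n (Phi a n)"
  shows "(\<integral>z. poly (Phis a n) z \<partial>M) = complex_of_real (sqnorm (Phi a n))"
proof -
  have 1: "(\<integral>z. poly (Phis a n) z \<partial>M) = (\<integral>z. cnj (cnj (z ^ n) * poly (Phi a n) z) \<partial>M)"
    by (rule integral_cong_circle) (auto intro!: continuous_intros simp: poly_Phis_circle)
  have 2: "(\<integral>z. cnj (poly (Phi a n - monom 1 n) z) * poly (Phi a n) z \<partial>M) = 0"
    using coeff_Phi_Phis_above[of n a] coeff_Phi_top[of a n]
    by (intro orth_poly[OF assms]) (auto simp: le_less)
  have "cnj (poly (Phi a n - monom 1 n) z) * poly (Phi a n) z =
     cnj (poly (Phi a n) z) * poly (Phi a n) z - cnj (z ^ n) * poly (Phi a n) z" for z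
    by (simp add: poly_monom algebra_simps)
  then have "0 = (\<integral>z. cnj (poly (Phi a n) z) * poly (Phi a n) z - cnj (z ^ n) * poly (Phi a n) z \<partial>M)"
    using 2 by simp
  also have "\<dots> = (\<integral>z. cnj (poly (Phi a n) z) * poly (Phi a n) z \<partial>M) - (\<integral>z. cnj (z ^ n) * poly (Phi a n) z \<partial>M)"
    by (intro Bochner_Integration.integral_diff integrable_cont continuous_intros)
  finally have "(\<integral>z. cnj (z ^ n) * poly (Phi a n) z \<partial>M) = complex_of_real (sqnorm (Phi a n))"
    unfolding integral_cnj_mult_self by (rule right_minus_eq[THEN iffD1, OF sym, THEN sym])
  then show ?thesis unfolding 1 Bochner_Integration.integral_cnj by (simp only: complex_cnj_complex_of_real)
qed

end

text \<open>For k > 0 the integral of Phi_k vanishes, which expresses the k-th moment through the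
  lower ones; so the polynomials and the total mass determine the moments up to order n. Mixed
  moments reduce to these because cnj z = 1 / z.\<close>

lemma circle_moments_eq:
  assumes "circle_meas M" "circle_meas M'" "measure M UNIV = measure M' UNIV"
    and "\<And>k. k \<le> n \<Longrightarrow> circle_meas.orth M k (Phi a k)"
    and "\<And>k. k \<le> n \<Longrightarrow> circle_meas.orth M' k (Phi a k)"
    and "i \<le> n" "k \<le> n"
  shows "(\<integral>z. cnj (z ^ i) * z ^ k \<partial>M) = (\<integral>z. cnj (z ^ i) * z ^ k \<partial>M')"
proof -
  interpret M: circle_meas M by fact
  interpret M': circle_meas M' by fact
  have exp: "(\<integral>z. z ^ k \<partial>N) = - (\<Sum>i<k. coeff (Phi a k) i * (\<integral>z. z ^ i \<partial>N))"
    if N: "circle_meas N" "circle_meas.orth N k (Phi a k)" "k \<noteq> 0" for N k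
  proof -
    interpret N: circle_meas N by fact
    have "(\<integral>z. cnj (z ^ 0) * poly (Phi a k) z \<partial>N) = 0" using N(2,3) unfolding N.orth_def by blast
    then have "0 = (\<integral>z. poly (Phi a k) z \<partial>N)" by simp
    also have "\<dots> = (\<integral>z. (\<Sum>i<Suc k. coeff (Phi a k) i * z ^ i) \<partial>N)"
      by (simp only: poly_altdef degree_Phi lessThan_Suc_atMost)
    also have "\<dots> = (\<Sum>i<Suc k. (\<integral>z. coeff (Phi a k) i * z ^ i \<partial>N))"
      by (intro Bochner_Integration.integral_sum N.integrable_cont continuous_intros)
    also have "\<dots> = (\<integral>z. z ^ k \<partial>N) + (\<Sum>i<k. coeff (Phi a k) i * (\<integral>z. z ^ i \<partial>N))"
      by (simp add: coeff_Phi_top)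
    finally show ?thesis by (simp add: eq_neg_iff_add_eq_0)
  qed
  have pos: "(\<integral>z. z ^ k \<partial>M) = (\<integral>z. z ^ k \<partial>M')" if "k \<le> n" for k
    using that
  proof (induction k rule: less_induct)
    case (less k)
    show ?case
    proof (cases "k = 0")
      case True then show ?thesis using assms(3) by simp
    next
      case False
      have "(\<Sum>i<k. coeff (Phi a k) i * (\<integral>z. z ^ i \<partial>M)) = (\<Sum>i<k. coeff (Phi a k) i * (\<integral>z. z ^ i \<partial>M'))"
        using less by (intro sum.cong refl) simp
      then show ?thesis
        using exp[OF assms(1) assms(4) False] exp[OF assms(2) assms(5) False] less.prems by simp
    qed
  qed
  have red: "(\<integral>z. cnj (z ^ i) * z ^ k \<partial>N) =
      (if i \<le> k then \<integral>z. z ^ (k - i) \<partial>N else cnj (\<integral>z. z ^ (i - k) \<partial>N))"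
    if N: "circle_meas N" for N
  proof -
    interpret N: circle_meas N by fact
    have zz: "cnj z ^ m * z ^ m = 1" if "cmod z = 1" for z m
      using that by (simp add: complex_norm_square[symmetric] mult.commute flip: power_mult_distrib)
    have 1: "cnj (z ^ i) * z ^ k = z ^ (k - i)" if "cmod z = 1" "i \<le> k" for z
      using zz[OF that(1), of i] that(2)
      by (metis complex_cnj_power le_add_diff_inverse mult.assoc mult_1 power_add)
    have 2: "cnj (z ^ i) * z ^ k = cnj (z ^ (i - k))" if "cmod z = 1" "k \<le> i" for z
      using zz[OF that(1), of k] that(2)
      by (metis complex_cnj_power le_add_diff_inverse2 mult.assoc mult.right_neutral power_add)
    show ?thesis
    proof (cases "i \<le> k")
      case True
      then have "(\<integral>z. cnj (z ^ i) * z ^ k \<partial>N) = (\<integral>z. z ^ (k - i) \<partial>N)"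
        by (intro N.integral_cong_circle continuous_intros 1)
      then show ?thesis using True by simp
    next
      case False
      then have "(\<integral>z. cnj (z ^ i) * z ^ k \<partial>N) = (\<integral>z. cnj (z ^ (i - k)) \<partial>N)"
        by (intro N.integral_cong_circle continuous_intros 2) auto
      then show ?thesis using False by (simp only: Bochner_Integration.integral_cnj if_False)
    qed
  qed
  have "k - i \<le> n" "i - k \<le> n" using assms by auto
  then show ?thesis unfolding red[OF assms(1)] red[OF assms(2)] by (simp only: pos)
qed

section \<open>Nontrivial measures: their orthogonal polynomials obey the recursion\<close>

lemma nontrivial_circle_meas:
  assumes "nontrivial_circle_prob \<mu>" shows "circle_meas \<mu>"
proof -
  interpret prob_space \<mu> using assms by (simp add: nontrivial_circle_prob_def)
  show ?thesis using assms by unfold_locales (auto simp: nontrivial_circle_prob_def)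
qed

text \<open>A vanishing norm would confine the support of the measure to the zeros of p, a finite
  set.\<close>

lemma sqnorm_pos:
  assumes "nontrivial_circle_prob \<mu>" "p \<noteq> 0"
  shows "circle_meas.sqnorm \<mu> p > 0"
proof (rule ccontr)
  interpret circle_meas \<mu> by (rule nontrivial_circle_meas) fact
  assume "\<not> 0 < sqnorm p"
  moreover have "0 \<le> sqnorm p" by (simp add: sqnorm_def)
  ultimately have "sqnorm p = 0" by simp
  moreover have "integrable \<mu> (\<lambda>z. (cmod (poly p z))\<^sup>2)"
    by (intro integrable_cont continuous_intros)
  ultimately have AE: "AE z in \<mu>. poly p z = 0"
    unfolding sqnorm_def by (subst (asm) integral_nonneg_eq_0_iff_AE) auto
  have "measure_support \<mu> \<subseteq> {z. poly p z = 0}"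
  proof
    fix z assume z: "z \<in> measure_support \<mu>"
    show "z \<in> {z. poly p z = 0}"
    proof (rule ccontr)
      assume "z \<notin> {z. poly p z = 0}"
      moreover have o: "open {z. poly p z \<noteq> 0}"
        by (intro open_Collect_neq continuous_intros)
      moreover have "emeasure \<mu> {z. poly p z \<noteq> 0} = 0"
        using AE o AE_iff_measurable[of "{z. poly p z \<noteq> 0}" \<mu> "\<lambda>z. poly p z = 0"] by (auto simp: sets_M)
      ultimately show False using z unfolding measure_support_def by force
    qed
  qed
  then show False using assms poly_roots_finite[OF assms(2)] finite_subset
    by (auto simp: nontrivial_circle_prob_def)
qed

text \<open>The difference of two candidates has degree below n and is orthogonal to all such
  polynomials, hence to itself. This turns the \<open>THE\<close> in \<open>monic_OP\<close> into a
  usable value.\<close>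

lemma monic_OP_eqI:
  assumes "nontrivial_circle_prob \<mu>" "is_monic_OP \<mu> n p"
  shows "monic_OP \<mu> n = p"
  unfolding monic_OP_def
proof (rule the_equality)
  show "is_monic_OP \<mu> n p" by fact
next
  interpret circle_meas \<mu> by (rule nontrivial_circle_meas) fact
  fix q assume q: "is_monic_OP \<mu> n q"
  show "q = p"
  proof (rule ccontr)
    assume "q \<noteq> p"
    then have pos: "sqnorm (q - p) > 0" using sqnorm_pos[OF assms(1)] by simp
    have "orth n (q - p)"
      unfolding orth_def
    proof (intro allI impI)
      fix k assume k: "k < n"
      have "(\<integral>z. cnj (z ^ k) * poly (q - p) z \<partial>\<mu>) =
         (\<integral>z. cnj (z ^ k) * poly q z - cnj (z ^ k) * poly p z \<partial>\<mu>)" by (simp add: algebra_simps)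
      also have "\<dots> = (\<integral>z. cnj (z ^ k) * poly q z \<partial>\<mu>) - (\<integral>z. cnj (z ^ k) * poly p z \<partial>\<mu>)"
        by (intro Bochner_Integration.integral_diff integrable_cont continuous_intros)
      finally show "(\<integral>z. cnj (z ^ k) * poly (q - p) z \<partial>\<mu>) = 0"
        using q assms(2) k by (simp add: is_monic_OP_def)
    qed
    moreover have "coeff (q - p) i = 0" if "i \<ge> n" for i
      using that q assms(2) by (cases "i = n") (auto simp: is_monic_OP_def coeff_eq_0)
    ultimately have "(\<integral>z. cnj (poly (q - p) z) * poly (q - p) z \<partial>\<mu>) = 0" by (rule orth_poly)
    then show False using pos by (simp only: integral_cnj_mult_self of_real_eq_0_iff)
  qed
qed

text \<open>Ties the coefficients read off from the orthogonal polynomials at 0 to the recursion: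
  run with \<open>verblunsky \<mu>\<close>, it reproduces those polynomials. The strict bound comes
  from the positivity of consecutive norms.\<close>

lemma verblunsky_Phi:
  assumes "nontrivial_circle_prob \<mu>"
  shows "circle_meas.orth \<mu> n (Phi (verblunsky \<mu>) n)" "cmod (verblunsky \<mu> n) < 1"
proof -
  interpret circle_meas \<mu> by (rule nontrivial_circle_meas) fact
  let ?a = "verblunsky \<mu>"
  have step: "orth (Suc n) (Phi ?a (Suc n))" if IH: "orth n (Phi ?a n)" for n
  proof -
    have "Phi ?a n \<noteq> 0" using coeff_Phi_top[of ?a n] by auto
    then have pos: "sqnorm (Phi ?a n) > 0" by (rule sqnorm_pos[OF assms])
    \<comment> \<open>The only choice that makes z Phi_n - c Phis_n orthogonal to 1, since Phis_n
      has integral \<open>sqnorm (Phi ?a n)\<close>; both terms are already orthogonal to z, ...,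
      z^n.\<close>
    define c where "c = (\<integral>z. z * poly (Phi ?a n) z \<partial>\<mu>) / complex_of_real (sqnorm (Phi ?a n))"
    define p where "p = pCons 0 (Phi ?a n) - smult c (Phis ?a n)"
    have "orth (Suc n) p"
      unfolding orth_def
    proof (intro allI impI)
      fix k assume k: "k < Suc n"
      have "(\<integral>z. cnj (z ^ k) * poly p z \<partial>\<mu>) =
         (\<integral>z. cnj (z ^ k) * (z * poly (Phi ?a n) z) - c * (cnj (z ^ k) * poly (Phis ?a n) z) \<partial>\<mu>)"
        by (simp add: p_def algebra_simps)
      also have "\<dots> = (\<integral>z. cnj (z ^ k) * (z * poly (Phi ?a n) z) \<partial>\<mu>) - (\<integral>z. c * (cnj (z ^ k) * poly (Phis ?a n) z) \<partial>\<mu>)"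
        by (intro Bochner_Integration.integral_diff integrable_cont continuous_intros)
      also have "\<dots> = (\<integral>z. cnj (z ^ k) * (z * poly (Phi ?a n) z) \<partial>\<mu>) - c * (\<integral>z. cnj (z ^ k) * poly (Phis ?a n) z \<partial>\<mu>)"
        by (simp only: integral_mult_right_zero)
      also have "\<dots> = 0"
      proof (cases k)
        case 0
        then show ?thesis using integral_Phis[OF IH] pos by (simp add: c_def)
      next
        case (Suc m)
        have "(\<integral>z. cnj (z ^ k) * (z * poly (Phi ?a n) z) \<partial>\<mu>) = (\<integral>z. cnj (z ^ m) * poly (Phi ?a n) z \<partial>\<mu>)"
        proof (rule integral_cong_circle)
          fix z :: complex assume z: "cmod z = 1"
          have "cnj (z ^ k) * (z * poly (Phi ?a n) z) = (cnj z * z) * (cnj (z ^ m) * poly (Phi ?a n) z)"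
            by (simp add: Suc)
          also have "cnj z * z = 1" using z by (simp add: complex_norm_square[symmetric] mult.commute)
          finally show "cnj (z ^ k) * (z * poly (Phi ?a n) z) = cnj (z ^ m) * poly (Phi ?a n) z" by simp
        qed (auto intro!: continuous_intros)
        also have "\<dots> = 0" using IH k Suc by (simp add: orth_def)
        finally show ?thesis using orth_Phis[OF IH, of k] k Suc by simp
      qed
      finally show "(\<integral>z. cnj (z ^ k) * poly p z \<partial>\<mu>) = 0" .
    qed
    moreover have co: "coeff p (Suc n) = 1" "\<And>i. i > Suc n \<Longrightarrow> coeff p i = 0"
      using coeff_Phi_Phis_above[of n ?a] coeff_Phi_top[of ?a n]
      by (auto simp: p_def coeff_pCons split: nat.split)
    moreover have "degree p = Suc n"
      using co by (metis degree_le le_degree nle_le zero_neq_one)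
    ultimately have "is_monic_OP \<mu> (Suc n) p"
      by (simp add: is_monic_OP_def orth_def)
    then have "monic_OP \<mu> (Suc n) = p" by (rule monic_OP_eqI[OF assms])
    moreover have "poly (Phis ?a n) 0 = 1" by (induction n) auto
    \<comment> \<open>Evaluation at 0 recovers c: p (0) = - c Phis_n (0) = - c.\<close>
    ultimately have "?a n = cnj c" by (simp add: verblunsky_def p_def)
    then have "Phi ?a (Suc n) = p" by (simp add: p_def)
    with \<open>orth (Suc n) p\<close> show ?thesis by simp
  qed
  have orth: "orth n (Phi ?a n)" for n
    by (induction n) (simp add: orth_def, rule step)
  then show "orth n (Phi ?a n)" .
  have "Phi ?a k \<noteq> 0" for k using coeff_Phi_top[of ?a k] by auto
  then have pos: "sqnorm (Phi ?a k) > 0" for k by (rule sqnorm_pos[OF assms])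
  have "0 < (1 - (cmod (?a n))\<^sup>2) * sqnorm (Phi ?a n)"
    using sqnorm_Phi_Suc[OF orth[of "Suc n"]] pos[of "Suc n"] by (simp only:)
  then have "(cmod (?a n))\<^sup>2 < 1" using pos[of n] by (simp add: zero_less_mult_iff)
  then show "cmod (?a n) < 1" by (simp add: abs_square_less_1)
qed

section \<open>Integrals over the circle and Taylor expansion of the Schur iterates\<close>

lemma arc_measure_density:
  "arc_measure = density lborel (\<lambda>\<theta>. ennreal (indicator {0..2 * pi} \<theta> / (2 * pi)))"
proof -
  have "indicator {0..2 * pi} \<theta> / ennreal (2 * pi) = ennreal (indicator {0..2 * pi} \<theta> / (2 * pi))" for \<theta> :: real
    by (simp add: divide_ennreal[symmetric] ennreal_indicator)
  then show ?thesis by (simp add: arc_measure_def uniform_measure_def)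
qed

lemma sets_arc_measure [simp, measurable_cong]: "sets arc_measure = sets borel"
  by (simp add: arc_measure_density)

lemma space_arc_measure [simp]: "space arc_measure = UNIV"
  by (simp add: arc_measure_density)

lemma prob_space_arc_measure: "prob_space arc_measure"
  unfolding arc_measure_def by (rule prob_space_uniform_measure) auto

lemma cis_measurable_borel: "cis \<in> borel_measurable borel"
  by (intro borel_measurable_continuous_onI continuous_intros)

lemma AE_arc_measure: "AE \<theta> in arc_measure. \<theta> \<in> {0..2 * pi}"
  unfolding arc_measure_def by (rule AE_uniform_measureI) auto

lemma integrable_arc:
  fixes f :: "real \<Rightarrow> 'b::euclidean_space"
  assumes "continuous_on UNIV f"
  shows "integrable arc_measure f"
proof -
  interpret prob_space arc_measure by (rule prob_space_arc_measure)
  have "compact (f ` {0..2 * pi})"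
    using assms by (intro compact_continuous_image) (auto intro: continuous_on_subset)
  then obtain B where B: "\<And>\<theta>. \<theta> \<in> {0..2 * pi} \<Longrightarrow> norm (f \<theta>) \<le> B"
    by (force dest: compact_imp_bounded simp: bounded_iff)
  have "f \<in> borel_measurable arc_measure"
    unfolding measurable_cong_sets[OF sets_arc_measure refl]
    using assms by (rule borel_measurable_continuous_onI)
  moreover have "AE \<theta> in arc_measure. norm (f \<theta>) \<le> B"
    using AE_arc_measure by eventually_elim (rule B)
  ultimately show ?thesis by (rule integrable_const_bound[rotated])
qed

text \<open>Passes from the Bochner integral over \<open>arc_measure\<close> to the gauge integral,
  in which contour integrals are stated.\<close>

lemma integral_arc:
  fixes f :: "real \<Rightarrow> 'b::euclidean_space"
  assumes "continuous_on UNIV f"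
  shows "(\<integral>\<theta>. f \<theta> \<partial>arc_measure) = (1 / (2 * pi)) *\<^sub>R integral {0..2 * pi} f"
proof -
  have "(\<integral>\<theta>. f \<theta> \<partial>arc_measure) = (\<integral>\<theta>. (indicator {0..2 * pi} \<theta> / (2 * pi)) *\<^sub>R f \<theta> \<partial>lborel)"
    unfolding arc_measure_density
    by (rule integral_density) (use assms in \<open>auto intro: borel_measurable_continuous_onI\<close>)
  also have "\<dots> = (\<integral>\<theta>. (1 / (2 * pi)) *\<^sub>R (indicator {0..2 * pi} \<theta> *\<^sub>R f \<theta>) \<partial>lborel)"
    by (simp only: scaleR_scaleR times_divide_eq_left mult_1_left)
  also have "\<dots> = (1 / (2 * pi)) *\<^sub>R (LINT \<theta>:{0..2 * pi}|lborel. f \<theta>)"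
    unfolding set_lebesgue_integral_def by (rule integral_scaleR_right)
  also have "(LINT \<theta>:{0..2 * pi}|lborel. f \<theta>) = integral {0..2 * pi} f"
    using assms by (intro set_borel_integral_eq_integral borel_integrable_atLeastAtMost')
      (auto intro: continuous_on_subset)
  finally show ?thesis .
qed

section \<open>The mean value property and integration against the weight\<close>

lemma analytic_cball_continuous_cis:
  assumes "F analytic_on cball 0 1" shows "continuous_on UNIV (\<lambda>\<theta>. F (cis \<theta>))"
proof -
  have "continuous_on (cball 0 1) F"
    using assms by (intro holomorphic_on_imp_continuous_on analytic_imp_holomorphic)
  then show ?thesis
    by (rule continuous_on_compose2) (auto intro!: continuous_intros)
qed

text \<open>Cauchy's formula at the centre. Analyticity on the closed disc means analyticity in a
  neighbourhood of it, which includes continuity up to the circle.\<close>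

lemma mean_value_circle:
  assumes "F analytic_on cball 0 1"
  shows "(\<integral>\<theta>. F (cis \<theta>) \<partial>arc_measure) = F 0"
proof -
  have hol: "F holomorphic_on cball 0 1" using assms by (rule analytic_imp_holomorphic)
  have "((\<lambda>u. F u / (u - 0)) has_contour_integral (2 * of_real pi * \<i> * F 0)) (circlepath 0 1)"
    using hol by (intro Cauchy_integral_circlepath holomorphic_on_imp_continuous_on)
      (auto intro: holomorphic_on_subset)
  then have "((\<lambda>t. F (0 + complex_of_real 1 * cis t) / (0 + complex_of_real 1 * cis t - 0) * complex_of_real 1 * \<i> * cis t)
      has_integral (2 * of_real pi * \<i> * F 0)) {0..2 * pi}"
    unfolding circlepath_def by (subst (asm) has_contour_integral_part_circlepath_iff) auto
  then have "((\<lambda>t. \<i> * F (cis t)) has_integral (2 * of_real pi * \<i> * F 0)) {0..2 * pi}"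
    by (rule has_integral_eq[rotated]) (simp add: field_simps)
  then have "((\<lambda>t. (- \<i>) * (\<i> * F (cis t))) has_integral ((- \<i>) * (2 * of_real pi * \<i> * F 0))) {0..2 * pi}"
    by (rule has_integral_mult_right)
  then have "((\<lambda>t. F (cis t)) has_integral (2 * of_real pi * F 0)) {0..2 * pi}"
    by (simp add: mult_ac)
  then have "integral {0..2 * pi} (\<lambda>t. F (cis t)) = 2 * of_real pi * F 0" by (rule integral_unique)
  then show ?thesis
    by (simp add: integral_arc[OF analytic_cball_continuous_cis[OF assms]] scaleR_conv_of_real)
qed

text \<open>Equality of Taylor polynomials modulo z^k, encoded by an explicit analytic remainder
  instead of derivatives. The equation is required on the closed disc only, because that is where
  the denominators of the quotients to be compared are known not to vanish.\<close>

definition zcong :: "nat \<Rightarrow> (complex \<Rightarrow> complex) \<Rightarrow> (complex \<Rightarrow> complex) \<Rightarrow> bool" where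
  "zcong k F G \<longleftrightarrow> (\<exists>r. r analytic_on cball 0 1 \<and> (\<forall>z\<in>cball 0 1. F z = G z + z ^ k * r z))"

lemma zcongI:
  assumes "r analytic_on cball 0 1" "\<And>z. cmod z \<le> 1 \<Longrightarrow> F z = G z + z ^ k * r z"
  shows "zcong k F G"
  using assms unfolding zcong_def by (intro exI[of _ r]) auto

lemma zcong_trans [trans]: "zcong k F G \<Longrightarrow> zcong k G H \<Longrightarrow> zcong k F H"
  unfolding zcong_def
proof clarify
  fix r s
  assume *: "r analytic_on cball 0 1" "\<forall>z\<in>cball 0 1. F z = G z + z ^ k * r z"
    "s analytic_on cball 0 1" "\<forall>z\<in>cball 0 1. G z = H z + z ^ k * s z"
  show "\<exists>r. r analytic_on cball 0 1 \<and> (\<forall>z\<in>cball 0 1. F z = H z + z ^ k * r z)"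
    using * by (intro exI[of _ "\<lambda>z. r z + s z"]) (auto intro!: analytic_intros simp: algebra_simps)
qed

lemma zcong_mult:
  assumes "zcong k F F'" "zcong k G G'" "F' analytic_on cball 0 1" "G' analytic_on cball 0 1"
  shows "zcong k (\<lambda>z. F z * G z) (\<lambda>z. F' z * G' z)"
proof -
  from assms obtain r s where r: "r analytic_on cball 0 1" "\<forall>z\<in>cball 0 1. F z = F' z + z ^ k * r z"
    and s: "s analytic_on cball 0 1" "\<forall>z\<in>cball 0 1. G z = G' z + z ^ k * s z"
    unfolding zcong_def by auto
  show ?thesis
  proof (rule zcongI)
    show "(\<lambda>z. F' z * s z + G' z * r z + z ^ k * r z * s z) analytic_on cball 0 1"
      using r s assms by (intro analytic_intros)
  qed (use r s in \<open>simp add: algebra_simps\<close>)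
qed

text \<open>Splits the product into an analytic part and the conjugate of an analytic part vanishing at \<open>0\<close>,
  which has mean zero on the circle.\<close>

lemma sin4_cis:
  fixes z c0 c1 c2 c3 c4 r :: complex
  assumes "cmod z = 1"
  shows "complex_of_real (Im z ^ 4) * (c0 + c1 * z + c2 * z\<^sup>2 + c3 * z ^ 3 + c4 * z ^ 4 + z ^ 5 * r)
   = ((z ^ 4 - 4 * z\<^sup>2 + 6) * (c0 + c1 * z + c2 * z\<^sup>2 + c3 * z ^ 3 + c4 * z ^ 4 + z ^ 5 * r)
      - 4 * (c2 + c3 * z + c4 * z\<^sup>2 + z ^ 3 * r) + (c4 + z * r)) / 16
     + cnj ((- 4 * (cnj c0 * z\<^sup>2 + cnj c1 * z) + (cnj c0 * z ^ 4 + cnj c1 * z ^ 3 + cnj c2 * z\<^sup>2 + cnj c3 * z)) / 16)"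
proof -
  \<comment> \<open>On the circle y = 1 / z, so the weight is the Laurent polynomial (z - y)^4 / 16.
    Against the Taylor expansion, y^2 leaves negative powers only at c0, c1 and y^4 only at c0, ...,
    c3; these make up the conjugated part.\<close>
  define y where "y = cnj z"
  have zy: "z * y = 1" using assms by (simp add: y_def complex_norm_square[symmetric])
  have I: "complex_of_real (Im z) = (z - y) / (2 * \<i>)"
    by (simp add: y_def complex_eq_iff)
  have "complex_of_real (Im z ^ 4) = (z - y) ^ 4 / 16"
    unfolding of_real_power I by (simp add: power_divide power_mult_distrib)
  also have "(z - y) ^ 4 = z ^ 4 - 4 * z\<^sup>2 * (z * y) + 6 * (z * y) * (z * y) - 4 * y\<^sup>2 * (z * y) + y ^ 4"
    by (simp add: power_numeral_reduce algebra_simps)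
  also have "\<dots> = z ^ 4 - 4 * z\<^sup>2 + 6 - 4 * y\<^sup>2 + y ^ 4" by (simp add: zy)
  finally have S: "complex_of_real (Im z ^ 4) = (z ^ 4 - 4 * z\<^sup>2 + 6 - 4 * y\<^sup>2 + y ^ 4) / 16" .
  have y1: "y * z = 1" "y * (z * x) = x" for x using zy by (simp_all add: mult.commute mult.left_commute)
  have 2: "y\<^sup>2 * (c0 + c1 * z + c2 * z\<^sup>2 + c3 * z ^ 3 + c4 * z ^ 4 + z ^ 5 * r)
      = c0 * y\<^sup>2 + c1 * y + (c2 + c3 * z + c4 * z\<^sup>2 + z ^ 3 * r)"
    by (simp add: power_numeral_reduce algebra_simps y1 mult.left_commute[of z y])
  have 4: "y ^ 4 * (c0 + c1 * z + c2 * z\<^sup>2 + c3 * z ^ 3 + c4 * z ^ 4 + z ^ 5 * r)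
      = c0 * y ^ 4 + c1 * y ^ 3 + c2 * y\<^sup>2 + c3 * y + (c4 + z * r)"
    by (simp add: power_numeral_reduce algebra_simps y1 mult.left_commute[of z y])
  let ?P = "c0 + c1 * z + c2 * z\<^sup>2 + c3 * z ^ 3 + c4 * z ^ 4 + z ^ 5 * r"
  have "complex_of_real (Im z ^ 4) * ?P = ((z ^ 4 - 4 * z\<^sup>2 + 6) * ?P - 4 * (y\<^sup>2 * ?P) + y ^ 4 * ?P) / 16"
    unfolding S by (simp add: algebra_simps)
  moreover have "cnj ((- 4 * (cnj c0 * z\<^sup>2 + cnj c1 * z) + (cnj c0 * z ^ 4 + cnj c1 * z ^ 3 + cnj c2 * z\<^sup>2 + cnj c3 * z)) / 16)
     = (- 4 * (c0 * y\<^sup>2 + c1 * y) + (c0 * y ^ 4 + c1 * y ^ 3 + c2 * y\<^sup>2 + c3 * y)) / 16"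
    by (simp add: y_def)
  ultimately show ?thesis
    unfolding 2 4 by (simp only: add_divide_distrib[symmetric]) (simp add: algebra_simps)
qed

text \<open>The value at 0 of the analytic part in \<open>sin4_cis\<close>: the Fourier coefficients
  6/16, -4/16, 1/16 of sin^4 pair with the Taylor coefficients of orders 0, 2, 4.\<close>

lemma integral_sin4:
  assumes "zcong 5 F (\<lambda>z. c0 + c1 * z + c2 * z\<^sup>2 + c3 * z ^ 3 + c4 * z ^ 4)"
  shows "(\<integral>\<theta>. complex_of_real (sin \<theta> ^ 4) * F (cis \<theta>) \<partial>arc_measure) = (6 * c0 - 4 * c2 + c4) / 16"
proof -
  from assms obtain r where r: "r analytic_on cball 0 1"
    and F: "\<And>z. cmod z \<le> 1 \<Longrightarrow> F z = c0 + c1 * z + c2 * z\<^sup>2 + c3 * z ^ 3 + c4 * z ^ 4 + z ^ 5 * r z"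
    unfolding zcong_def by auto
  define A where "A z = ((z ^ 4 - 4 * z\<^sup>2 + 6) * (c0 + c1 * z + c2 * z\<^sup>2 + c3 * z ^ 3 + c4 * z ^ 4 + z ^ 5 * r z)
      - 4 * (c2 + c3 * z + c4 * z\<^sup>2 + z ^ 3 * r z) + (c4 + z * r z)) / 16" for z
  define B where "B z = (- 4 * (cnj c0 * z\<^sup>2 + cnj c1 * z) + (cnj c0 * z ^ 4 + cnj c1 * z ^ 3 + cnj c2 * z\<^sup>2 + cnj c3 * z)) / 16" for z
  have A: "A analytic_on cball 0 1" and B: "B analytic_on cball 0 1"
    unfolding A_def B_def using r by (auto intro!: analytic_intros)
  have "(\<integral>\<theta>. complex_of_real (sin \<theta> ^ 4) * F (cis \<theta>) \<partial>arc_measure) = (\<integral>\<theta>. A (cis \<theta>) + cnj (B (cis \<theta>)) \<partial>arc_measure)"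
  proof (rule Bochner_Integration.integral_cong)
    fix \<theta>
    show "complex_of_real (sin \<theta> ^ 4) * F (cis \<theta>) = A (cis \<theta>) + cnj (B (cis \<theta>))"
      using sin4_cis[of "cis \<theta>" c0 c1 c2 c3 c4 "r (cis \<theta>)"] F[of "cis \<theta>"]
      unfolding A_def B_def by (simp only: norm_cis cis.sel order_refl)
  qed simp
  also have "\<dots> = (\<integral>\<theta>. A (cis \<theta>) \<partial>arc_measure) + (\<integral>\<theta>. cnj (B (cis \<theta>)) \<partial>arc_measure)"
    by (intro Bochner_Integration.integral_add integrable_arc continuous_on_cnj analytic_cball_continuous_cis A B)
  also have "\<dots> = A 0 + cnj (B 0)"
    by (simp add: mean_value_circle A B)
  also have "\<dots> = (6 * c0 - 4 * c2 + c4) / 16"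
    by (simp add: A_def B_def)
  finally show ?thesis .
qed

text \<open>With coefficients in the disc this is a finite Blaschke product. The factor z is
  included so that powers vanish at 0 to increasing order and the recursion for \<open>Phis\<close>
  becomes multiplication by 1 - a_n b_n.\<close>

definition schurb :: "(nat \<Rightarrow> complex) \<Rightarrow> nat \<Rightarrow> complex \<Rightarrow> complex" where
  "schurb a n z = z * poly (Phi a n) z / poly (Phis a n) z"

lemma Re_of_real_times: "Re (complex_of_real r * z) = r * Re z"
  by simp

lemma poly_analytic_on: "(\<lambda>z. poly p z) analytic_on S"
  by (rule analytic_on_subset[of _ UNIV]) (auto simp: analytic_on_open intro!: holomorphic_intros)

section \<open>The functions b_n: bounds, recursion, Taylor coefficients up to order 4\<close>

locale disc_seq =
  fixes a :: "nat \<Rightarrow> complex"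
  assumes lt1: "cmod (a i) < 1"
begin

lemma Phis_bound:
  assumes "cmod z \<le> 1"
  shows "poly (Phis a n) z \<noteq> 0" "cmod z * cmod (poly (Phi a n) z) \<le> cmod (poly (Phis a n) z)"
  using Phis_nonzero_and_bound[of a z n] lt1 assms by (auto simp: norm_mult)

lemma schurb_le_1: "cmod z \<le> 1 \<Longrightarrow> cmod (schurb a n z) \<le> 1"
  using Phis_bound[of z n] by (simp add: schurb_def norm_divide norm_mult)

lemma schurb_analytic: "schurb a n analytic_on cball 0 1"
proof -
  have "(\<lambda>z. z * poly (Phi a n) z / poly (Phis a n) z) analytic_on cball 0 1"
    using Phis_bound(1) by (intro analytic_intros poly_analytic_on) auto
  then show ?thesis by (simp add: schurb_def[abs_def])
qed

lemma schurb_mult_le: "cmod z \<le> 1 \<Longrightarrow> cmod (a n * schurb a m z) \<le> cmod (a n)"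
  using schurb_le_1[of z m] by (simp add: norm_mult mult_left_le)

lemma schurb_ne: "cmod z \<le> 1 \<Longrightarrow> 1 - a n * schurb a m z \<noteq> 0"
  using schurb_mult_le[of z n m] lt1[of n] by fastforce

lemma Phis_Suc_schurb: "cmod z \<le> 1 \<Longrightarrow> poly (Phis a (Suc n)) z = poly (Phis a n) z * (1 - a n * schurb a n z)"
  using Phis_bound[of z n] by (simp add: schurb_def field_simps)

lemma schurb_Suc:
  assumes "cmod z \<le> 1"
  shows "schurb a (Suc n) z = z * (schurb a n z - cnj (a n)) / (1 - a n * schurb a n z)"
proof -
  have P: "poly (Phi a (Suc n)) z = poly (Phis a n) z * (schurb a n z - cnj (a n))"
    using Phis_bound(1)[OF assms, of n] by (simp add: schurb_def field_simps)
  show ?thesis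
    using Phis_bound(1)[OF assms, of n]
    by (simp add: schurb_def[of a "Suc n"] Phis_Suc_schurb[OF assms] P del: Phi.simps Phis.simps)
qed

text \<open>One has (b - cnj a) / (1 - a b) = - cnj a + rho b / (1 - a b), and the geometric series
  is cut after a^2 b^3, as the tail a^3 b^4 / (1 - a b) has order 4. The outer factor z raises all
  orders by one: x4 drops out, and each further step loses one more of the old coefficients.\<close>

lemma schurb_taylor_step:
  assumes "zcong 5 (schurb a n) (\<lambda>z. x1 * z + x2 * z\<^sup>2 + x3 * z ^ 3 + x4 * z ^ 4)"
  defines "\<rho> \<equiv> 1 - a n * cnj (a n)"
  shows "zcong 5 (schurb a (Suc n)) (\<lambda>z. - cnj (a n) * z + \<rho> * x1 * z\<^sup>2 + \<rho> * (x2 + a n * x1\<^sup>2) * z ^ 3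
      + \<rho> * (x3 + 2 * a n * x1 * x2 + (a n)\<^sup>2 * x1 ^ 3) * z ^ 4)"
proof -
  let ?b = "schurb a n"
  from assms obtain r where r: "r analytic_on cball 0 1"
    and b: "\<And>z. cmod z \<le> 1 \<Longrightarrow> ?b z = z * (x1 + x2 * z + x3 * z\<^sup>2 + x4 * z ^ 3 + z ^ 4 * r z)"
    unfolding zcong_def by (force simp: algebra_simps power_numeral_reduce)
  define h where "h z = x1 + x2 * z + x3 * z\<^sup>2 + x4 * z ^ 3 + z ^ 4 * r z" for z
  have h: "h analytic_on cball 0 1" unfolding h_def using r by (auto intro!: analytic_intros)
  define s where "s z = x3 + x4 * z + z\<^sup>2 * r z" for z
  have s: "s analytic_on cball 0 1" unfolding s_def using r by (auto intro!: analytic_intros)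
  have hs: "h z = x1 + x2 * z + z\<^sup>2 * s z" for z
    by (simp add: h_def s_def algebra_simps power_numeral_reduce)
  \<comment> \<open>Everything of order at least 4 inside the bracket, divided by z^4; the outer
    factor z turns it into a remainder of order 5.\<close>
  define R where "R z = \<rho> * (x4 + z * r z + a n * (x2\<^sup>2 + 2 * x1 * s z + 2 * x2 * z * s z + z\<^sup>2 * (s z)\<^sup>2)
      + (a n)\<^sup>2 * (3 * x1\<^sup>2 * (x2 + z * s z) + 3 * x1 * z * (x2 + z * s z)\<^sup>2 + z\<^sup>2 * (x2 + z * s z) ^ 3)
      + (a n) ^ 3 * h z ^ 4 / (1 - a n * ?b z))" for z
  show ?thesis
  proof (rule zcongI)
    show "R analytic_on cball 0 1"
      unfolding R_def using r s h schurb_ne by (intro analytic_intros schurb_analytic) auto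
  next
    fix z :: complex assume z: "cmod z \<le> 1"
    have ne: "1 - a n * ?b z \<noteq> 0" by (rule schurb_ne[OF z])
    have *: "(?b z - cnj (a n)) / (1 - a n * ?b z) = - cnj (a n) + \<rho> * (?b z + a n * (?b z)\<^sup>2 + (a n)\<^sup>2 * ?b z ^ 3
        + (a n) ^ 3 * ?b z ^ 4 / (1 - a n * ?b z))"
      using ne by (simp add: \<rho>_def field_simps) (simp add: algebra_simps power_numeral_reduce)
    \<comment> \<open>The quotient stays opaque from here on, which leaves a polynomial
      identity.\<close>
    define d where "d = 1 - a n * ?b z"
    define q where "q = (a n) ^ 3 * h z ^ 4 / d"
    have "(?b z - cnj (a n)) / (1 - a n * ?b z) = - cnj (a n) + \<rho> * (?b z + a n * (?b z)\<^sup>2 + (a n)\<^sup>2 * ?b z ^ 3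
        + (a n) ^ 3 * ?b z ^ 4 / d)"
      using * by (simp only: d_def)
    then have e: "schurb a (Suc n) z = z * (- cnj (a n) + \<rho> * (?b z + a n * (?b z)\<^sup>2 + (a n)\<^sup>2 * ?b z ^ 3
        + (a n) ^ 3 * ?b z ^ 4 / d))"
      by (simp only: schurb_Suc[OF z] times_divide_eq_right[symmetric])
    have bz: "?b z = z * h z" using b[OF z] by (simp add: h_def)
    have 1: "?b z = x1 * z + x2 * z\<^sup>2 + z ^ 3 * x3 + z ^ 4 * (x4 + z * r z)"
      by (simp add: bz h_def algebra_simps power_numeral_reduce)
    have 2: "(?b z)\<^sup>2 = x1\<^sup>2 * z\<^sup>2 + 2 * x1 * x2 * z ^ 3
        + z ^ 4 * (x2\<^sup>2 + 2 * x1 * s z + 2 * x2 * z * s z + z\<^sup>2 * (s z)\<^sup>2)"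
      by (simp add: bz hs algebra_simps power_numeral_reduce)
    have 3: "?b z ^ 3 = x1 ^ 3 * z ^ 3 + z ^ 4 * (3 * x1\<^sup>2 * (x2 + z * s z) + 3 * x1 * z * (x2 + z * s z)\<^sup>2 + z\<^sup>2 * (x2 + z * s z) ^ 3)"
      by (simp add: bz hs algebra_simps power_numeral_reduce)
    have 4: "?b z ^ 4 = z ^ 4 * h z ^ 4" by (simp add: bz power_mult_distrib)
    have "schurb a (Suc n) z = z * (- cnj (a n) + \<rho> * (x1 * z + x2 * z\<^sup>2 + z ^ 3 * x3 + z ^ 4 * (x4 + z * r z)
       + a n * (x1\<^sup>2 * z\<^sup>2 + 2 * x1 * x2 * z ^ 3
        + z ^ 4 * (x2\<^sup>2 + 2 * x1 * s z + 2 * x2 * z * s z + z\<^sup>2 * (s z)\<^sup>2)) + (a n)\<^sup>2 *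
        (x1 ^ 3 * z ^ 3 + z ^ 4 * (3 * x1\<^sup>2 * (x2 + z * s z) + 3 * x1 * z * (x2 + z * s z)\<^sup>2 + z\<^sup>2 * (x2 + z * s z) ^ 3))
        + z ^ 4 * q))"
      unfolding e 4 2 3 by (subst 1) (simp only: q_def times_divide_eq_right mult.left_commute[of _ "z ^ 4"])
    also have "\<dots> = - cnj (a n) * z + \<rho> * x1 * z\<^sup>2 + \<rho> * (x2 + a n * x1\<^sup>2) * z ^ 3
      + \<rho> * (x3 + 2 * a n * x1 * x2 + (a n)\<^sup>2 * x1 ^ 3) * z ^ 4 + z ^ 5 * R z"
      unfolding R_def d_def[symmetric] q_def[symmetric] by (simp add: algebra_simps power_numeral_reduce)
    finally show "schurb a (Suc n) z = - cnj (a n) * z + \<rho> * x1 * z\<^sup>2 + \<rho> * (x2 + a n * x1\<^sup>2) * z ^ 3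
      + \<rho> * (x3 + 2 * a n * x1 * x2 + (a n)\<^sup>2 * x1 ^ 3) * z ^ 4 + z ^ 5 * R z" .
  qed
qed

end

context disc_seq
begin

text \<open>b_n is divisible by z, so its powers beyond the fourth have no Taylor coefficient that
  the weight could see.\<close>

lemma schurb_power_high:
  assumes "zcong 5 (schurb a n) (\<lambda>z. x1 * z + x2 * z\<^sup>2 + x3 * z ^ 3 + x4 * z ^ 4)" "k \<ge> 5"
  shows "zcong 5 (\<lambda>z. schurb a n z ^ k) (\<lambda>z. 0 + 0 * z + 0 * z\<^sup>2 + 0 * z ^ 3 + 0 * z ^ 4)"
proof -
  from assms obtain r where r: "r analytic_on cball 0 1"
    and b: "\<And>z. cmod z \<le> 1 \<Longrightarrow> schurb a n z = z * (x1 + x2 * z + x3 * z\<^sup>2 + x4 * z ^ 3 + z ^ 4 * r z)"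
    unfolding zcong_def by (force simp: algebra_simps power_numeral_reduce)
  show ?thesis
  proof (rule zcongI)
    show "(\<lambda>z. z ^ (k - 5) * (x1 + x2 * z + x3 * z\<^sup>2 + x4 * z ^ 3 + z ^ 4 * r z) ^ k) analytic_on cball 0 1"
      using r by (intro analytic_intros)
    fix z :: complex assume "cmod z \<le> 1"
    from b[OF this] show "schurb a n z ^ k = 0 + 0 * z + 0 * z\<^sup>2 + 0 * z ^ 3 + 0 * z ^ 4
        + z ^ 5 * (z ^ (k - 5) * (x1 + x2 * z + x3 * z\<^sup>2 + x4 * z ^ 3 + z ^ 4 * r z) ^ k)"
      using assms(2) by (simp add: power_mult_distrib flip: power_add)
  qed
qed

text \<open>The series ln (1 - a b) = - sum (a b)^k / k is integrated term by term, dominated by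
  |a|^k. Only k = 1, ..., 4 survive against the weight, and each is read off from the coefficients
  of b^k at the orders 2 and 4.\<close>

lemma integral_sin4_log_schurb:
  assumes "zcong 5 (schurb a n) (\<lambda>z. x1 * z + x2 * z\<^sup>2 + x3 * z ^ 3 + x4 * z ^ 4)"
  shows "(\<integral>\<theta>. sin \<theta> ^ 4 * ln (cmod (1 - a n * schurb a n (cis \<theta>))) \<partial>arc_measure)
     = - Re (a n * (x4 - 4 * x2) + (a n)\<^sup>2 * (2 * x1 * x3 + x2\<^sup>2 - 4 * x1\<^sup>2) / 2
         + (a n) ^ 3 * x1\<^sup>2 * x2 + (a n) ^ 4 * x1 ^ 4 / 4) / 16"
proof -
  interpret prob_space arc_measure by (rule prob_space_arc_measure)
  let ?b = "schurb a n"
  define A where "A = a n"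
  define f where "f k \<theta> = complex_of_real (sin \<theta> ^ 4) * (- ((A * ?b (cis \<theta>)) ^ k) / of_nat k)" for k :: nat and \<theta>
  define I where "I k = (\<integral>\<theta>. complex_of_real (sin \<theta> ^ 4) * ?b (cis \<theta>) ^ k \<partial>arc_measure)" for k
  have cb: "continuous_on UNIV (\<lambda>\<theta>. ?b (cis \<theta>))"
    by (intro analytic_cball_continuous_cis schurb_analytic)
  have gA: "cmod (A * ?b (cis \<theta>)) \<le> cmod A" for \<theta>
    using schurb_mult_le[of "cis \<theta>" n n] by (simp add: A_def)
  have A1: "cmod A < 1" by (simp add: A_def lt1)
  have int_f: "integrable arc_measure (f k)" for k
    by (cases "k = 0") (auto simp: f_def intro!: integrable_arc continuous_intros cb)
  \<comment> \<open>For k = 0 the division by 0 makes the term 0, in agreement with the logarithmic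
    series. For k > 0 the weight and 1 / k are at most 1, which leaves a geometric bound.\<close>
  have f_le: "norm (f k \<theta>) \<le> cmod A ^ k" for k \<theta>
  proof (cases "k = 0")
    case True then show ?thesis by (simp add: f_def)
  next
    case False
    have "\<bar>sin \<theta> ^ 4\<bar> \<le> 1" unfolding power_abs by (rule power_le_one) auto
    moreover have "cmod (A * ?b (cis \<theta>)) ^ k / real k \<le> cmod A ^ k / 1"
      using gA False by (intro frac_le power_mono) auto
    ultimately have "\<bar>sin \<theta> ^ 4\<bar> * (cmod (A * ?b (cis \<theta>)) ^ k / real k) \<le> 1 * (cmod A ^ k / 1)"
      by (intro mult_mono) auto
    then show ?thesis unfolding f_def by (simp add: norm_mult norm_divide norm_power power_mult_distrib)
  qed
  have sumA: "summable (\<lambda>k. cmod A ^ k)" using A1 by (intro summable_geometric) simp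
  have "(\<lambda>k. integral\<^sup>L arc_measure (f k)) sums (\<integral>\<theta>. (\<Sum>k. f k \<theta>) \<partial>arc_measure)"
  proof (rule sums_integral[OF int_f])
    show "AE \<theta> in arc_measure. summable (\<lambda>k. norm (f k \<theta>))"
      using f_le by (intro AE_I2 summable_comparison_test'[OF sumA]) auto
    show "summable (\<lambda>k. \<integral>\<theta>. norm (f k \<theta>) \<partial>arc_measure)"
    proof (rule summable_comparison_test'[OF sumA])
      fix k
      have "(\<integral>\<theta>. norm (f k \<theta>) \<partial>arc_measure) \<le> (\<integral>\<theta>. cmod A ^ k \<partial>arc_measure)"
        using int_f f_le by (intro integral_mono) auto
      then show "norm (\<integral>\<theta>. norm (f k \<theta>) \<partial>arc_measure) \<le> cmod A ^ k"
        using prob_space by simp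
    qed
  qed
  moreover have "(\<Sum>k. f k \<theta>) = complex_of_real (sin \<theta> ^ 4) * ln (1 - A * ?b (cis \<theta>))" for \<theta>
  proof -
    have "(\<lambda>k. - ((- (- (A * ?b (cis \<theta>)))) ^ k) / of_nat k) sums ln (1 + - (A * ?b (cis \<theta>)))"
      using gA[of \<theta>] A1 by (intro Ln_series') (simp add: norm_minus_cancel)
    then have "(\<lambda>k. f k \<theta>) sums (complex_of_real (sin \<theta> ^ 4) * ln (1 - A * ?b (cis \<theta>)))"
      unfolding f_def by (intro sums_mult) simp
    then show ?thesis by (simp add: sums_iff)
  qed
  moreover have If: "integral\<^sup>L arc_measure (f k) = - (A ^ k / of_nat k) * I k" for k
  proof -
    have "f k = (\<lambda>\<theta>. - (A ^ k / of_nat k) * (complex_of_real (sin \<theta> ^ 4) * ?b (cis \<theta>) ^ k))"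
      by (simp add: f_def fun_eq_iff power_mult_distrib)
    then show ?thesis unfolding I_def by (simp only: integral_mult_right_zero)
  qed
  ultimately have "(\<lambda>k. - (A ^ k / of_nat k) * I k) sums
      (\<integral>\<theta>. complex_of_real (sin \<theta> ^ 4) * ln (1 - A * ?b (cis \<theta>)) \<partial>arc_measure)" by simp
  moreover have "I k = 0" if "k \<ge> 5" for k
    unfolding I_def using integral_sin4[OF schurb_power_high[OF assms that]] by simp
  then have "(\<lambda>k. - (A ^ k / of_nat k) * I k) sums (\<Sum>k\<in>{1,2,3,4}. - (A ^ k / of_nat k) * I k)"
  proof (intro sums_finite)
    fix k :: nat assume *: "k \<notin> {1,2,3,4}" "\<And>k. k \<ge> 5 \<Longrightarrow> I k = 0"
    then have "k = 0 \<or> k \<ge> 5" by auto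
    then show "- (A ^ k / of_nat k) * I k = 0" using * by auto
  qed simp
  ultimately have eq: "(\<integral>\<theta>. complex_of_real (sin \<theta> ^ 4) * ln (1 - A * ?b (cis \<theta>)) \<partial>arc_measure)
     = (\<Sum>k\<in>{1,2,3,4}. - (A ^ k / of_nat k) * I k)"
    by (rule sums_unique2)
  let ?p = "\<lambda>z. x1 * z + x2 * z\<^sup>2 + x3 * z ^ 3 + x4 * z ^ 4"
  have pa: "(\<lambda>z. ?p z) analytic_on cball 0 1" by (intro analytic_intros)
  have z1: "zcong 5 ?b (\<lambda>z. 0 + x1 * z + x2 * z\<^sup>2 + x3 * z ^ 3 + x4 * z ^ 4)"
    using assms by simp
  \<comment> \<open>Powers are built one factor at a time. Each witness given to
    \<open>zcongI\<close> is the cofactor of z^5 in the product of the two polynomials.\<close>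
  have c2: "zcong 5 (\<lambda>z. ?b z * ?b z) (\<lambda>z. ?p z * ?p z)"
    by (intro zcong_mult assms pa)
  also have "zcong 5 (\<lambda>z. ?p z * ?p z) (\<lambda>z. 0 + 0 * z + x1\<^sup>2 * z\<^sup>2 + (2 * x1 * x2) * z ^ 3 + (2 * x1 * x3 + x2\<^sup>2) * z ^ 4)"
    by (rule zcongI[of "\<lambda>z. 2 * x1 * x4 + 2 * x2 * x3 + (2 * x2 * x4 + x3\<^sup>2) * z + 2 * x3 * x4 * z\<^sup>2 + x4\<^sup>2 * z ^ 3"],
        intro analytic_intros) (simp add: algebra_simps power_numeral_reduce)
  finally have z2: "zcong 5 (\<lambda>z. ?b z * ?b z) (\<lambda>z. 0 + 0 * z + x1\<^sup>2 * z\<^sup>2 + (2 * x1 * x2) * z ^ 3 + (2 * x1 * x3 + x2\<^sup>2) * z ^ 4)" .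
  have "zcong 5 (\<lambda>z. (?b z * ?b z) * ?b z) (\<lambda>z. (0 + 0 * z + x1\<^sup>2 * z\<^sup>2 + (2 * x1 * x2) * z ^ 3 + (2 * x1 * x3 + x2\<^sup>2) * z ^ 4) * ?p z)"
    by (intro zcong_mult assms z2 pa analytic_intros)
  also have "zcong 5 (\<lambda>z. (0 + 0 * z + x1\<^sup>2 * z\<^sup>2 + (2 * x1 * x2) * z ^ 3 + (2 * x1 * x3 + x2\<^sup>2) * z ^ 4) * ?p z)
       (\<lambda>z. 0 + 0 * z + 0 * z\<^sup>2 + x1 ^ 3 * z ^ 3 + (3 * x1\<^sup>2 * x2) * z ^ 4)"
    by (rule zcongI[of "\<lambda>z. (x1\<^sup>2 * x3 + 2 * x1 * x2 * x2 + (2 * x1 * x3 + x2\<^sup>2) * x1)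
       + (x1\<^sup>2 * x4 + 2 * x1 * x2 * x3 + (2 * x1 * x3 + x2\<^sup>2) * x2) * z
       + (2 * x1 * x2 * x4 + (2 * x1 * x3 + x2\<^sup>2) * x3) * z\<^sup>2
       + (2 * x1 * x3 + x2\<^sup>2) * x4 * z ^ 3"],
        intro analytic_intros) (simp add: algebra_simps power_numeral_reduce)
  finally have z3: "zcong 5 (\<lambda>z. (?b z * ?b z) * ?b z) (\<lambda>z. 0 + 0 * z + 0 * z\<^sup>2 + x1 ^ 3 * z ^ 3 + (3 * x1\<^sup>2 * x2) * z ^ 4)" .
  have "zcong 5 (\<lambda>z. ((?b z * ?b z) * ?b z) * ?b z) (\<lambda>z. (0 + 0 * z + 0 * z\<^sup>2 + x1 ^ 3 * z ^ 3 + (3 * x1\<^sup>2 * x2) * z ^ 4) * ?p z)"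
    by (intro zcong_mult assms z3 pa analytic_intros)
  also have "zcong 5 (\<lambda>z. (0 + 0 * z + 0 * z\<^sup>2 + x1 ^ 3 * z ^ 3 + (3 * x1\<^sup>2 * x2) * z ^ 4) * ?p z)
       (\<lambda>z. 0 + 0 * z + 0 * z\<^sup>2 + 0 * z ^ 3 + x1 ^ 4 * z ^ 4)"
    by (rule zcongI[of "\<lambda>z. (x1 ^ 3 * x2 + 3 * x1\<^sup>2 * x2 * x1) + (x1 ^ 3 * x3 + 3 * x1\<^sup>2 * x2 * x2) * z
        + (x1 ^ 3 * x4 + 3 * x1\<^sup>2 * x2 * x3) * z\<^sup>2 + 3 * x1\<^sup>2 * x2 * x4 * z ^ 3"],
        intro analytic_intros) (simp add: algebra_simps power_numeral_reduce)
  finally have z4: "zcong 5 (\<lambda>z. ((?b z * ?b z) * ?b z) * ?b z) (\<lambda>z. 0 + 0 * z + 0 * z\<^sup>2 + 0 * z ^ 3 + x1 ^ 4 * z ^ 4)" .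
  have I1: "I 1 = (x4 - 4 * x2) / 16" unfolding I_def using integral_sin4[OF z1] by simp
  have I2: "I 2 = (2 * x1 * x3 + x2\<^sup>2 - 4 * x1\<^sup>2) / 16"
    unfolding I_def using integral_sin4[OF z2] by (simp add: power2_eq_square)
  have I3: "I 3 = 3 * x1\<^sup>2 * x2 / 16"
    unfolding I_def using integral_sin4[OF z3] by (simp add: power3_eq_cube mult.assoc)
  have I4: "I 4 = x1 ^ 4 / 16"
    unfolding I_def using integral_sin4[OF z4] by (simp add: power4_eq_xxxx mult.assoc)
  have ne: "1 - A * ?b (cis \<theta>) \<noteq> 0" for \<theta>
    using schurb_ne[of "cis \<theta>" n n] by (simp add: A_def)
  have "(\<integral>\<theta>. sin \<theta> ^ 4 * ln (cmod (1 - A * ?b (cis \<theta>))) \<partial>arc_measure)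
     = (\<integral>\<theta>. Re (complex_of_real (sin \<theta> ^ 4) * ln (1 - A * ?b (cis \<theta>))) \<partial>arc_measure)"
    by (simp only: Re_of_real_times Re_Ln[OF ne])
  also have "\<dots> = Re (\<integral>\<theta>. complex_of_real (sin \<theta> ^ 4) * ln (1 - A * ?b (cis \<theta>)) \<partial>arc_measure)"
  proof (rule integral_Re)
    \<comment> \<open>The real part is positive, which keeps the argument of the logarithm off the
      branch cut.\<close>
    have "1 - A * ?b (cis \<theta>) \<notin> \<real>\<^sub>\<le>\<^sub>0" for \<theta>
    proof
      assume *: "1 - A * ?b (cis \<theta>) \<in> \<real>\<^sub>\<le>\<^sub>0"
      then have "Re (A * ?b (cis \<theta>)) \<ge> 1" by (simp add: complex_nonpos_Reals_iff)
      then show False using gA[of \<theta>] A1 complex_Re_le_cmod[of "A * ?b (cis \<theta>)"] by linarith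
    qed
    then show "integrable arc_measure (\<lambda>\<theta>. complex_of_real (sin \<theta> ^ 4) * ln (1 - A * ?b (cis \<theta>)))"
      by (intro integrable_arc continuous_intros cb) auto
  qed
  also have "\<dots> = - Re (A * (x4 - 4 * x2) + A\<^sup>2 * (2 * x1 * x3 + x2\<^sup>2 - 4 * x1\<^sup>2) / 2
         + A ^ 3 * x1\<^sup>2 * x2 + A ^ 4 * x1 ^ 4 / 4) / 16"
  proof -
    have "(\<Sum>k\<in>{1,2,3,4}. - (A ^ k / of_nat k) * I k) = - (A * (x4 - 4 * x2) + A\<^sup>2 * (2 * x1 * x3 + x2\<^sup>2 - 4 * x1\<^sup>2) / 2
         + A ^ 3 * x1\<^sup>2 * x2 + A ^ 4 * x1 ^ 4 / 4) / 16"
    proof -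
      have "(\<Sum>k\<in>{1,2,3,4}. h k) = h 1 + h 2 + h 3 + h 4" for h :: "nat \<Rightarrow> complex" by simp
      then have "(\<Sum>k\<in>{1,2,3,4}. - (A ^ k / of_nat k) * I k)
        = - (A ^ 1 / of_nat 1) * I 1 + - (A ^ 2 / of_nat 2) * I 2 + - (A ^ 3 / of_nat 3) * I 3 + - (A ^ 4 / of_nat 4) * I 4" .
      also have "\<dots> = - (A * (x4 - 4 * x2) + A\<^sup>2 * (2 * x1 * x3 + x2\<^sup>2 - 4 * x1\<^sup>2) / 2
         + A ^ 3 * x1\<^sup>2 * x2 + A ^ 4 * x1 ^ 4 / 4) / 16"
        unfolding I1 I2 I3 I4 by (simp add: field_simps)
      finally show ?thesis .
    qed
    then show ?thesis unfolding eq by (simp only: Re_divide_numeral uminus_complex.sel)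
  qed
  finally show ?thesis by (simp only: A_def)
qed

lemma schurb_taylor_exists: "\<exists>x1 x2 x3 x4. zcong 5 (schurb a n) (\<lambda>z. x1 * z + x2 * z\<^sup>2 + x3 * z ^ 3 + x4 * z ^ 4)"
proof (induction n)
  case 0
  have "zcong 5 (schurb a 0) (\<lambda>z. 1 * z + 0 * z\<^sup>2 + 0 * z ^ 3 + 0 * z ^ 4)"
    by (rule zcongI[of "\<lambda>z. 0"]) (auto simp: schurb_def)
  then show ?case by blast
next
  case (Suc n)
  then show ?case using schurb_taylor_step by blast
qed

definition rho :: "nat \<Rightarrow> complex" where "rho n = 1 - a n * cnj (a n)"

text \<open>Four applications of \<open>schurb_taylor_step\<close>, after which the unknown
  coefficients y1, ..., y4 of the starting function have disappeared.\<close>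

lemma schurb_taylor:
  fixes n :: nat
  defines "x1 \<equiv> - cnj (a (n + 3))"
    and "x2 \<equiv> - rho (n + 3) * cnj (a (n + 2))"
    and "x3 \<equiv> rho (n + 3) * (- rho (n + 2) * cnj (a (n + 1)) + a (n + 3) * (cnj (a (n + 2)))\<^sup>2)"
    and "x4 \<equiv> rho (n + 3) * (- rho (n + 2) * rho (n + 1) * cnj (a n) + rho (n + 2) * a (n + 2) * (cnj (a (n + 1)))\<^sup>2
       + 2 * a (n + 3) * cnj (a (n + 2)) * rho (n + 2) * cnj (a (n + 1)) - (a (n + 3))\<^sup>2 * (cnj (a (n + 2))) ^ 3)"
  shows "zcong 5 (schurb a (n + 4)) (\<lambda>z. x1 * z + x2 * z\<^sup>2 + x3 * z ^ 3 + x4 * z ^ 4)"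
proof -
  obtain y1 y2 y3 y4 where y: "zcong 5 (schurb a n) (\<lambda>z. y1 * z + y2 * z\<^sup>2 + y3 * z ^ 3 + y4 * z ^ 4)"
    using schurb_taylor_exists by blast
  note step = schurb_taylor_step[folded rho_def]
  have n: "n + 4 = Suc (Suc (Suc (Suc n)))" "n + 3 = Suc (Suc (Suc n))" "n + 2 = Suc (Suc n)" "n + 1 = Suc n" by simp_all
  have "zcong 5 (schurb a (n + 4)) (\<lambda>z. - cnj (a (n + 3)) * z + rho (n + 3) * (- cnj (a (n + 2))) * z\<^sup>2 +
      rho (n + 3) * (rho (n + 2) * (- cnj (a (n + 1))) + a (n + 3) * (- cnj (a (n + 2)))\<^sup>2) * z ^ 3
     + rho (n + 3) * (rho (n + 2) * (rho (n + 1) * (- cnj (a n)) + a (n + 2) * (- cnj (a (n + 1)))\<^sup>2)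
        + 2 * a (n + 3) * (- cnj (a (n + 2))) * (rho (n + 2) * (- cnj (a (n + 1))))
        + (a (n + 3))\<^sup>2 * (- cnj (a (n + 2))) ^ 3) * z ^ 4)"
    unfolding n by (rule step[OF step[OF step[OF step[OF y]]]])
  moreover have "x1 = - cnj (a (n + 3))" "x2 = rho (n + 3) * (- cnj (a (n + 2)))"
    "x3 = rho (n + 3) * (rho (n + 2) * (- cnj (a (n + 1))) + a (n + 3) * (- cnj (a (n + 2)))\<^sup>2)"
    "x4 = rho (n + 3) * (rho (n + 2) * (rho (n + 1) * (- cnj (a n)) + a (n + 2) * (- cnj (a (n + 1)))\<^sup>2)
        + 2 * a (n + 3) * (- cnj (a (n + 2))) * (rho (n + 2) * (- cnj (a (n + 1))))
        + (a (n + 3))\<^sup>2 * (- cnj (a (n + 2))) ^ 3)"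
    by (simp_all add: x1_def x2_def x3_def x4_def algebra_simps)
  ultimately show ?thesis by (simp only:)
qed

end

section \<open>Bounded partial sums along slowly varying sequences\<close>

text \<open>Boundedness rather than convergence: this is what the comparison with the sum of |a_n|^6
  asks for, and a telescoping sum over a bounded sequence has it even when no limit exists.\<close>

definition bps :: "(nat \<Rightarrow> real) \<Rightarrow> bool" where
  "bps X \<longleftrightarrow> (\<exists>K. \<forall>N. \<bar>\<Sum>n<N. X n\<bar> \<le> K)"

lemma bpsI: "(\<And>N. \<bar>\<Sum>n<N. X n\<bar> \<le> K) \<Longrightarrow> bps X"
  by (auto simp: bps_def)

lemma bps_add:
  assumes "bps X" "bps Y" shows "bps (\<lambda>n. X n + Y n)"
proof -
  obtain K L where "\<And>N. \<bar>\<Sum>n<N. X n\<bar> \<le> K" "\<And>N. \<bar>\<Sum>n<N. Y n\<bar> \<le> L"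
    using assms by (auto simp: bps_def)
  then show ?thesis
    by (intro bpsI[of _ "K + L"]) (simp add: sum.distrib order_trans[OF abs_triangle_ineq] add_mono)
qed

lemma bps_cmult:
  assumes "bps X" shows "bps (\<lambda>n. c * X n)"
proof -
  obtain K where K: "\<And>N. \<bar>\<Sum>n<N. X n\<bar> \<le> K" using assms by (auto simp: bps_def)
  show ?thesis
    using K by (intro bpsI[of _ "\<bar>c\<bar> * K"]) (simp add: sum_distrib_left[symmetric] abs_mult mult_left_mono)
qed

lemma bps_diff: "bps X \<Longrightarrow> bps Y \<Longrightarrow> bps (\<lambda>n. X n - Y n)"
  using bps_add[of X "\<lambda>n. (-1) * Y n"] bps_cmult[of Y "-1"] by simp

lemma bps_0: "bps (\<lambda>n. 0)"
  by (rule bpsI[of _ 0]) simp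

lemma bps_sum_list: "(\<And>x. x \<in> set xs \<Longrightarrow> bps (X x)) \<Longrightarrow> bps (\<lambda>n. \<Sum>x\<leftarrow>xs. X x n)"
  by (induction xs) (auto intro!: bps_add bps_0)

lemma bps_summable:
  assumes "summable Y" "\<And>n. \<bar>X n\<bar> \<le> Y n" shows "bps X"
proof (rule bpsI)
  fix N
  have "\<bar>\<Sum>n<N. X n\<bar> \<le> (\<Sum>n<N. Y n)"
    by (rule order_trans[OF sum_abs]) (rule sum_mono, rule assms)
  also have "\<dots> \<le> suminf Y"
    by (rule sum_le_suminf[OF assms(1)]) (auto intro: order_trans[OF abs_ge_zero assms(2)])
  finally show "\<bar>\<Sum>n<N. X n\<bar> \<le> suminf Y" .
qed

lemma bps_shift_diff:
  assumes "\<And>n. \<bar>f n\<bar> \<le> B" shows "bps (\<lambda>n. f (n + p) - f n)"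
proof (induction p)
  case 0 show ?case by (simp add: bps_0)
next
  case (Suc p)
  have "bps (\<lambda>n. f (Suc (n + p)) - f (n + p))"
  proof (rule bpsI)
    fix N
    have "(\<Sum>n<N. f (Suc (n + p)) - f (n + p)) = f (N + p) - f p"
      using sum_lessThan_telescope[of "\<lambda>n. f (n + p)" N] by simp
    then show "\<bar>\<Sum>n<N. f (Suc (n + p)) - f (n + p)\<bar> \<le> 2 * B"
      using assms[of "N + p"] assms[of p] by linarith
  qed
  from bps_add[OF this Suc] show ?case by simp
qed

text \<open>First order expansion of the product at u = v = x, with an error quadratic in the
  displacement D. The bound on the linear term L is carried along because the inductive step
  multiplies L by the deviation of the new factor.\<close>

lemma prod_taylor:
  fixes us :: "(complex \<times> complex) list" and x :: complex
  assumes "\<And>u v. (u, v) \<in> set us \<Longrightarrow> cmod u \<le> 1 \<and> cmod v \<le> 1 \<and> cmod (u - x) \<le> D \<and> cmod (v - x) \<le> D"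
    and x: "cmod x \<le> 1" and D: "0 \<le> D"
  defines "L \<equiv> \<lambda>us. \<Sum>(u, v)\<leftarrow>us. cnj x * (u - x) + x * cnj (v - x)"
  shows "cmod ((\<Prod>(u, v)\<leftarrow>us. u * cnj v) - (x * cnj x) ^ length us - (x * cnj x) ^ (length us - 1) * L us)
     \<le> 2 * real (length us) ^ 2 * D\<^sup>2 \<and> cmod (L us) \<le> 2 * real (length us) * D"
  using assms(1)
proof (induction us)
  case Nil then show ?case by (simp add: L_def)
next
  case (Cons uv us)
  obtain u v where uv: "uv = (u, v)" by (cases uv)
  let ?k = "length us"
  define t where "t = x * cnj x"
  define l where "l = cnj x * (u - x) + x * cnj (v - x)"
  define P where "P = (\<Prod>(u, v)\<leftarrow>us. u * cnj v)"
  define R where "R = P - t ^ ?k - t ^ (?k - 1) * L us"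
  have b: "cmod u \<le> 1" "cmod v \<le> 1" "cmod (u - x) \<le> D" "cmod (v - x) \<le> D"
    using Cons.prems[of u v] by (auto simp: uv)
  have IH: "cmod R \<le> 2 * real ?k ^ 2 * D\<^sup>2" "cmod (L us) \<le> 2 * real ?k * D"
    using Cons.IH Cons.prems by (auto simp: R_def P_def t_def)
  have Lc: "L (uv # us) = l + L us" by (simp add: L_def l_def uv)
  have l: "cmod l \<le> 2 * D"
  proof -
    have "cmod l \<le> cmod x * cmod (u - x) + cmod x * cmod (v - x)"
      unfolding l_def by (rule order_trans[OF norm_triangle_ineq]) (simp add: norm_mult flip: complex_cnj_diff)
    also have "\<dots> \<le> 1 * D + 1 * D" using x b D by (intro add_mono mult_mono) auto
    finally show ?thesis by simp
  qed
  have uvt: "cmod (u * cnj v - t) \<le> 2 * D"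
  proof -
    have "u * cnj v - t = (u - x) * cnj v + x * cnj (v - x)" by (simp add: t_def algebra_simps)
    then have "cmod (u * cnj v - t) \<le> cmod (u - x) * cmod v + cmod x * cmod (v - x)"
      by (metis norm_triangle_ineq norm_mult complex_mod_cnj)
    also have "\<dots> \<le> D * 1 + 1 * D" using x b D by (intro add_mono mult_mono) auto
    finally show ?thesis by simp
  qed
  have t1: "cmod (t ^ m) \<le> 1" for m
    using x by (simp add: t_def norm_power norm_mult power_le_one mult_le_one)
  \<comment> \<open>For the empty list the truncated exponent \<open>length us - 1\<close> is 0
    instead of -1, but then L is 0 as well.\<close>
  have tk: "t ^ (?k - 1) * L us * t = t ^ ?k * L us"
    by (cases us) (auto simp: L_def)
  have e: "u * cnj v = t + l + (u - x) * cnj (v - x)"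
    by (simp add: t_def l_def algebra_simps)
  have "P * (u * cnj v) - t ^ Suc ?k - t ^ ?k * (l + L us)
     = t ^ ?k * ((u - x) * cnj (v - x)) + t ^ (?k - 1) * L us * (u * cnj v - t) + R * (u * cnj v)"
  proof -
    have "P * (u * cnj v) = t ^ ?k * (u * cnj v) + t ^ (?k - 1) * L us * (u * cnj v - t)
       + t ^ (?k - 1) * L us * t + R * (u * cnj v)"
      by (simp add: R_def algebra_simps)
    also have "t ^ ?k * (u * cnj v) = t ^ Suc ?k + t ^ ?k * l + t ^ ?k * ((u - x) * cnj (v - x))"
      by (subst e) (simp add: algebra_simps)
    finally show ?thesis unfolding tk by (simp add: algebra_simps)
  qed
  moreover have "cmod (t ^ ?k * ((u - x) * cnj (v - x))) \<le> 1 * (D * D)"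
    unfolding norm_mult[of "t ^ ?k"] norm_mult[of "u - x"] complex_mod_cnj
    using b D t1 by (intro mult_mono) auto
  moreover have "cmod (t ^ (?k - 1) * L us * (u * cnj v - t)) \<le> 1 * (2 * real ?k * D) * (2 * D)"
    unfolding norm_mult[of "t ^ (?k - 1) * L us"] norm_mult[of "t ^ (?k - 1)"]
    using IH uvt D t1 by (intro mult_mono) auto
  moreover have "cmod (R * (u * cnj v)) \<le> 2 * real ?k ^ 2 * D\<^sup>2 * (1 * 1)"
    unfolding norm_mult complex_mod_cnj using b D IH by (intro mult_mono) auto
  ultimately have "cmod (P * (u * cnj v) - t ^ Suc ?k - t ^ ?k * (l + L us))
      \<le> 1 * (D * D) + 1 * (2 * real ?k * D) * (2 * D) + 2 * real ?k ^ 2 * D\<^sup>2 * (1 * 1)"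
    by (smt (verit) norm_triangle_ineq)
  \<comment> \<open>With k the length of the tail, the three errors add up to (2 k^2 + 4 k + 1) D^2,
    which is below 2 (k + 1)^2 D^2.\<close>
  also have "\<dots> \<le> 2 * real (Suc ?k) ^ 2 * D\<^sup>2"
    by (simp add: power2_eq_square algebra_simps)
  finally have 1: "cmod (P * (u * cnj v) - t ^ Suc ?k - t ^ ?k * (l + L us)) \<le> 2 * real (Suc ?k) ^ 2 * D\<^sup>2" .
  have "cmod (L (uv # us)) \<le> 2 * D + 2 * real ?k * D"
    unfolding Lc using IH l norm_triangle_ineq[of l "L us"] by linarith
  then have 2: "cmod (L (uv # us)) \<le> 2 * real (length (uv # us)) * D"
    by (simp add: algebra_simps)
  have "(\<Prod>(u, v)\<leftarrow>uv # us. u * cnj v) = P * (u * cnj v)" by (simp add: P_def uv mult.commute)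
  with 1 2 show ?case by (simp add: Lc t_def[symmetric])
qed

section \<open>Sequences with square summable differences\<close>

locale slow_seq =
  fixes a :: "nat \<Rightarrow> complex"
  assumes le1: "cmod (a n) \<le> 1"
    and summable_diff: "summable (\<lambda>n. (cmod (a (Suc n) - a n))\<^sup>2)"
begin

text \<open>The length of the path a_n, ..., a_(n+m): a single quantity that dominates all
  displacements from a_n within the window.\<close>

definition D :: "nat \<Rightarrow> nat \<Rightarrow> real" where
  "D m n = (\<Sum>i<m. cmod (a (Suc (n + i)) - a (n + i)))"

lemma D_nonneg: "0 \<le> D m n" by (simp add: D_def sum_nonneg)

lemma diff_le_D: "p \<le> m \<Longrightarrow> cmod (a (n + p) - a n) \<le> D m n"
proof -
  assume p: "p \<le> m"
  have "cmod (a (n + p) - a n) \<le> D p n"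
  proof (induction p)
    case (Suc p)
    have "a (n + Suc p) - a n = (a (Suc (n + p)) - a (n + p)) + (a (n + p) - a n)" by simp
    then have "cmod (a (n + Suc p) - a n) \<le> cmod (a (Suc (n + p)) - a (n + p)) + cmod (a (n + p) - a n)"
      by (metis norm_triangle_ineq)
    then show ?case using Suc by (simp add: D_def)
  qed (simp add: D_def)
  also have "D p n \<le> D m n" unfolding D_def using p by (intro sum_mono2) auto
  finally show ?thesis .
qed

text \<open>Cauchy-Schwarz for m summands, each of them a shift of the given square summable
  sequence.\<close>

lemma summable_D2: "summable (\<lambda>n. (D m n)\<^sup>2)"
proof (rule summable_comparison_test')
  have "summable (\<lambda>n. (cmod (a (Suc (n + i)) - a (n + i)))\<^sup>2)" for i
    using summable_ignore_initial_segment[OF summable_diff, of i] by simp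
  then show "summable (\<lambda>n. real m * (\<Sum>i<m. (cmod (a (Suc (n + i)) - a (n + i)))\<^sup>2))"
    by (intro summable_mult summable_sum) auto
next
  fix n
  have "(D m n)\<^sup>2 \<le> real m * (\<Sum>i<m. (cmod (a (Suc (n + i)) - a (n + i)))\<^sup>2)"
    unfolding D_def
    using Cauchy_Schwarz_ineq_sum[of "\<lambda>i. 1" "\<lambda>i. cmod (a (Suc (n + i)) - a (n + i))" "{..<m}"] by simp
  then show "norm ((D m n)\<^sup>2) \<le> real m * (\<Sum>i<m. (cmod (a (Suc (n + i)) - a (n + i)))\<^sup>2)" by simp
qed

lemma bps_modulus_shift: "bps (\<lambda>n. cmod (a (n + p)) ^ k - cmod (a n) ^ k)"
  using le1 by (intro bps_shift_diff[of "\<lambda>n. cmod (a n) ^ k" 1]) (simp add: power_le_one)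

text \<open>The first order term of the monomial is the average of the first order terms of
  \<open>|a (n + p)| ^ (2 k)\<close> over all its factors, and those differences telescope.\<close>

lemma bps_monomial:
  fixes pq :: "(nat \<times> nat) list"
  shows "bps (\<lambda>n. Re (\<Prod>(p, q)\<leftarrow>pq. a (n + p) * cnj (a (n + q))) - cmod (a n) ^ (2 * length pq))"
proof (cases "pq = []")
  case True then show ?thesis by (simp add: bps_0)
next
  case False
  let ?k = "length pq"
  have k: "?k > 0" using False by simp
  define m where "m = Max (set (map fst pq @ map snd pq))"
  have m: "p \<le> m" "q \<le> m" if "(p, q) \<in> set pq" for p q
    using that unfolding m_def by (auto intro!: Max_ge simp del: set_map intro: rev_image_eqI simp: image_iff) (force intro!: Max_ge)+
  define x where "x n = a n * cnj (a n)" for n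
  have xt: "x n = complex_of_real ((cmod (a n))\<^sup>2)" for n by (simp only: x_def complex_norm_square)
  define S where "S n = (\<Sum>(p, q)\<leftarrow>pq. (cmod (a (n + p)) ^ (2 * ?k) - cmod (a n) ^ (2 * ?k))
       + (cmod (a (n + q)) ^ (2 * ?k) - cmod (a n) ^ (2 * ?k)))" for n
  have S: "bps S"
    unfolding S_def split_def by (intro bps_sum_list bps_add bps_modulus_shift)
  have T1: "\<bar>Re (\<Prod>(p, q)\<leftarrow>pq. a (n + p) * cnj (a (n + q))) - cmod (a n) ^ (2 * ?k)
      - cmod (a n) ^ (2 * (?k - 1)) * (\<Sum>(p, q)\<leftarrow>pq. Re (cnj (a n) * (a (n + p) - a n)) + Re (cnj (a n) * (a (n + q) - a n)))\<bar>
      \<le> 2 * real ?k ^ 2 * (D m n)\<^sup>2" for n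
  proof -
    let ?us = "map (\<lambda>(p, q). (a (n + p), a (n + q))) pq"
    let ?L = "\<Sum>(u, v)\<leftarrow>?us. cnj (a n) * (u - a n) + a n * cnj (v - a n)"
    have "cmod ((\<Prod>(u, v)\<leftarrow>?us. u * cnj v) - (x n) ^ length ?us - (x n) ^ (length ?us - 1) * ?L)
       \<le> 2 * real (length ?us) ^ 2 * (D m n)\<^sup>2"
      unfolding x_def by (rule prod_taylor[THEN conjunct1]) (auto simp: le1 D_nonneg intro!: diff_le_D dest: m)
    then have "\<bar>Re ((\<Prod>(u, v)\<leftarrow>?us. u * cnj v) - (x n) ^ ?k - (x n) ^ (?k - 1) * ?L)\<bar>
       \<le> 2 * real ?k ^ 2 * (D m n)\<^sup>2"
      by (intro order_trans[OF abs_Re_le_cmod]) simp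
    moreover have "(\<Prod>(u, v)\<leftarrow>?us. u * cnj v) = (\<Prod>(p, q)\<leftarrow>pq. a (n + p) * cnj (a (n + q)))"
      by (induction pq) auto
    moreover have "Re ?L = (\<Sum>(p, q)\<leftarrow>pq. Re (cnj (a n) * (a (n + p) - a n)) + Re (cnj (a n) * (a (n + q) - a n)))"
      by (induction pq) (auto simp: algebra_simps)
    moreover have "Re ((x n) ^ (?k - 1) * z) = cmod (a n) ^ (2 * (?k - 1)) * Re z" for z
      unfolding xt by (simp only: of_real_power[symmetric] Re_complex_of_real Re_of_real_times power_mult)
    moreover have "Re ((x n) ^ ?k) = cmod (a n) ^ (2 * ?k)"
      unfolding xt by (simp only: of_real_power[symmetric] Re_complex_of_real power_mult)
    ultimately show ?thesis by (simp only: minus_complex.sel)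
  qed
  \<comment> \<open>The same expansion for the pure modulus, seen as a product of k equal pairs. Its
    linear part is 2 k times one displacement term, while that of the monomial is a sum of 2 k such
    terms.\<close>
  have T2: "\<bar>cmod (a (n + p)) ^ (2 * ?k) - cmod (a n) ^ (2 * ?k)
      - 2 * real ?k * (cmod (a n) ^ (2 * (?k - 1)) * Re (cnj (a n) * (a (n + p) - a n)))\<bar>
      \<le> 2 * real ?k ^ 2 * (D m n)\<^sup>2" if p: "p \<le> m" for p n
  proof -
    let ?us = "replicate ?k (a (n + p), a (n + p))"
    let ?L = "\<Sum>(u, v)\<leftarrow>?us. cnj (a n) * (u - a n) + a n * cnj (v - a n)"
    have "cmod ((\<Prod>(u, v)\<leftarrow>?us. u * cnj v) - (x n) ^ length ?us - (x n) ^ (length ?us - 1) * ?L)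
       \<le> 2 * real (length ?us) ^ 2 * (D m n)\<^sup>2"
      unfolding x_def by (rule prod_taylor[THEN conjunct1]) (auto simp: le1 D_nonneg intro!: diff_le_D p)
    then have "\<bar>Re ((\<Prod>(u, v)\<leftarrow>?us. u * cnj v) - (x n) ^ ?k - (x n) ^ (?k - 1) * ?L)\<bar>
       \<le> 2 * real ?k ^ 2 * (D m n)\<^sup>2"
      by (intro order_trans[OF abs_Re_le_cmod]) simp
    moreover have "(\<Prod>(u, v)\<leftarrow>?us. u * cnj v) = (x (n + p)) ^ ?k"
      by (simp add: prod_list_replicate x_def)
    moreover have "Re ?L = 2 * real ?k * Re (cnj (a n) * (a (n + p) - a n))"
      by (simp add: sum_list_replicate algebra_simps)
    moreover have "Re ((x n) ^ (?k - 1) * z) = cmod (a n) ^ (2 * (?k - 1)) * Re z" for z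
      unfolding xt by (simp only: of_real_power[symmetric] Re_complex_of_real Re_of_real_times power_mult)
    moreover have "Re ((x j) ^ ?k) = cmod (a j) ^ (2 * ?k)" for j
      unfolding xt by (simp only: of_real_power[symmetric] Re_complex_of_real power_mult)
    ultimately show ?thesis by (simp only: minus_complex.sel mult.left_commute)
  qed
  have "bps (\<lambda>n. (Re (\<Prod>(p, q)\<leftarrow>pq. a (n + p) * cnj (a (n + q))) - cmod (a n) ^ (2 * ?k)) - 1 / (2 * real ?k) * S n)"
  proof (rule bps_summable)
    \<comment> \<open>Twice 2 k^2 D^2: once from \<open>T1\<close>, and once from the 2 k instances
      of \<open>T2\<close> after division by 2 k.\<close>
    show "summable (\<lambda>n. 4 * real ?k ^ 2 * (D m n)\<^sup>2)" by (intro summable_mult summable_D2)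
  next
    fix n
    define c where "c = cmod (a n) ^ (2 * (?k - 1))"
    define f where "f p = Re (cnj (a n) * (a (n + p) - a n))" for p
    define g where "g p = cmod (a (n + p)) ^ (2 * ?k) - cmod (a n) ^ (2 * ?k)" for p
    have g: "\<bar>g p - 2 * real ?k * (c * f p)\<bar> \<le> 2 * real ?k ^ 2 * (D m n)\<^sup>2" if "p \<le> m" for p
      using T2[OF that, of n] by (simp add: c_def f_def g_def)
    have "\<bar>(\<Sum>(p, q)\<leftarrow>ys. g p + g q) - 2 * real ?k * (c * (\<Sum>(p, q)\<leftarrow>ys. f p + f q))\<bar>
       \<le> real (length ys) * (4 * real ?k ^ 2 * (D m n)\<^sup>2)" if "set ys \<subseteq> set pq" for ys
      using that
    proof (induction ys)
      case (Cons y ys)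
      obtain p q where y: "y = (p, q)" by (cases y)
      have "p \<le> m" "q \<le> m" using m[of p q] Cons.prems y by auto
      from g[OF this(1)] g[OF this(2)] Cons show ?case
        unfolding y by (simp add: algebra_simps)
    qed simp
    from this[of pq] have 1: "\<bar>S n - 2 * real ?k * (c * (\<Sum>(p, q)\<leftarrow>pq. f p + f q))\<bar>
        \<le> real ?k * (4 * real ?k ^ 2 * (D m n)\<^sup>2)"
      by (simp add: S_def g_def)
    have "\<bar>1 / (2 * real ?k) * S n - c * (\<Sum>(p, q)\<leftarrow>pq. f p + f q)\<bar>
       = 1 / (2 * real ?k) * \<bar>S n - 2 * real ?k * (c * (\<Sum>(p, q)\<leftarrow>pq. f p + f q))\<bar>"
    proof -
      have "1 / (2 * real ?k) * S n - c * (\<Sum>(p, q)\<leftarrow>pq. f p + f q)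
         = 1 / (2 * real ?k) * (S n - 2 * real ?k * (c * (\<Sum>(p, q)\<leftarrow>pq. f p + f q)))"
        using k by (simp add: right_diff_distrib)
      then show ?thesis by (simp only: abs_mult) simp
    qed
    also have "\<dots> \<le> 1 / (2 * real ?k) * (real ?k * (4 * real ?k ^ 2 * (D m n)\<^sup>2))"
      using 1 by (intro mult_left_mono) auto
    also have "\<dots> = 2 * real ?k ^ 2 * (D m n)\<^sup>2" using k by simp
    finally have "\<bar>1 / (2 * real ?k) * S n - c * (\<Sum>(p, q)\<leftarrow>pq. f p + f q)\<bar> \<le> 2 * real ?k ^ 2 * (D m n)\<^sup>2" .
    with T1[of n] show "\<bar>(Re (\<Prod>(p, q)\<leftarrow>pq. a (n + p) * cnj (a (n + q))) - cmod (a n) ^ (2 * ?k)) - 1 / (2 * real ?k) * S n\<bar>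
        \<le> 4 * real ?k ^ 2 * (D m n)\<^sup>2"
      unfolding c_def[symmetric] f_def[symmetric] by linarith
  qed
  from bps_add[OF this bps_cmult[OF S, of "1 / (2 * real ?k)"]] show ?thesis by simp
qed

text \<open>A factor 1 - |a_(n+s)|^2 is removed by writing the expression as a difference of two
  without it, the second with the pair (s, s) added to the monomial; hence the induction needs
  \<open>pq\<close> arbitrary.\<close>

lemma bps_monomial_rho:
  fixes pq :: "(nat \<times> nat) list" and ss :: "nat list"
  shows "bps (\<lambda>n. Re (\<Prod>(p, q)\<leftarrow>pq. a (n + p) * cnj (a (n + q))) * (\<Prod>s\<leftarrow>ss. 1 - (cmod (a (n + s)))\<^sup>2)
     - ((cmod (a n))\<^sup>2) ^ length pq * (1 - (cmod (a n))\<^sup>2) ^ length ss)"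
proof (induction ss arbitrary: pq)
  case Nil
  show ?case using bps_monomial[of pq] by (simp add: power_mult)
next
  case (Cons s ss)
  have e: "Re (\<Prod>(p, q)\<leftarrow>(s, s) # pq. a (n + p) * cnj (a (n + q)))
     = (cmod (a (n + s)))\<^sup>2 * Re (\<Prod>(p, q)\<leftarrow>pq. a (n + p) * cnj (a (n + q)))" for n
    by (simp only: list.map prod_list.Cons prod.case complex_norm_square[symmetric] Re_of_real_times)
  show ?case
    using bps_diff[OF Cons.IH[of pq] Cons.IH[of "(s, s) # pq"]]
    unfolding e by (simp add: algebra_simps)
qed

end

text \<open>The expression has derivative - x^3 / (1 - x), which lies between - 2 x^3 and 0 on
  [0, 1/2]. So it decreases from 0, and it increases once t^4 is added.\<close>

lemma ln_one_minus_taylor3: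
  fixes t :: real
  assumes "0 \<le> t" "t \<le> 1 / 2"
  shows "\<bar>ln (1 - t) + t + t\<^sup>2 / 2 + t ^ 3 / 3\<bar> \<le> t ^ 4"
proof -
  let ?f = "\<lambda>t::real. ln (1 - t) + t + t\<^sup>2 / 2 + t ^ 3 / 3"
  have d: "(?f has_real_derivative - (x ^ 3 / (1 - x))) (at x)" if "0 \<le> x" "x \<le> t" for x
  proof -
    have "x < 1" using that assms by simp
    then show ?thesis
      by (auto intro!: derivative_eq_intros simp: field_simps power_numeral_reduce)
  qed
  have "?f t \<le> ?f 0"
  proof (rule DERIV_nonpos_imp_nonincreasing[OF assms(1)])
    fix x assume x: "0 \<le> x" "x \<le> t"
    then have "- (x ^ 3 / (1 - x)) \<le> 0" using assms by simp
    with d[OF x] show "\<exists>y. (?f has_real_derivative y) (at x) \<and> y \<le> 0" by blast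
  qed
  moreover have "?f 0 + 0 ^ 4 \<le> ?f t + t ^ 4"
  proof (rule DERIV_nonneg_imp_nondecreasing[OF assms(1)])
    fix x assume x: "0 \<le> x" "x \<le> t"
    have "((\<lambda>t. ?f t + t ^ 4) has_real_derivative (- (x ^ 3 / (1 - x)) + 4 * x ^ 3)) (at x)"
      by (rule DERIV_add[OF d[OF x]]) (auto intro!: derivative_eq_intros)
    moreover have "x ^ 3 / (1 - x) \<le> x ^ 3 / (1 / 2)"
      using x assms by (intro divide_left_mono) auto
    then have "x ^ 3 / (1 - x) \<le> 2 * x ^ 3" by simp
    then have "- (x ^ 3 / (1 - x)) + 4 * x ^ 3 \<ge> 0" using zero_le_power[OF x(1), of 3] by linarith
    ultimately show "\<exists>y. ((\<lambda>t. ?f t + t ^ 4) has_real_derivative y) (at x) \<and> 0 \<le> y" by blast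
  qed
  ultimately show ?thesis by simp
qed

text \<open>Meant for squared moduli, whose fourth powers are summable by the assumption on eighth
  powers. Summability brings t below 1/2 eventually, and the finitely many earlier terms do not
  affect it.\<close>

lemma bps_ln_one_minus:
  fixes t :: "nat \<Rightarrow> real"
  assumes "\<And>n. 0 \<le> t n" "summable (\<lambda>n. t n ^ 4)"
  shows "bps (\<lambda>n. ln (1 - t n) + t n + (t n)\<^sup>2 / 2 + t n ^ 3 / 3)"
proof -
  have "(\<lambda>n. t n ^ 4) \<longlonglongrightarrow> 0" using assms(2) by (rule summable_LIMSEQ_zero)
  then have "\<forall>\<^sub>F n in sequentially. t n ^ 4 < (1 / 2) ^ 4" by (rule order_tendstoD) simp
  then obtain N where N: "\<And>n. n \<ge> N \<Longrightarrow> t n ^ 4 < (1 / 2) ^ 4" by (auto simp: eventually_sequentially)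
  have le: "\<bar>ln (1 - t n) + t n + (t n)\<^sup>2 / 2 + t n ^ 3 / 3\<bar> \<le> t n ^ 4" if "n \<ge> N" for n
  proof (rule ln_one_minus_taylor3[OF assms(1)])
    show "t n \<le> 1 / 2" using N[OF that] power_less_imp_less_base[of "t n" 4 "1/2"] by simp
  qed
  have "summable (\<lambda>n. \<bar>ln (1 - t n) + t n + (t n)\<^sup>2 / 2 + t n ^ 3 / 3\<bar>)"
    by (rule summable_comparison_test'[OF assms(2), of N]) (use le in auto)
  then show ?thesis by (rule bps_summable) simp
qed

section \<open>The entropy of the Bernstein-Szego approximations\<close>

lemma integral_sin4_1: "(\<integral>\<theta>. sin \<theta> ^ 4 \<partial>arc_measure) = 3 / 8"
proof -
  have "complex_of_real (\<integral>\<theta>. sin \<theta> ^ 4 \<partial>arc_measure) = (\<integral>\<theta>. complex_of_real (sin \<theta> ^ 4) * 1 \<partial>arc_measure)"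
    by (simp only: integral_complex_of_real[symmetric] mult_1_right)
  also have "\<dots> = (6 * 1 - 4 * 0 + 0) / 16"
    by (rule integral_sin4[where F = "\<lambda>z. 1" and ?c1.0 = 0 and ?c3.0 = 0], rule zcongI[of "\<lambda>z. 0"]) auto
  also have "\<dots> = complex_of_real (3 / 8)" by simp
  finally show ?thesis using of_real_eq_iff by blast
qed

section \<open>The entropy increments as explicit functions of five coefficients\<close>

context disc_seq
begin

text \<open>The product is the squared norm of Phi_n for unit mass, and \<open>Phis\<close> has the
  modulus of Phi_n on the circle. It is \<open>Phis\<close> that factors through 1 - a_n b_n and has
  no zero in the closed disc.\<close>

definition bs_density :: "nat \<Rightarrow> real \<Rightarrow> real" where
  "bs_density n \<theta> = (\<Prod>j<n. 1 - (cmod (a j))\<^sup>2) / (cmod (poly (Phis a n) (cis \<theta>)))\<^sup>2"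

lemma one_minus_pos: "0 < 1 - (cmod (a j))\<^sup>2"
  using lt1[of j] by (simp add: abs_square_less_1)

lemma Phis_cis_ne: "poly (Phis a n) (cis \<theta>) \<noteq> 0"
  by (rule Phis_bound) simp

lemma bs_density_pos: "0 < bs_density n \<theta>"
  unfolding bs_density_def using one_minus_pos Phis_cis_ne by (intro divide_pos_pos prod_pos) auto

lemma continuous_bs_density: "continuous_on UNIV (bs_density n)"
  unfolding bs_density_def[abs_def] using Phis_cis_ne
  by (intro continuous_intros) auto

definition sin4_entropy :: "nat \<Rightarrow> real" where
  "sin4_entropy n = (\<integral>\<theta>. sin \<theta> ^ 4 * ln (bs_density n \<theta>) \<partial>arc_measure)"

text \<open>The factorization of Phis_(n+1) reads w_(n+1) = w_n (1 - |a_n|^2) / |1 - a_n b_n|^2 on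
  the circle; 3/8 is the mean of sin^4.\<close>

lemma sin4_entropy_Suc:
  "sin4_entropy (Suc n) = sin4_entropy n + (3 / 8 * ln (1 - (cmod (a n))\<^sup>2)
     - 2 * (\<integral>\<theta>. sin \<theta> ^ 4 * ln (cmod (1 - a n * schurb a n (cis \<theta>))) \<partial>arc_measure))"
proof -
  have ne: "1 - a n * schurb a n (cis \<theta>) \<noteq> 0" for \<theta> by (rule schurb_ne) simp
  have e: "ln (bs_density (Suc n) \<theta>) = ln (bs_density n \<theta>) + (ln (1 - (cmod (a n))\<^sup>2)
     - 2 * ln (cmod (1 - a n * schurb a n (cis \<theta>))))" for \<theta>
  proof -
    have "bs_density (Suc n) \<theta> = bs_density n \<theta> * ((1 - (cmod (a n))\<^sup>2) / (cmod (1 - a n * schurb a n (cis \<theta>)))\<^sup>2)"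
      using Phis_Suc_schurb[of "cis \<theta>" n]
      by (simp add: bs_density_def norm_mult power_mult_distrib del: Phis.simps)
    then have "ln (bs_density (Suc n) \<theta>) = ln (bs_density n \<theta>) + (ln (1 - (cmod (a n))\<^sup>2) - ln ((cmod (1 - a n * schurb a n (cis \<theta>)))\<^sup>2))"
      using bs_density_pos[of n \<theta>] one_minus_pos[of n] ne[of \<theta>] by (simp add: ln_mult_pos ln_div)
    also have "ln ((cmod (1 - a n * schurb a n (cis \<theta>)))\<^sup>2) = 2 * ln (cmod (1 - a n * schurb a n (cis \<theta>)))"
      using ne[of \<theta>] by (simp add: ln_realpow)
    finally show ?thesis .
  qed
  have i1: "integrable arc_measure (\<lambda>\<theta>. sin \<theta> ^ 4 * ln (bs_density n \<theta>))"
    using bs_density_pos[of n] by (intro integrable_arc continuous_intros continuous_bs_density) (auto simp: less_le)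
  have i2: "integrable arc_measure (\<lambda>\<theta>. ln (1 - (cmod (a n))\<^sup>2) * sin \<theta> ^ 4)"
    by (intro integrable_arc continuous_intros)
  have i3: "integrable arc_measure (\<lambda>\<theta>. 2 * (sin \<theta> ^ 4 * ln (cmod (1 - a n * schurb a n (cis \<theta>)))))"
    using ne by (intro integrable_arc continuous_intros analytic_cball_continuous_cis schurb_analytic) auto
  have "sin4_entropy (Suc n) = (\<integral>\<theta>. sin \<theta> ^ 4 * ln (bs_density n \<theta>) + (ln (1 - (cmod (a n))\<^sup>2) * sin \<theta> ^ 4
      - 2 * (sin \<theta> ^ 4 * ln (cmod (1 - a n * schurb a n (cis \<theta>))))) \<partial>arc_measure)"
    unfolding sin4_entropy_def e by (intro Bochner_Integration.integral_cong refl) (simp add: algebra_simps)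
  also have "\<dots> = sin4_entropy n + (ln (1 - (cmod (a n))\<^sup>2) * (3 / 8)
      - 2 * (\<integral>\<theta>. sin \<theta> ^ 4 * ln (cmod (1 - a n * schurb a n (cis \<theta>))) \<partial>arc_measure))"
    unfolding sin4_entropy_def
    by (simp only: Bochner_Integration.integral_add[OF i1 Bochner_Integration.integrable_diff[OF i2 i3]]
        Bochner_Integration.integral_diff[OF i2 i3] integral_mult_right_zero integral_sin4_1)
  finally show ?thesis by simp
qed

text \<open>The shift by 4 guarantees four predecessors, so that the coefficients involved are
  exactly a_n, ..., a_(n+4).\<close>

definition sin4_entropy_step :: "nat \<Rightarrow> real" where
  "sin4_entropy_step n = 3 / 8 * ln (1 - (cmod (a (n + 4)))\<^sup>2)
     - 2 * (\<integral>\<theta>. sin \<theta> ^ 4 * ln (cmod (1 - a (n + 4) * schurb a (n + 4) (cis \<theta>))) \<partial>arc_measure)"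

lemma sin4_entropy_eq_sum: "sin4_entropy (N + 4) = sin4_entropy 4 + (\<Sum>n<N. sin4_entropy_step n)"
proof (induction N)
  case (Suc N)
  have "sin4_entropy (Suc N + 4) = sin4_entropy (N + 4) + sin4_entropy_step N"
    using sin4_entropy_Suc[of "N + 4"] by (simp add: sin4_entropy_step_def)
  then show ?case using Suc by simp
qed simp

definition monomial :: "(nat \<times> nat) list \<Rightarrow> nat list \<Rightarrow> nat \<Rightarrow> real" where
  "monomial pq ss n = Re (\<Prod>(p, q)\<leftarrow>pq. a (n + p) * cnj (a (n + q))) * (\<Prod>s\<leftarrow>ss. 1 - (cmod (a (n + s)))\<^sup>2)"

text \<open>The coefficients from \<open>schurb_taylor\<close> inserted into
  \<open>integral_sin4_log_schurb\<close> and sorted by monomials; 1/8 is 2/16. Every term balances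
  the a against the conjugates, the form to which \<open>bps_monomial_rho\<close> applies.\<close>

lemma sin4_entropy_step_eq:
  "sin4_entropy_step n = 3 / 8 * ln (1 - (cmod (a (n + 4)))\<^sup>2) + 1 / 8 * (4 * monomial [(4,2)] [3] n
     + (- 1) * monomial [(4,0)] [3,2,1] n + monomial [(4,1),(2,1)] [3,2] n + 2 * monomial [(4,2),(3,1)] [3,2] n
     + (- 1) * monomial [(4,2),(3,2),(3,2)] [3] n + (- 2) * monomial [(4,3),(4,3)] [] n + monomial [(4,3),(4,1)] [3,2] n
     + (- 1) * monomial [(4,3),(4,2),(3,2)] [3] n + 1 / 2 * monomial [(4,2),(4,2)] [3,3] n
     + (- 1) * monomial [(4,3),(4,3),(4,2)] [3] n + 1 / 4 * monomial [(4,3),(4,3),(4,3),(4,3)] [] n)"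
proof -
  define A B C D E where "A = a (n + 4)" and "B = a (n + 3)" and "C = a (n + 2)" and "D = a (n + 1)" and "E = a n"
  define R where "R k = 1 - (cmod (a (n + k)))\<^sup>2" for k
  have rho: "rho (n + k) = complex_of_real (R k)" for k
    by (simp only: rho_def R_def of_real_diff of_real_1 complex_norm_square)
  have Re_mult_of_real: "Re z * r = Re (z * complex_of_real r)" for z r by simp
  note tay = integral_sin4_log_schurb[OF schurb_taylor, of n]
  let ?x1 = "- cnj B" and ?x2 = "- of_real (R 3) * cnj C"
  let ?x3 = "of_real (R 3) * (- of_real (R 2) * cnj D + B * (cnj C)\<^sup>2)"
  let ?x4 = "of_real (R 3) * (- of_real (R 2) * of_real (R 1) * cnj E + of_real (R 2) * C * (cnj D)\<^sup>2
       + 2 * B * cnj C * of_real (R 2) * cnj D - B\<^sup>2 * (cnj C) ^ 3)"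
  have "- 2 * (\<integral>\<theta>. sin \<theta> ^ 4 * ln (cmod (1 - a (n + 4) * schurb a (n + 4) (cis \<theta>))) \<partial>arc_measure)
     = 1 / 8 * Re (A * (?x4 - 4 * ?x2) + A\<^sup>2 * (2 * ?x1 * ?x3 + ?x2\<^sup>2 - 4 * ?x1\<^sup>2) / 2
         + A ^ 3 * ?x1\<^sup>2 * ?x2 + A ^ 4 * ?x1 ^ 4 / 4)"
  proof -
    have "- 2 * (- r / 16) = 1 / 8 * r" for r :: real by simp
    then show ?thesis unfolding tay rho A_def B_def C_def D_def E_def .
  qed
  also have "A * (?x4 - 4 * ?x2) + A\<^sup>2 * (2 * ?x1 * ?x3 + ?x2\<^sup>2 - 4 * ?x1\<^sup>2) / 2
         + A ^ 3 * ?x1\<^sup>2 * ?x2 + A ^ 4 * ?x1 ^ 4 / 4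
     = of_real 4 * (A * cnj C * of_real (R 3))
     + of_real (- 1) * (A * cnj E * of_real (R 3 * (R 2 * R 1)))
     + (A * cnj D * (C * cnj D) * of_real (R 3 * R 2))
     + of_real 2 * (A * cnj C * (B * cnj D) * of_real (R 3 * R 2))
     + of_real (- 1) * (A * cnj C * (B * cnj C * (B * cnj C)) * of_real (R 3))
     + of_real (- 2) * (A * cnj B * (A * cnj B))
     + (A * cnj B * (A * cnj D) * of_real (R 3 * R 2))
     + of_real (- 1) * (A * cnj B * (A * cnj C * (B * cnj C)) * of_real (R 3))
     + of_real (1 / 2) * (A * cnj C * (A * cnj C) * of_real (R 3 * R 3))
     + of_real (- 1) * (A * cnj B * (A * cnj B * (A * cnj C)) * of_real (R 3))
     + of_real (1 / 4) * (A * cnj B * (A * cnj B * (A * cnj B * (A * cnj B))))"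
    by (simp add: algebra_simps power_numeral_reduce add_divide_distrib diff_divide_distrib)
  finally show ?thesis
    unfolding sin4_entropy_step_def monomial_def
    by (simp only: list.map prod_list.Cons prod_list.Nil prod.case mult_1_right R_def[symmetric] add_0_right
        A_def[symmetric] B_def[symmetric] C_def[symmetric] D_def[symmetric] E_def[symmetric]
        Re_mult_of_real Re_of_real_times plus_complex.sel)
qed

end

section \<open>Comparison of the entropy with the sum of |a_n|^6\<close>

locale slow_disc_seq = disc_seq +
  assumes sum_diff: "summable (\<lambda>n. (cmod (a (Suc n) - a n))\<^sup>2)"
    and sum8: "summable (\<lambda>n. cmod (a n) ^ 8)"
begin

sublocale slow_seq a
  using lt1 sum_diff by unfold_locales (auto intro: less_imp_le)

definition t :: "nat \<Rightarrow> real" where "t n = (cmod (a n))\<^sup>2"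

lemma t_bounds: "0 \<le> t n" "t n \<le> 1"
  using lt1[of n] by (auto simp: t_def abs_square_le_1 less_imp_le)

lemma bps_monomials: "bps (\<lambda>n. monomial pq ss n - t n ^ length pq * (1 - t n) ^ length ss)"
  unfolding monomial_def t_def by (rule bps_monomial_rho)

lemma sum_t4: "summable (\<lambda>n. t n ^ 4)"
  using sum8 by (simp add: t_def flip: power_mult)

lemma bps_sin4_entropy_step: "bps (\<lambda>n. sin4_entropy_step n + 2 * t n ^ 3)"
proof -
  \<comment> \<open>The third order Taylor polynomial of - ln (1 - t). The logarithm carries the
    index n + 4, so P is compared there and then moved back to n by a telescoping
    difference.\<close>
  define P where "P n = t n + (t n)\<^sup>2 / 2 + t n ^ 3 / 3" for n
  have 1: "bps (\<lambda>n. ln (1 - t (n + 4)) + P (n + 4))"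
    using bps_ln_one_minus[of "\<lambda>n. t (n + 4)"] t_bounds summable_ignore_initial_segment[OF sum_t4, of 4]
    by (simp add: P_def add.assoc)
  have 2: "bps (\<lambda>n. P (n + 4) - P n)"
  proof (rule bps_shift_diff)
    fix n
    have "t n ^ k \<le> 1" "0 \<le> t n ^ k" for k using t_bounds[of n] by (auto intro: power_le_one)
    from this[of 1] this[of 2] this[of 3] show "\<bar>P n\<bar> \<le> 2" by (simp add: P_def)
  qed
  have 3: "bps (\<lambda>n. t n ^ 4)"
    by (rule bps_summable[OF sum_t4]) (simp add: t_bounds)
  \<comment> \<open>35/32 is the coefficient of t^4 in the diagonal value of the monomial part;
    correcting for it is free because t^4 is summable.\<close>
  have "bps (\<lambda>n. 3 / 8 * (ln (1 - t (n + 4)) + P (n + 4)) - 3 / 8 * (P (n + 4) - P n) + 35 / 32 * t n ^ 4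
     + 1 / 8 * (4 * (monomial [(4,2)] [3] n - t n ^ length [(4::nat,2::nat)] * (1 - t n) ^ length [3::nat])
     + (- 1) * (monomial [(4,0)] [3,2,1] n - t n ^ length [(4::nat,0::nat)] * (1 - t n) ^ length [3::nat,2,1])
     + (monomial [(4,1),(2,1)] [3,2] n - t n ^ length [(4::nat,1::nat),(2,1)] * (1 - t n) ^ length [3::nat,2])
     + 2 * (monomial [(4,2),(3,1)] [3,2] n - t n ^ length [(4::nat,2::nat),(3,1)] * (1 - t n) ^ length [3::nat,2])
     + (- 1) * (monomial [(4,2),(3,2),(3,2)] [3] n - t n ^ length [(4::nat,2::nat),(3,2),(3,2)] * (1 - t n) ^ length [3::nat])
     + (- 2) * (monomial [(4,3),(4,3)] [] n - t n ^ length [(4::nat,3::nat),(4,3)] * (1 - t n) ^ length ([] :: nat list))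
     + (monomial [(4,3),(4,1)] [3,2] n - t n ^ length [(4::nat,3::nat),(4,1)] * (1 - t n) ^ length [3::nat,2])
     + (- 1) * (monomial [(4,3),(4,2),(3,2)] [3] n - t n ^ length [(4::nat,3::nat),(4,2),(3,2)] * (1 - t n) ^ length [3::nat])
     + 1 / 2 * (monomial [(4,2),(4,2)] [3,3] n - t n ^ length [(4::nat,2::nat),(4,2)] * (1 - t n) ^ length [3::nat,3])
     + (- 1) * (monomial [(4,3),(4,3),(4,2)] [3] n - t n ^ length [(4::nat,3::nat),(4,3),(4,2)] * (1 - t n) ^ length [3::nat])
     + 1 / 4 * (monomial [(4,3),(4,3),(4,3),(4,3)] [] n - t n ^ length [(4::nat,3::nat),(4,3),(4,3),(4,3)] * (1 - t n) ^ length ([] :: nat list))))"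
    (is "bps ?X")
    by (intro bps_add bps_diff[of "\<lambda>n. 3 / 8 * (ln (1 - t (n + 4)) + P (n + 4))"] bps_cmult bps_monomials 1 2 3)
  also have "?X = (\<lambda>n. sin4_entropy_step n + 2 * t n ^ 3)"
  proof
    fix n
    define d where "d pq ss = t n ^ length pq * (1 - t n) ^ length ss" for pq :: "(nat \<times> nat) list" and ss :: "nat list"
    \<comment> \<open>the linear and quadratic terms in \<open>t n\<close> cancel; this is where the exponent 6 comes from\<close>
    have aux: "3 / 8 * P n = 1 / 8 * (4 * (t n ^ length [(4::nat,2::nat)] * (1 - t n) ^ length [3::nat])
     + (- 1) * (t n ^ length [(4::nat,0::nat)] * (1 - t n) ^ length [3::nat,2,1])
     + (t n ^ length [(4::nat,1::nat),(2,1)] * (1 - t n) ^ length [3::nat,2])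
     + 2 * (t n ^ length [(4::nat,2::nat),(3,1)] * (1 - t n) ^ length [3::nat,2])
     + (- 1) * (t n ^ length [(4::nat,2::nat),(3,2),(3,2)] * (1 - t n) ^ length [3::nat])
     + (- 2) * (t n ^ length [(4::nat,3::nat),(4,3)] * (1 - t n) ^ length ([] :: nat list))
     + (t n ^ length [(4::nat,3::nat),(4,1)] * (1 - t n) ^ length [3::nat,2])
     + (- 1) * (t n ^ length [(4::nat,3::nat),(4,2),(3,2)] * (1 - t n) ^ length [3::nat])
     + 1 / 2 * (t n ^ length [(4::nat,2::nat),(4,2)] * (1 - t n) ^ length [3::nat,3])
     + (- 1) * (t n ^ length [(4::nat,3::nat),(4,3),(4,2)] * (1 - t n) ^ length [3::nat])
     + 1 / 4 * (t n ^ length [(4::nat,3::nat),(4,3),(4,3),(4,3)] * (1 - t n) ^ length ([] :: nat list)))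
       + 2 * t n ^ 3 - 35 / 32 * t n ^ 4"
      unfolding P_def by (simp add: field_simps power_numeral_reduce)
    show "?X n = sin4_entropy_step n + 2 * t n ^ 3"
      using aux unfolding sin4_entropy_step_eq t_def[symmetric] d_def[symmetric] by (simp add: field_simps)
  qed
  finally show ?thesis .
qed

text \<open>Up to a bounded error the entropy is a constant minus twice the partial sums of t^3,
  whose terms are nonnegative.\<close>

lemma bounded_sin4_entropy_iff: "bdd_below (range sin4_entropy) \<longleftrightarrow> summable (\<lambda>n. cmod (a n) ^ 6)"
proof -
  obtain K where K: "\<And>N. \<bar>\<Sum>n<N. sin4_entropy_step n + 2 * t n ^ 3\<bar> \<le> K"
    using bps_sin4_entropy_step by (auto simp: bps_def)
  have e: "sin4_entropy (N + 4) = sin4_entropy 4 + (\<Sum>n<N. sin4_entropy_step n + 2 * t n ^ 3) - 2 * (\<Sum>n<N. t n ^ 3)" for N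
    by (simp add: sin4_entropy_eq_sum sum.distrib sum_distrib_left)
  have s: "(\<lambda>n. cmod (a n) ^ 6) = (\<lambda>n. t n ^ 3)" by (simp add: t_def flip: power_mult)
  show ?thesis unfolding s
  proof
    assume "bdd_below (range sin4_entropy)"
    then obtain L where L: "\<And>n. L \<le> sin4_entropy n" by (auto simp: bdd_below_def)
    show "summable (\<lambda>n. t n ^ 3)"
    proof (rule summableI_nonneg_bounded)
      fix N show "(\<Sum>n<N. t n ^ 3) \<le> (sin4_entropy 4 + K - L) / 2"
        using e[of N] K[of N] L[of "N + 4"] by (simp add: abs_le_iff)
    qed (simp add: t_bounds)
  next
    assume sm: "summable (\<lambda>n. t n ^ 3)"
    have "sin4_entropy (N + 4) \<ge> sin4_entropy 4 - K - 2 * suminf (\<lambda>n. t n ^ 3)" for N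
      using e[of N] K[of N] sum_le_suminf[OF sm, of "{..<N}"] t_bounds by (simp add: abs_le_iff)
    then have "bdd_below ((\<lambda>N. sin4_entropy (N + 4)) ` UNIV)"
      by (intro bdd_belowI[of _ "sin4_entropy 4 - K - 2 * suminf (\<lambda>n. t n ^ 3)"]) auto
    moreover have "range sin4_entropy \<subseteq> sin4_entropy ` {..<4} \<union> (\<lambda>N. sin4_entropy (N + 4)) ` UNIV"
    proof
      fix x assume "x \<in> range sin4_entropy"
      then obtain m where "x = sin4_entropy m" by auto
      then show "x \<in> sin4_entropy ` {..<4} \<union> (\<lambda>N. sin4_entropy (N + 4)) ` UNIV"
        by (cases "m < 4") (auto intro!: image_eqI[of _ _ "m - 4"])
    qed
    ultimately show "bdd_below (range sin4_entropy)"
      using bdd_below_mono[of "sin4_entropy ` {..<4} \<union> (\<lambda>N. sin4_entropy (N + 4)) ` UNIV"] by simp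
  qed
qed

end

section \<open>The Bernstein-Szego measures: orthogonality and mass\<close>

context disc_seq
begin

definition bs_measure :: "nat \<Rightarrow> complex measure" where
  "bs_measure n = distr (density arc_measure (\<lambda>\<theta>. ennreal (bs_density n \<theta>))) borel cis"

lemma bs_density_measurable: "bs_density n \<in> borel_measurable borel"
  by (intro borel_measurable_continuous_onI continuous_bs_density)

lemma circle_meas_bs: "circle_meas (bs_measure n)"
proof (intro circle_meas.intro circle_meas_axioms.intro finite_measureI)
  have "emeasure (bs_measure n) (space (bs_measure n)) = (\<integral>\<^sup>+\<theta>. ennreal (bs_density n \<theta>) \<partial>arc_measure)"
    unfolding bs_measure_def using bs_density_measurable[of n] cis_measurable_borel
    by (simp add: emeasure_distr emeasure_density)
  also have "\<dots> < \<infinity>"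
    using integrable_arc[OF continuous_bs_density[of n]] bs_density_pos[of n]
    by (simp add: integrable_iff_bounded less_imp_le)
  finally show "emeasure (bs_measure n) (space (bs_measure n)) \<noteq> \<infinity>" by simp
  show "sets (bs_measure n) = sets borel" by (simp add: bs_measure_def)
  show "AE z in bs_measure n. cmod z = 1"
    unfolding bs_measure_def using cis_measurable_borel by (subst AE_distr_iff) auto
qed

lemma integral_bs_measure:
  fixes f :: "complex \<Rightarrow> 'b::euclidean_space"
  assumes "continuous_on UNIV f"
  shows "(\<integral>z. f z \<partial>bs_measure n) = (\<integral>\<theta>. bs_density n \<theta> *\<^sub>R f (cis \<theta>) \<partial>arc_measure)"
proof -
  have f: "f \<in> borel_measurable borel" using assms by (rule borel_measurable_continuous_onI)
  have "(\<integral>z. f z \<partial>bs_measure n) = (\<integral>\<theta>. f (cis \<theta>) \<partial>density arc_measure (\<lambda>\<theta>. ennreal (bs_density n \<theta>)))"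
    unfolding bs_measure_def using cis_measurable_borel f by (intro integral_distr) auto
  also have "\<dots> = (\<integral>\<theta>. bs_density n \<theta> *\<^sub>R f (cis \<theta>) \<partial>arc_measure)"
    using bs_density_measurable[of n] bs_density_pos[of n] measurable_compose[OF cis_measurable_borel f]
    by (intro integral_density) (auto simp: less_imp_le)
  finally show ?thesis .
qed

text \<open>On the circle w_n cnj (z^k) Phi_n is a multiple of z^(n-k) / Phis_n, the boundary value
  of an analytic function that vanishes at 0 for k < n; so its mean is 0. This settles degree n, and
  \<open>orth_down\<close> descends from there.\<close>

lemma orth_bs_measure: "k \<le> n \<Longrightarrow> circle_meas.orth (bs_measure n) k (Phi a k)"
proof -
  interpret B: circle_meas "bs_measure n" by (rule circle_meas_bs)
  define N where "N = (\<Prod>j<n. 1 - (cmod (a j))\<^sup>2)"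
  have top: "B.orth n (Phi a n)"
    unfolding B.orth_def
  proof (intro allI impI)
    fix k assume k: "k < n"
    have eq: "bs_density n \<theta> *\<^sub>R (cnj (cis \<theta> ^ k) * poly (Phi a n) (cis \<theta>))
        = of_real N * (cis \<theta> ^ (n - k) / poly (Phis a n) (cis \<theta>))" for \<theta>
    proof -
      define z where "z = cis \<theta>"
      have z: "cmod z = 1" "cnj z * z = 1" by (simp_all add: z_def cis_cnj cis_mult)
      define P Q where "P = poly (Phi a n) z" and "Q = poly (Phis a n) z"
      have Q: "Q = z ^ n * cnj P" unfolding P_def Q_def using z by (intro poly_Phis_circle)
      have Q0: "Q \<noteq> 0" unfolding Q_def z_def by (rule Phis_cis_ne)
      then have P0: "P \<noteq> 0" unfolding Q by auto
      have zk: "cnj (z ^ k) * z ^ n = z ^ (n - k)"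
      proof -
        have "cnj (z ^ k) * z ^ n = (cnj z * z) ^ k * z ^ (n - k)"
          using k by (simp add: power_mult_distrib flip: power_add)
        then show ?thesis by (simp add: z)
      qed
      have "complex_of_real ((cmod Q)\<^sup>2) = complex_of_real ((cmod P)\<^sup>2)"
        unfolding Q by (simp add: norm_mult norm_power z)
      also have "\<dots> = P * cnj P" by (rule complex_norm_square)
      finally have nQ: "complex_of_real ((cmod Q)\<^sup>2) = P * cnj P" .
      have "bs_density n \<theta> *\<^sub>R (cnj (z ^ k) * P) = of_real N * (cnj (z ^ k) * P) / complex_of_real ((cmod Q)\<^sup>2)"
        by (simp add: bs_density_def N_def Q_def z_def scaleR_conv_of_real)
      also have "\<dots> = of_real N * (cnj (z ^ k) / cnj P)" unfolding nQ using P0 by simp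
      also have "cnj (z ^ k) / cnj P = cnj (z ^ k) * z ^ n / Q"
        unfolding Q using P0 z by (auto simp: field_simps)
      finally show ?thesis unfolding zk by (simp add: P_def Q_def z_def)
    qed
    have an: "(\<lambda>z. z ^ (n - k) / poly (Phis a n) z) analytic_on cball 0 1"
      using Phis_bound(1) by (intro analytic_intros poly_analytic_on) auto
    have "(\<integral>z. cnj (z ^ k) * poly (Phi a n) z \<partial>bs_measure n)
        = (\<integral>\<theta>. bs_density n \<theta> *\<^sub>R (cnj (cis \<theta> ^ k) * poly (Phi a n) (cis \<theta>)) \<partial>arc_measure)"
      by (intro integral_bs_measure continuous_intros)
    also have "\<dots> = of_real N * (\<integral>\<theta>. cis \<theta> ^ (n - k) / poly (Phis a n) (cis \<theta>) \<partial>arc_measure)"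
      unfolding eq by (rule integral_mult_right_zero)
    also have "\<dots> = 0" using mean_value_circle[OF an] k by simp
    finally show "(\<integral>z. cnj (z ^ k) * poly (Phi a n) z \<partial>bs_measure n) = 0" .
  qed
  show "B.orth k (Phi a k)" if "k \<le> n"
    using that top by (induction rule: inc_induct) (auto intro: B.orth_down lt1)
qed

text \<open>The squared norm of Phi_n is computed twice: w_n |Phi_n|^2 is the constant N, while the
  product formula gives N times the mass.\<close>

lemma measure_bs_measure: "measure (bs_measure n) UNIV = 1"
proof -
  interpret B: circle_meas "bs_measure n" by (rule circle_meas_bs)
  interpret prob_space arc_measure by (rule prob_space_arc_measure)
  define N where "N = (\<Prod>j<n. 1 - (cmod (a j))\<^sup>2)"
  have N: "N > 0" unfolding N_def using one_minus_pos by (intro prod_pos) auto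
  have "B.sqnorm (Phi a n) = (\<integral>\<theta>. bs_density n \<theta> *\<^sub>R (cmod (poly (Phi a n) (cis \<theta>)))\<^sup>2 \<partial>arc_measure)"
    unfolding B.sqnorm_def by (intro integral_bs_measure continuous_intros)
  also have "\<dots> = (\<integral>\<theta>. N \<partial>arc_measure)"
  proof (intro Bochner_Integration.integral_cong refl)
    fix \<theta>
    have "cmod (poly (Phi a n) (cis \<theta>)) \<noteq> 0"
      using Phis_cis_ne[of n \<theta>] by (simp flip: norm_Phis_circle)
    then show "bs_density n \<theta> *\<^sub>R (cmod (poly (Phi a n) (cis \<theta>)))\<^sup>2 = N"
      by (simp add: bs_density_def N_def norm_Phis_circle)
  qed
  also have "\<dots> = N" using prob_space by simp
  finally have "N * measure (bs_measure n) UNIV = N"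
    using B.sqnorm_Phi[of n a] orth_bs_measure by (simp add: N_def)
  then show ?thesis using N by simp
qed

end

text \<open>On the circle real polynomials in Re z and Im z are trigonometric polynomials. All
  negative powers sit in one factor cnj (z^d), so the integral involves finitely many
  moments.\<close>

lemma real_polynomial_function_circle:
  fixes g :: "complex \<Rightarrow> real"
  assumes "real_polynomial_function g"
  shows "\<exists>d p. \<forall>z. cmod z = 1 \<longrightarrow> complex_of_real (g z) = cnj (z ^ d) * poly p z"
  using assms
proof induction
  case (linear f)
  interpret bounded_linear f by fact
  \<comment> \<open>The coefficients come from Re z = (z + cnj z) / 2 and Im z = (z - cnj z) / (2
    i), with z written as cnj z times z^2.\<close>
  have "complex_of_real (f z) = cnj (z ^ 1) * poly [: (of_real (f 1) + \<i> * of_real (f \<i>)) / 2, 0, (of_real (f 1) - \<i> * of_real (f \<i>)) / 2 :] z"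
    if "cmod z = 1" for z
  proof -
    have zz: "cnj z * z = 1" using that by (simp add: complex_norm_square[symmetric] mult.commute)
    have "z = Re z *\<^sub>R 1 + Im z *\<^sub>R \<i>" by (simp add: complex_eq_iff)
    then have "f z = f (Re z *\<^sub>R 1 + Im z *\<^sub>R \<i>)" by (rule arg_cong)
    also have "\<dots> = Re z * f 1 + Im z * f \<i>" by (simp only: add scale real_scaleR_def)
    finally have "complex_of_real (f z) = of_real (Re z) * of_real (f 1) + of_real (Im z) * of_real (f \<i>)" by simp
    also have "complex_of_real (Re z) = (z + cnj z) / 2" by (simp add: complex_eq_iff)
    also have "complex_of_real (Im z) = (z - cnj z) / (2 * \<i>)" by (simp add: complex_eq_iff)
    finally have "complex_of_real (f z) = (z + cnj z) / 2 * f 1 + (z - cnj z) / (2 * \<i>) * f \<i>" .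
    also have "\<dots> = cnj z * ((of_real (f 1) + \<i> * of_real (f \<i>)) / 2) + (of_real (f 1) - \<i> * of_real (f \<i>)) / 2 * z"
      by (simp add: field_simps)
    also have "\<dots> = cnj z * ((of_real (f 1) + \<i> * of_real (f \<i>)) / 2) + (of_real (f 1) - \<i> * of_real (f \<i>)) / 2 * z * (cnj z * z)"
      by (simp add: zz)
    finally show ?thesis by (simp add: algebra_simps)
  qed
  then show ?case by blast
next
  case (const c)
  show ?case by (rule exI[of _ 0], rule exI[of _ "[:of_real c:]"]) simp
next
  case (add f g)
  then obtain d p e q where f: "\<And>z. cmod z = 1 \<Longrightarrow> complex_of_real (f z) = cnj (z ^ d) * poly p z"
    and g: "\<And>z. cmod z = 1 \<Longrightarrow> complex_of_real (g z) = cnj (z ^ e) * poly q z" by blast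
  have "complex_of_real (f z + g z) = cnj (z ^ (d + e)) * poly (monom 1 e * p + monom 1 d * q) z" if z: "cmod z = 1" for z
  proof -
    have zz: "cnj z * z = 1" using z by (simp add: complex_norm_square[symmetric] mult.commute)
    have "cnj (z ^ (d + e)) * poly (monom 1 e * p + monom 1 d * q) z
       = (cnj z * z) ^ e * (cnj (z ^ d) * poly p z) + (cnj z * z) ^ d * (cnj (z ^ e) * poly q z)"
      by (simp add: poly_monom power_add power_mult_distrib algebra_simps)
    then show ?thesis by (simp add: zz f[OF z] g[OF z])
  qed
  then show ?case by blast
next
  case (mult f g)
  then obtain d p e q where f: "\<And>z. cmod z = 1 \<Longrightarrow> complex_of_real (f z) = cnj (z ^ d) * poly p z"
    and g: "\<And>z. cmod z = 1 \<Longrightarrow> complex_of_real (g z) = cnj (z ^ e) * poly q z" by blast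
  have "complex_of_real (f z * g z) = cnj (z ^ (d + e)) * poly (p * q) z" if "cmod z = 1" for z
    using f[OF that] g[OF that] by (simp add: power_add)
  then show ?case by blast
qed

lemma (in circle_meas) integral_real_polynomial:
  fixes g :: "complex \<Rightarrow> real"
  assumes g: "\<And>z. cmod z = 1 \<Longrightarrow> complex_of_real (g z) = cnj (z ^ d) * poly p z" and "continuous_on UNIV g"
  shows "complex_of_real (\<integral>z. g z \<partial>M) = (\<Sum>i\<le>degree p. coeff p i * (\<integral>z. cnj (z ^ d) * z ^ i \<partial>M))"
proof -
  have "complex_of_real (\<integral>z. g z \<partial>M) = (\<integral>z. complex_of_real (g z) \<partial>M)" by simp
  also have "\<dots> = (\<integral>z. (\<Sum>i\<le>degree p. coeff p i * (cnj (z ^ d) * z ^ i)) \<partial>M)"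
    using assms by (intro integral_cong_circle continuous_intros)
      (auto simp: poly_altdef sum_distrib_left mult_ac)
  also have "\<dots> = (\<Sum>i\<le>degree p. (\<integral>z. coeff p i * (cnj (z ^ d) * z ^ i) \<partial>M))"
    by (intro Bochner_Integration.integral_sum integrable_cont continuous_intros)
  finally show ?thesis by simp
qed

text \<open>An exact equality instead of a limit: a trigonometric polynomial involves finitely many
  moments, and those up to order n coincide.\<close>

lemma bs_measure_eventually_eq:
  assumes "nontrivial_circle_prob \<mu>" "a = verblunsky \<mu>" "real_polynomial_function g"
  shows "\<forall>\<^sub>F n in sequentially. (\<integral>z. g z \<partial>disc_seq.bs_measure a n) = (\<integral>z. g z \<partial>\<mu>)"
proof -
  interpret disc_seq a using verblunsky_Phi[OF assms(1)] by unfold_locales (simp add: assms(2))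
  interpret M: circle_meas \<mu> by (rule nontrivial_circle_meas) fact
  obtain d p where g: "\<And>z. cmod z = 1 \<Longrightarrow> complex_of_real (g z) = cnj (z ^ d) * poly p z"
    using real_polynomial_function_circle[OF assms(3)] by blast
  have cont: "continuous_on UNIV g"
    using assms(3) by (simp add: continuous_on_polymonial_function real_polynomial_function_eq)
  have "measure \<mu> UNIV = 1"
    using assms(1) prob_space.prob_space[of \<mu>] by (simp add: nontrivial_circle_prob_def)
  then have tot: "measure (bs_measure n) UNIV = measure \<mu> UNIV" for n
    by (simp only: measure_bs_measure)
  have orth: "M.orth k (Phi a k)" for k
    unfolding assms(2) by (rule verblunsky_Phi(1)[OF assms(1)])
  have mom: "(\<integral>z. cnj (z ^ d) * z ^ i \<partial>bs_measure n) = (\<integral>z. cnj (z ^ d) * z ^ i \<partial>\<mu>)"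
    if "d \<le> n" "i \<le> n" for i n
    by (rule circle_moments_eq[OF circle_meas_bs M.circle_meas_axioms tot orth_bs_measure orth that])
  have "(\<integral>z. g z \<partial>bs_measure n) = (\<integral>z. g z \<partial>\<mu>)" if n: "n \<ge> max d (degree p)" for n
  proof -
    have "complex_of_real (\<integral>z. g z \<partial>bs_measure n)
        = (\<Sum>i\<le>degree p. coeff p i * (\<integral>z. cnj (z ^ d) * z ^ i \<partial>bs_measure n))"
      by (rule circle_meas.integral_real_polynomial[OF circle_meas_bs _ cont]) (rule g)
    also have "\<dots> = (\<Sum>i\<le>degree p. coeff p i * (\<integral>z. cnj (z ^ d) * z ^ i \<partial>\<mu>))"
      using n by (intro sum.cong refl arg_cong2[where f = "(*)"] mom) auto
    also have "\<dots> = complex_of_real (\<integral>z. g z \<partial>\<mu>)"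
      by (rule M.integral_real_polynomial[OF _ cont, symmetric]) (rule g)
    finally have "complex_of_real (\<integral>z. g z \<partial>bs_measure n) = complex_of_real (\<integral>z. g z \<partial>\<mu>)" .
    then show ?thesis by (simp only: of_real_eq_iff)
  qed
  then show ?thesis by (rule eventually_sequentiallyI)
qed

text \<open>ln x <= x at x = w_n g, for an n at which the approximation already integrates sin^4 g
  exactly as mu does. Writing sin as Im z keeps this product a polynomial.\<close>

lemma entropy_dual_bound_polynomial:
  assumes "nontrivial_circle_prob \<mu>" "a = verblunsky \<mu>" "real_polynomial_function g"
    and C: "\<And>n. - C \<le> disc_seq.sin4_entropy a n"
    and pos: "\<And>z. cmod z = 1 \<Longrightarrow> 0 < g z"
  shows "(\<integral>\<theta>. sin \<theta> ^ 4 * ln (g (cis \<theta>)) \<partial>arc_measure) \<le> (\<integral>z. Im z ^ 4 * g z \<partial>\<mu>) + C"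
proof -
  interpret disc_seq a using verblunsky_Phi[OF assms(1)] by unfold_locales (simp add: assms(2))
  have cont: "continuous_on UNIV g"
    using assms(3) by (simp add: continuous_on_polymonial_function real_polynomial_function_eq)
  have "real_polynomial_function Im" by (rule real_polynomial_function.intros(1)) (rule bounded_linear_Im)
  then have rp: "real_polynomial_function (\<lambda>z. Im z ^ 4 * g z)"
    using assms(3) by (intro real_polynomial_function.intros(4) real_polynomial_function_power)
  obtain n where n: "(\<integral>z. Im z ^ 4 * g z \<partial>bs_measure n) = (\<integral>z. Im z ^ 4 * g z \<partial>\<mu>)"
    using bs_measure_eventually_eq[OF assms(1,2) rp] by (auto simp: eventually_sequentially)
  have cg: "continuous_on UNIV (\<lambda>\<theta>. g (cis \<theta>))"
    using continuous_on_compose2[OF cont, of UNIV cis] by (simp add: continuous_intros)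
  have gp: "0 < g (cis \<theta>)" for \<theta> by (rule pos) simp
  have i1: "integrable arc_measure (\<lambda>\<theta>. sin \<theta> ^ 4 * ln (bs_density n \<theta>))"
    using bs_density_pos[of n] by (intro integrable_arc continuous_intros continuous_bs_density) (auto simp: less_le)
  have i2: "integrable arc_measure (\<lambda>\<theta>. sin \<theta> ^ 4 * ln (g (cis \<theta>)))"
    using gp by (intro integrable_arc continuous_intros cg) (auto simp: less_le)
  have i3: "integrable arc_measure (\<lambda>\<theta>. bs_density n \<theta> *\<^sub>R (Im (cis \<theta>) ^ 4 * g (cis \<theta>)))"
    by (intro integrable_arc continuous_intros continuous_bs_density cg)
  have "sin4_entropy n + (\<integral>\<theta>. sin \<theta> ^ 4 * ln (g (cis \<theta>)) \<partial>arc_measure)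
      = (\<integral>\<theta>. sin \<theta> ^ 4 * ln (bs_density n \<theta>) + sin \<theta> ^ 4 * ln (g (cis \<theta>)) \<partial>arc_measure)"
    unfolding sin4_entropy_def by (rule Bochner_Integration.integral_add[OF i1 i2, symmetric])
  also have "\<dots> \<le> (\<integral>\<theta>. bs_density n \<theta> *\<^sub>R (Im (cis \<theta>) ^ 4 * g (cis \<theta>)) \<partial>arc_measure)"
  proof (rule integral_mono[OF Bochner_Integration.integrable_add[OF i1 i2] i3])
    fix \<theta>
    have "ln (bs_density n \<theta> * g (cis \<theta>)) \<le> bs_density n \<theta> * g (cis \<theta>)"
      using ln_le_minus_one[of "bs_density n \<theta> * g (cis \<theta>)"] bs_density_pos[of n \<theta>] gp[of \<theta>] by simp
    then have "ln (bs_density n \<theta>) + ln (g (cis \<theta>)) \<le> bs_density n \<theta> * g (cis \<theta>)"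
      using bs_density_pos[of n \<theta>] gp[of \<theta>] by (simp add: ln_mult_pos)
    then have "sin \<theta> ^ 4 * (ln (bs_density n \<theta>) + ln (g (cis \<theta>))) \<le> sin \<theta> ^ 4 * (bs_density n \<theta> * g (cis \<theta>))"
      by (intro mult_left_mono) auto
    then show "sin \<theta> ^ 4 * ln (bs_density n \<theta>) + sin \<theta> ^ 4 * ln (g (cis \<theta>))
        \<le> bs_density n \<theta> *\<^sub>R (Im (cis \<theta>) ^ 4 * g (cis \<theta>))"
      by (simp add: algebra_simps)
  qed
  also have "\<dots> = (\<integral>z. Im z ^ 4 * g z \<partial>bs_measure n)"
    by (intro integral_bs_measure[symmetric] continuous_intros cont)
  finally show ?thesis using n C[of n] by linarith
qed

section \<open>Approximation by continuous functions in $L^1$ of several measures\<close>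

text \<open>A discrete layer cake of mesh b: every layer that starts below y is counted in full, so
  only the topmost one is in error.\<close>

lemma layer_bound:
  fixes y b :: real
  assumes "0 < b" "0 \<le> y" "y \<le> real m * b"
  shows "\<bar>y - (\<Sum>k<m. b * (if real k * b < y then 1 else 0))\<bar> \<le> b"
  using assms
proof (induction m arbitrary: y)
  case (Suc m)
  show ?case
  proof (cases "y \<le> real m * b")
    case True
    then show ?thesis using Suc.IH[of y] Suc.prems by simp
  next
    case False
    have "(\<Sum>k<Suc m. b * (if real k * b < y then 1 else 0)) = (\<Sum>k<Suc m. b)"
    proof (intro sum.cong refl)
      fix k assume "k \<in> {..<Suc m}"
      then have "real k * b \<le> real m * b" using Suc.prems(1) by (intro mult_right_mono) auto
      then show "b * (if real k * b < y then 1 else 0) = b" using False by simp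
    qed
    then show ?thesis using False Suc.prems by (simp add: algebra_simps)
  qed
qed simp

text \<open>One continuous function has to serve all measures of the set, since the test function
  appears under mu on one side of the dual bound and under arc length on the other.\<close>

definition L1_approx :: "'a::euclidean_space measure set \<Rightarrow> ('a \<Rightarrow> real) \<Rightarrow> bool" where
  "L1_approx \<M> f \<longleftrightarrow> (\<forall>e>0. \<exists>c. continuous_on UNIV c \<and> (\<forall>M\<in>\<M>. (\<integral>\<^sup>+x. ennreal \<bar>f x - c x\<bar> \<partial>M) \<le> ennreal e))"

locale finite_borel_measures =
  fixes \<M> :: "'a::euclidean_space measure set"
  assumes finite: "finite \<M>"
    and sets: "M \<in> \<M> \<Longrightarrow> sets M = sets borel"
    and fin: "M \<in> \<M> \<Longrightarrow> finite_measure M"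
begin

lemma borel_measurable_\<M>: "M \<in> \<M> \<Longrightarrow> f \<in> borel_measurable borel \<Longrightarrow> f \<in> borel_measurable M"
  using measurable_cong_sets[OF sets refl] by blast

lemma compact_open_approx:
  assumes M: "M \<in> \<M>" and B: "B \<in> sets borel" and e: "0 < (e::real)"
  shows "\<exists>K U. compact K \<and> K \<subseteq> B \<and> B \<subseteq> U \<and> open U \<and> emeasure M (U - K) \<le> ennreal e"
proof -
  interpret finite_measure M using fin[OF M] .
  note s = sets[OF M]
  have "\<exists>K\<in>{K. K \<subseteq> B \<and> compact K}. emeasure M B < emeasure M K + ennreal (e / 2)"
    by (rule SUP_approx_ennreal[OF _ _ inner_regular[OF s _ B]]) (use e in auto)
  then obtain K where K: "K \<subseteq> B" "compact K" "emeasure M B \<le> emeasure M K + ennreal (e / 2)"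
    by (auto intro: less_imp_le)
  have "\<exists>U\<in>{U. B \<subseteq> U \<and> open U}. emeasure M U < emeasure M B + ennreal (e / 2)"
    by (rule INF_approx_ennreal[OF _ outer_regular[OF s _ B]]) (use e in auto)
  then obtain U where U: "B \<subseteq> U" "open U" "emeasure M U \<le> emeasure M B + ennreal (e / 2)"
    by (auto intro: less_imp_le)
  have "emeasure M (U - K) = emeasure M U - emeasure M K"
    using K U s by (intro emeasure_Diff) (auto simp: borel_compact)
  also have "\<dots> \<le> (emeasure M K + ennreal (e / 2) + ennreal (e / 2)) - emeasure M K"
    using K(3) U(3) by (intro ennreal_minus_mono order_trans[OF U(3)] add_mono) auto
  also have "\<dots> = ennreal (e / 2) + ennreal (e / 2)"
    by (simp add: add.assoc ennreal_add_diff_cancel_left)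
  also have "\<dots> = ennreal e" using e by (simp flip: ennreal_plus)
  finally show ?thesis using K U by blast
qed

text \<open>Regularity gives compact K_M inside B and open U_M around it for each M. A Urysohn
  function equal to 1 on the union of the K_M and to 0 off the intersection of the U_M differs from
  the indicator only within U_M - K_M, for every M at once. Finiteness keeps the union compact and
  the intersection open.\<close>

lemma L1_approx_indicator:
  assumes B: "B \<in> sets borel" shows "L1_approx \<M> (indicator B)"
  unfolding L1_approx_def
proof (intro allI impI)
  fix e :: real assume e: "e > 0"
  have "\<forall>M\<in>\<M>. \<exists>K U. compact K \<and> K \<subseteq> B \<and> B \<subseteq> U \<and> open U \<and> emeasure M (U - K) \<le> ennreal e"
    using compact_open_approx[OF _ B e] by blast
  then obtain K U where KU: "\<And>M. M \<in> \<M> \<Longrightarrow> compact (K M)" "\<And>M. M \<in> \<M> \<Longrightarrow> K M \<subseteq> B"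
    "\<And>M. M \<in> \<M> \<Longrightarrow> B \<subseteq> U M" "\<And>M. M \<in> \<M> \<Longrightarrow> open (U M)"
    "\<And>M. M \<in> \<M> \<Longrightarrow> emeasure M (U M - K M) \<le> ennreal e"
    by metis
  have "closed (\<Union>M\<in>\<M>. K M)" using KU finite by (intro compact_imp_closed compact_UN) auto
  moreover have "closed (- (\<Inter>M\<in>\<M>. U M))" using KU finite by (intro closed_Compl open_INT) auto
  moreover have "(\<Union>M\<in>\<M>. K M) \<inter> - (\<Inter>M\<in>\<M>. U M) = {}" using KU(2,3) by blast
  ultimately obtain c :: "'a \<Rightarrow> real" where c: "continuous_on UNIV c" "\<And>x. c x \<in> closed_segment 1 0"
    "\<And>x. x \<in> (\<Union>M\<in>\<M>. K M) \<Longrightarrow> c x = 1" "\<And>x. x \<in> - (\<Inter>M\<in>\<M>. U M) \<Longrightarrow> c x = 0"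
    by (rule Urysohn[where a = 1 and b = 0]) blast
  have c01: "0 \<le> c x" "c x \<le> 1" for x using c(2)[of x] by (auto simp: closed_segment_eq_real_ivl)
  have "(\<integral>\<^sup>+x. ennreal \<bar>indicator B x - c x\<bar> \<partial>M) \<le> ennreal e" if M: "M \<in> \<M>" for M
  proof -
    have "(\<integral>\<^sup>+x. ennreal \<bar>indicator B x - c x\<bar> \<partial>M) \<le> (\<integral>\<^sup>+x. indicator (U M - K M) x \<partial>M)"
    proof (rule nn_integral_mono)
      fix x
      show "ennreal \<bar>indicator B x - c x\<bar> \<le> indicator (U M - K M) x"
        using c01[of x] c(3,4)[of x] KU(2,3)[OF M] M
        by (cases "x \<in> K M"; cases "x \<in> U M"; cases "x \<in> B") (auto simp: ennreal_le_1)
    qed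
    also have "\<dots> = emeasure M (U M - K M)"
      using KU(1,4)[OF M] by (intro nn_integral_indicator) (auto simp: sets[OF M] borel_compact)
    also have "\<dots> \<le> ennreal e" by (rule KU(5)[OF M])
    finally show ?thesis .
  qed
  then show "\<exists>c. continuous_on UNIV c \<and> (\<forall>M\<in>\<M>. (\<integral>\<^sup>+x. ennreal \<bar>indicator B x - c x\<bar> \<partial>M) \<le> ennreal e)"
    using c(1) by blast
qed

lemma L1_approx_add_cmult:
  assumes f: "L1_approx \<M> f" "f \<in> borel_measurable borel" and g: "L1_approx \<M> g" "g \<in> borel_measurable borel"
  shows "L1_approx \<M> (\<lambda>x. f x + k * g x)"
  unfolding L1_approx_def
proof (intro allI impI)
  fix e :: real assume e: "e > 0"
  define d where "d = e / (1 + \<bar>k\<bar>)"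
  have "d * (1 + \<bar>k\<bar>) = e" unfolding d_def by simp
  then have d: "d + \<bar>k\<bar> * d = e" "d > 0" using e by (simp add: algebra_simps, simp add: d_def add_pos_nonneg)
  obtain u where u: "continuous_on UNIV u" "\<And>M. M \<in> \<M> \<Longrightarrow> (\<integral>\<^sup>+x. ennreal \<bar>f x - u x\<bar> \<partial>M) \<le> ennreal d"
    using f(1) d(2) unfolding L1_approx_def by blast
  obtain v where v: "continuous_on UNIV v" "\<And>M. M \<in> \<M> \<Longrightarrow> (\<integral>\<^sup>+x. ennreal \<bar>g x - v x\<bar> \<partial>M) \<le> ennreal d"
    using g(1) d(2) unfolding L1_approx_def by blast
  have "(\<integral>\<^sup>+x. ennreal \<bar>f x + k * g x - (u x + k * v x)\<bar> \<partial>M) \<le> ennreal e" if M: "M \<in> \<M>" for M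
  proof -
    have m: "(\<lambda>x. ennreal \<bar>f x - u x\<bar>) \<in> borel_measurable M" "(\<lambda>x. ennreal \<bar>g x - v x\<bar>) \<in> borel_measurable M"
      using f(2) g(2) borel_measurable_continuous_onI[OF u(1)] borel_measurable_continuous_onI[OF v(1)]
      by (auto intro!: borel_measurable_\<M>[OF M])
    have "(\<integral>\<^sup>+x. ennreal \<bar>f x + k * g x - (u x + k * v x)\<bar> \<partial>M)
       \<le> (\<integral>\<^sup>+x. ennreal \<bar>f x - u x\<bar> + ennreal \<bar>k\<bar> * ennreal \<bar>g x - v x\<bar> \<partial>M)"
    proof (rule nn_integral_mono)
      fix x
      have "\<bar>f x + k * g x - (u x + k * v x)\<bar> \<le> \<bar>f x - u x\<bar> + \<bar>k * (g x - v x)\<bar>"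
        by (simp add: algebra_simps abs_triangle_ineq)
      then show "ennreal \<bar>f x + k * g x - (u x + k * v x)\<bar> \<le> ennreal \<bar>f x - u x\<bar> + ennreal \<bar>k\<bar> * ennreal \<bar>g x - v x\<bar>"
        by (simp add: abs_mult flip: ennreal_mult ennreal_plus) 
    qed
    also have "\<dots> = (\<integral>\<^sup>+x. ennreal \<bar>f x - u x\<bar> \<partial>M) + ennreal \<bar>k\<bar> * (\<integral>\<^sup>+x. ennreal \<bar>g x - v x\<bar> \<partial>M)"
      using m by (simp add: nn_integral_add nn_integral_cmult)
    also have "\<dots> \<le> ennreal d + ennreal \<bar>k\<bar> * ennreal d"
      using u(2)[OF M] v(2)[OF M] by (intro add_mono mult_left_mono) auto
    also have "\<dots> = ennreal e"
      using d by (simp flip: ennreal_mult ennreal_plus)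
    finally show ?thesis .
  qed
  then show "\<exists>c. continuous_on UNIV c \<and> (\<forall>M\<in>\<M>. (\<integral>\<^sup>+x. ennreal \<bar>f x + k * g x - c x\<bar> \<partial>M) \<le> ennreal e)"
    using u(1) v(1) by (intro exI[of _ "\<lambda>x. u x + k * v x"]) (auto intro!: continuous_intros)
qed

lemma L1_approx_layers:
  assumes f: "f \<in> borel_measurable borel"
  shows "L1_approx \<M> (\<lambda>x. \<Sum>k<m. b * indicator {x. real k * b < f x} x)"
proof (induction m)
  case 0
  show ?case unfolding L1_approx_def by (auto intro!: exI[of _ "\<lambda>x. 0"])
next
  case (Suc m)
  have s: "{x. real k * b < f x} \<in> sets borel" for k
    using f by measurable
  have gm: "(\<lambda>x. \<Sum>k<m. b * indicator {x. real k * b < f x} x) \<in> borel_measurable borel"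
    using s by (intro borel_measurable_sum borel_measurable_times borel_measurable_const borel_measurable_indicator)
  show ?case
    using L1_approx_add_cmult[OF Suc gm L1_approx_indicator[OF s] borel_measurable_indicator[OF s], of b m]
    by (simp only: sum.lessThan_Suc)
qed

lemma L1_approx_bounded:
  assumes f: "f \<in> borel_measurable borel" "\<And>x. 0 \<le> f x" "\<And>x. f x \<le> B"
  shows "L1_approx \<M> f"
  unfolding L1_approx_def
proof (intro allI impI)
  fix e :: real assume e: "e > 0"
  \<comment> \<open>T dominates all masses, so a uniform error b costs at most b T = e / 2 in each
    L^1 norm; the summand 1 keeps T positive.\<close>
  define T where "T = (\<Sum>M\<in>\<M>. measure M (space M)) + 1"
  have T: "measure M (space M) \<le> T" if "M \<in> \<M>" for M
    using member_le_sum[OF that, of "\<lambda>M. measure M (space M)"] finite by (simp add: T_def)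
  have T0: "T > 0" unfolding T_def by (intro add_nonneg_pos sum_nonneg) auto
  define b where "b = e / 2 / T"
  have b: "b > 0" using e T0 by (simp add: b_def)
  obtain m where m: "B < real m * b" using reals_Archimedean3[OF b] by blast
  define g where "g x = (\<Sum>k<m. b * indicator {x. real k * b < f x} x)" for x
  have s: "{x. real k * b < f x} \<in> sets borel" for k
    using f(1) by measurable
  have gm: "g \<in> borel_measurable borel"
    unfolding g_def[abs_def] using s
    by (intro borel_measurable_sum borel_measurable_times borel_measurable_const borel_measurable_indicator)
  have fg: "\<bar>f x - g x\<bar> \<le> b" for x
    using layer_bound[OF b f(2)[of x], of m] f(3)[of x] m
    by (simp add: g_def indicator_def of_bool_def)
  have "L1_approx \<M> g" unfolding g_def by (rule L1_approx_layers[OF f(1)])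
  then obtain c where c: "continuous_on UNIV c" "\<And>M. M \<in> \<M> \<Longrightarrow> (\<integral>\<^sup>+x. ennreal \<bar>g x - c x\<bar> \<partial>M) \<le> ennreal (e / 2)"
    using e unfolding L1_approx_def by (metis half_gt_zero)
  have "(\<integral>\<^sup>+x. ennreal \<bar>f x - c x\<bar> \<partial>M) \<le> ennreal e" if M: "M \<in> \<M>" for M
  proof -
    interpret finite_measure M using fin[OF M] .
    have cm: "c \<in> borel_measurable borel" by (rule borel_measurable_continuous_onI[OF c(1)])
    have m: "(\<lambda>x. ennreal \<bar>g x - c x\<bar>) \<in> borel_measurable M"
      using gm cm by (intro borel_measurable_\<M>[OF M]) measurable
    have "(\<integral>\<^sup>+x. ennreal \<bar>f x - c x\<bar> \<partial>M) \<le> (\<integral>\<^sup>+x. ennreal b + ennreal \<bar>g x - c x\<bar> \<partial>M)"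
    proof (rule nn_integral_mono)
      fix x
      have "\<bar>f x - c x\<bar> \<le> b + \<bar>g x - c x\<bar>" using fg[of x] by linarith
      then show "ennreal \<bar>f x - c x\<bar> \<le> ennreal b + ennreal \<bar>g x - c x\<bar>"
        using b by (simp flip: ennreal_plus)
    qed
    also have "\<dots> = ennreal b * emeasure M (space M) + (\<integral>\<^sup>+x. ennreal \<bar>g x - c x\<bar> \<partial>M)"
      using m by (simp add: nn_integral_add)
    also have "\<dots> \<le> ennreal b * ennreal T + ennreal (e / 2)"
      using T[OF M] c(2)[OF M] by (intro add_mono mult_left_mono) (auto simp: emeasure_eq_measure intro: ennreal_leI)
    also have "\<dots> = ennreal e"
      using b T0 e by (simp add: b_def flip: ennreal_mult ennreal_plus)
    finally show ?thesis .
  qed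
  then show "\<exists>c. continuous_on UNIV c \<and> (\<forall>M\<in>\<M>. (\<integral>\<^sup>+x. ennreal \<bar>f x - c x\<bar> \<partial>M) \<le> ennreal e)"
    using c(1) by blast
qed

end

section \<open>The dual bound for Borel functions and the two implications\<close>

lemma circle_meas_circle_measure: "circle_meas circle_measure"
proof -
  interpret A: prob_space arc_measure by (rule prob_space_arc_measure)
  have c: "cis \<in> measurable arc_measure borel" using cis_measurable_borel by simp
  interpret prob_space circle_measure
    unfolding circle_measure_def by (rule A.prob_space_distr[OF c])
  show ?thesis
  proof
    show "sets circle_measure = sets borel" by (simp add: circle_measure_def)
    show "AE z in circle_measure. cmod z = 1"
      unfolding circle_measure_def by (subst AE_distr_iff[OF c]) auto
  qed
qed

lemma sin_power4_le_1: "sin (\<theta>::real) ^ 4 \<le> 1"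
proof -
  have "\<bar>sin \<theta>\<bar> ^ 4 \<le> 1" by (intro power_le_one) auto
  then show ?thesis by simp
qed

lemma Im_power4_le_1:
  assumes "cmod z = 1" shows "Im z ^ 4 \<le> 1"
proof -
  have "\<bar>Im z\<bar> ^ 4 \<le> 1" using abs_Im_le_cmod[of z] assms by (intro power_le_one) auto
  then show ?thesis by simp
qed

lemma ln_diff_le:
  fixes x y :: real
  assumes "1 \<le> x" "1 / 2 \<le> y"
  shows "ln x - ln y \<le> 2 * \<bar>x - y\<bar>"
proof -
  have "ln x - ln y = ln (x / y)" using assms by (simp add: ln_div)
  also have "\<dots> \<le> x / y - 1" using assms by (intro ln_le_minus_one) simp
  also have "\<dots> = (x - y) / y" using assms by (simp add: diff_divide_distrib)
  also have "\<dots> \<le> \<bar>x - y\<bar> / y" using assms by (intro divide_right_mono) auto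
  also have "\<dots> \<le> \<bar>x - y\<bar> / (1 / 2)" using assms by (intro divide_left_mono) auto
  finally show ?thesis by simp
qed

lemma (in circle_meas) integrable_bounded:
  fixes f :: "complex \<Rightarrow> real"
  assumes "f \<in> borel_measurable borel" "\<And>z. \<bar>f z\<bar> \<le> B"
  shows "integrable M f"
  using assms by (intro integrable_const_bound[of _ B] borel_measurable_M) auto

text \<open>f is replaced by a continuous function close to it in L^1 of mu and of arc length,
  clamped to [1, B], then approximated uniformly by a polynomial g. The lower bound 1 on f keeps g
  above 1/2, where ln has Lipschitz constant 2, so that L^1 closeness controls the
  logarithms.\<close>

lemma entropy_dual_bound:
  fixes f :: "complex \<Rightarrow> real"
  assumes \<mu>: "nontrivial_circle_prob \<mu>" and a: "a = verblunsky \<mu>"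
    and C: "\<And>n. - C \<le> disc_seq.sin4_entropy a n"
    and f: "f \<in> borel_measurable borel" "\<And>z. 1 \<le> f z" "\<And>z. f z \<le> B"
  shows "(\<integral>\<theta>. sin \<theta> ^ 4 * ln (f (cis \<theta>)) \<partial>arc_measure) \<le> (\<integral>z. Im z ^ 4 * f z \<partial>\<mu>) + C"
proof (rule field_le_epsilon)
  fix \<epsilon> :: real assume \<epsilon>: "\<epsilon> > 0"
  \<comment> \<open>The total loss is 6 e: twice 2 e from the logarithms and 2 e from the integral
    over mu. The cap 1/2 keeps g at least 1/2.\<close>
  define e where "e = min (\<epsilon> / 6) (1 / 2)"
  have e: "0 < e" "e \<le> 1 / 2" "6 * e \<le> \<epsilon>" using \<epsilon> by (auto simp: e_def)
  interpret M: circle_meas \<mu> by (rule nontrivial_circle_meas) fact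
  interpret \<Lambda>: circle_meas circle_measure by (rule circle_meas_circle_measure)
  interpret arc: prob_space arc_measure by (rule prob_space_arc_measure)
  have cA: "cis \<in> measurable arc_measure borel" using cis_measurable_borel by simp
  interpret finite_borel_measures "{\<mu>, circle_measure}"
  proof (rule finite_borel_measures.intro)
    fix N assume "N \<in> {\<mu>, circle_measure}"
    then show "sets N = sets borel" "finite_measure N"
      using M.sets_M \<Lambda>.sets_M M.finite_measure_axioms \<Lambda>.finite_measure_axioms by blast+
  qed simp
  have f0: "0 \<le> f z" "\<bar>f z\<bar> \<le> B" for z using f(2,3)[of z] by auto
  have "L1_approx {\<mu>, circle_measure} f" by (rule L1_approx_bounded[OF f(1) f0(1) f(3)])
  then obtain c where c: "continuous_on UNIV c"
    "\<And>N. N \<in> {\<mu>, circle_measure} \<Longrightarrow> (\<integral>\<^sup>+z. ennreal \<bar>f z - c z\<bar> \<partial>N) \<le> ennreal e"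
    using e(1) unfolding L1_approx_def by blast
  \<comment> \<open>Clamping does not increase the distance to f, whose values lie in
    [1, B].\<close>
  define c' where "c' z = max 1 (min B (c z))" for z
  have c': "continuous_on (sphere 0 1) c'"
    unfolding c'_def by (intro continuous_intros continuous_on_subset[OF c(1)]) auto
  obtain g where g: "real_polynomial_function g" "\<And>z. z \<in> sphere 0 1 \<Longrightarrow> \<bar>c' z - g z\<bar> < e"
    using Stone_Weierstrass_real_polynomial_function[OF compact_sphere c' e(1)] by metis
  have gc: "continuous_on UNIV g"
    using g(1) by (simp add: continuous_on_polymonial_function real_polynomial_function_eq)
  have gm: "g \<in> borel_measurable borel" by (rule borel_measurable_continuous_onI[OF gc])
  have g_half: "1 / 2 \<le> g z" if "cmod z = 1" for z
    using g(2)[of z] that e(2) unfolding c'_def by (auto simp: abs_less_iff)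
  have fg: "\<bar>f z - g z\<bar> \<le> e + \<bar>f z - c z\<bar>" if "cmod z = 1" for z
  proof -
    have "\<bar>f z - c' z\<bar> \<le> \<bar>f z - c z\<bar>" using f(2,3)[of z] by (auto simp: c'_def)
    then show ?thesis using g(2)[of z] that by simp
  qed
  have L1: "(\<integral>z. \<bar>f z - g z\<bar> \<partial>N) \<le> 2 * e"
    if N: "N \<in> {\<mu>, circle_measure}" "circle_meas N" "emeasure N UNIV = 1" for N
  proof -
    interpret N: circle_meas N by fact
    have m: "(\<lambda>z. ennreal \<bar>f z - c z\<bar>) \<in> borel_measurable N"
      using f(1) borel_measurable_continuous_onI[OF c(1)] by (intro N.borel_measurable_M) measurable
    have "(\<integral>\<^sup>+z. ennreal \<bar>f z - g z\<bar> \<partial>N) \<le> (\<integral>\<^sup>+z. ennreal e + ennreal \<bar>f z - c z\<bar> \<partial>N)"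
    proof (rule nn_integral_mono_AE)
      show "AE z in N. ennreal \<bar>f z - g z\<bar> \<le> ennreal e + ennreal \<bar>f z - c z\<bar>"
        using N.AE_circle
      proof eventually_elim
        case (elim z)
        then show ?case using fg[OF elim] e(1) by (simp flip: ennreal_plus)
      qed
    qed
    also have "\<dots> = ennreal e + (\<integral>\<^sup>+z. ennreal \<bar>f z - c z\<bar> \<partial>N)"
      using m N(3) by (simp add: nn_integral_add)
    also have "\<dots> \<le> ennreal e + ennreal e" using c(2)[OF N(1)] by (intro add_mono) auto
    also have "\<dots> = ennreal (2 * e)" using e(1) by (simp flip: ennreal_plus)
    finally have "(\<integral>\<^sup>+z. ennreal \<bar>f z - g z\<bar> \<partial>N) \<le> ennreal (2 * e)" .
    moreover have "(\<lambda>z. \<bar>f z - g z\<bar>) \<in> borel_measurable N"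
      using f(1) gm by (intro N.borel_measurable_M) measurable
    ultimately show ?thesis
      using e(1) by (simp add: integral_eq_nn_integral enn2real_leI)
  qed
  have M1: "emeasure \<mu> UNIV = 1"
    using \<mu> prob_space.emeasure_space_1[of \<mu>] by (simp add: nontrivial_circle_prob_def)
  have \<Lambda>1: "emeasure circle_measure UNIV = 1"
    unfolding circle_measure_def using cA arc.emeasure_space_1 by (simp add: emeasure_distr)
  have intf: "integrable N f" if "circle_meas N" for N
    by (rule circle_meas.integrable_bounded[OF that f(1) f0(2)])
  have intg: "integrable N g" if "circle_meas N" for N
    by (rule circle_meas.integrable_cont[OF that gc])
  have intabs: "integrable N (\<lambda>z. \<bar>f z - g z\<bar>)" if "circle_meas N" for N
    using intf[OF that] intg[OF that] by auto
  have "continuous_on UNIV (\<lambda>\<theta>. g (cis \<theta>))"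
    using continuous_on_compose2[OF gc, of UNIV cis] by (simp add: continuous_intros)
  moreover have "g (cis \<theta>) \<noteq> 0" for \<theta> using g_half[of "cis \<theta>"] by auto
  ultimately have intlg: "integrable arc_measure (\<lambda>\<theta>. sin \<theta> ^ 4 * ln (g (cis \<theta>)))"
    by (intro integrable_arc continuous_intros) auto
  have intfg: "integrable arc_measure (\<lambda>\<theta>. \<bar>f (cis \<theta>) - g (cis \<theta>)\<bar>)"
    using intabs[OF circle_meas_circle_measure] unfolding circle_measure_def by (rule integrable_distr[OF cA])
  have "(\<integral>\<theta>. sin \<theta> ^ 4 * ln (f (cis \<theta>)) \<partial>arc_measure)
      \<le> (\<integral>\<theta>. sin \<theta> ^ 4 * ln (g (cis \<theta>)) + 2 * \<bar>f (cis \<theta>) - g (cis \<theta>)\<bar> \<partial>arc_measure)"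
  proof (rule integral_mono)
    have "(\<lambda>\<theta>. sin \<theta> ^ 4 * ln (f (cis \<theta>))) \<in> borel_measurable arc_measure"
      using measurable_compose[OF cA f(1)] by simp
    moreover have "\<bar>sin \<theta> ^ 4 * ln (f (cis \<theta>))\<bar> \<le> ln B" for \<theta>
    proof -
      have "sin \<theta> ^ 4 * ln (f (cis \<theta>)) \<le> 1 * ln B"
        using f(2)[of "cis \<theta>"] f(3)[of "cis \<theta>"] by (intro mult_mono sin_power4_le_1) auto
      then show ?thesis using f(2)[of "cis \<theta>"] by (simp add: abs_mult)
    qed
    ultimately show "integrable arc_measure (\<lambda>\<theta>. sin \<theta> ^ 4 * ln (f (cis \<theta>)))"
      by (intro arc.integrable_const_bound[of _ "ln B"]) auto
  next
    show "integrable arc_measure (\<lambda>\<theta>. sin \<theta> ^ 4 * ln (g (cis \<theta>)) + 2 * \<bar>f (cis \<theta>) - g (cis \<theta>)\<bar>)"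
      using intlg intfg by simp
  next
    fix \<theta>
    have "ln (f (cis \<theta>)) - ln (g (cis \<theta>)) \<le> 2 * \<bar>f (cis \<theta>) - g (cis \<theta>)\<bar>"
      by (intro ln_diff_le f g_half) simp
    then have "sin \<theta> ^ 4 * (ln (f (cis \<theta>)) - ln (g (cis \<theta>))) \<le> sin \<theta> ^ 4 * (2 * \<bar>f (cis \<theta>) - g (cis \<theta>)\<bar>)"
      by (intro mult_left_mono) auto
    also have "\<dots> \<le> 1 * (2 * \<bar>f (cis \<theta>) - g (cis \<theta>)\<bar>)"
      by (intro mult_right_mono sin_power4_le_1) auto
    finally show "sin \<theta> ^ 4 * ln (f (cis \<theta>)) \<le> sin \<theta> ^ 4 * ln (g (cis \<theta>)) + 2 * \<bar>f (cis \<theta>) - g (cis \<theta>)\<bar>"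
      by (simp add: algebra_simps)
  qed
  also have "\<dots> = (\<integral>\<theta>. sin \<theta> ^ 4 * ln (g (cis \<theta>)) \<partial>arc_measure) + 2 * (\<integral>z. \<bar>f z - g z\<bar> \<partial>circle_measure)"
  proof -
    have "integrable arc_measure (\<lambda>\<theta>. sin \<theta> ^ 4 * ln (g (cis \<theta>)))"
      by (rule intlg)
    moreover have "integrable arc_measure (\<lambda>\<theta>. 2 * \<bar>f (cis \<theta>) - g (cis \<theta>)\<bar>)"
      using intfg by simp
    moreover have "(\<integral>z. \<bar>f z - g z\<bar> \<partial>circle_measure) = (\<integral>\<theta>. \<bar>f (cis \<theta>) - g (cis \<theta>)\<bar> \<partial>arc_measure)"
      unfolding circle_measure_def using f(1) gm by (intro integral_distr[OF cA]) measurable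
    ultimately show ?thesis by (simp add: Bochner_Integration.integral_add)
  qed
  also have "\<dots> \<le> ((\<integral>z. Im z ^ 4 * g z \<partial>\<mu>) + C) + 2 * (2 * e)"
    using L1[OF _ circle_meas_circle_measure \<Lambda>1] g_half
    by (intro add_mono mult_left_mono entropy_dual_bound_polynomial[OF \<mu> a g(1) C]) (auto intro: less_le_trans[of 0 "1/2"])
  also have "(\<integral>z. Im z ^ 4 * g z \<partial>\<mu>) \<le> (\<integral>z. Im z ^ 4 * f z \<partial>\<mu>) + 2 * e"
  proof -
    have i: "integrable \<mu> (\<lambda>z. Im z ^ 4 * f z)"
    proof (rule Bochner_Integration.integrable_bound[OF intf[OF M.circle_meas_axioms]])
      show "(\<lambda>z. Im z ^ 4 * f z) \<in> borel_measurable \<mu>"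
        using f(1) by (intro M.borel_measurable_M) measurable
      show "AE z in \<mu>. norm (Im z ^ 4 * f z) \<le> norm (f z)"
        using M.AE_circle
      proof eventually_elim
        case (elim z)
        then show ?case using Im_power4_le_1[OF elim] by (simp add: abs_mult mult_left_le_one_le)
      qed
    qed
    have i': "integrable \<mu> (\<lambda>z. Im z ^ 4 * f z + \<bar>f z - g z\<bar>)"
      using i intabs[OF M.circle_meas_axioms] by (rule Bochner_Integration.integrable_add)
    have "(\<integral>z. Im z ^ 4 * g z \<partial>\<mu>) \<le> (\<integral>z. Im z ^ 4 * f z + \<bar>f z - g z\<bar> \<partial>\<mu>)"
    proof (rule integral_mono_AE[OF _ i'])
      show "integrable \<mu> (\<lambda>z. Im z ^ 4 * g z)"
        by (intro M.integrable_cont continuous_intros gc)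
      show "AE z in \<mu>. Im z ^ 4 * g z \<le> Im z ^ 4 * f z + \<bar>f z - g z\<bar>"
        using M.AE_circle
      proof eventually_elim
        case (elim z)
        have "Im z ^ 4 * (g z - f z) \<le> Im z ^ 4 * \<bar>f z - g z\<bar>" by (intro mult_left_mono) auto
        also have "\<dots> \<le> 1 * \<bar>f z - g z\<bar>" by (intro mult_right_mono Im_power4_le_1 elim) auto
        finally show ?case by (simp add: algebra_simps)
      qed
    qed
    also have "\<dots> = (\<integral>z. Im z ^ 4 * f z \<partial>\<mu>) + (\<integral>z. \<bar>f z - g z\<bar> \<partial>\<mu>)"
      by (rule Bochner_Integration.integral_add[OF i intabs[OF M.circle_meas_axioms]])
    finally show ?thesis using L1[OF _ M.circle_meas_axioms M1] by simp
  qed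
  finally show "(\<integral>\<theta>. sin \<theta> ^ 4 * ln (f (cis \<theta>)) \<partial>arc_measure) \<le> (\<integral>z. Im z ^ 4 * f z \<partial>\<mu>) + C + \<epsilon>"
    using e(3) by linarith
qed

section \<open>The Lebesgue decomposition and the extended entropy integral\<close>

lemma lebesgue_decomposition_nn_integral_le:
  assumes d: "lebesgue_decomposition \<mu> w \<mu>s" and s: "sets \<mu> = sets borel"
    and f: "f \<in> borel_measurable borel"
  shows "(\<integral>\<^sup>+\<theta>. ennreal (w \<theta>) * f (cis \<theta>) \<partial>arc_measure) \<le> (\<integral>\<^sup>+z. f z \<partial>\<mu>)"
proof -
  let ?\<nu> = "distr (density arc_measure (\<lambda>\<theta>. ennreal (w \<theta>))) borel cis"
  have w: "w \<in> borel_measurable borel" using d by (simp add: lebesgue_decomposition_def)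
  have "?\<nu> \<le> \<mu>"
    using d s by (subst le_measure) (auto simp: lebesgue_decomposition_def)
  then have "(\<integral>\<^sup>+z. f z \<partial>?\<nu>) \<le> (\<integral>\<^sup>+z. f z \<partial>\<mu>)"
    using s by (intro nn_integral_mono_measure) auto
  moreover have "(\<integral>\<^sup>+z. f z \<partial>?\<nu>) = (\<integral>\<^sup>+\<theta>. ennreal (w \<theta>) * f (cis \<theta>) \<partial>arc_measure)"
    using f w cis_measurable_borel measurable_compose[OF cis_measurable_borel f]
    by (simp add: nn_integral_distr nn_integral_density)
  ultimately show ?thesis by simp
qed

text \<open>Off a set N that carries the singular part, mu coincides with its absolutely continuous
  part; the restriction of both is expressed by the density \<open>indicator (- N)\<close>.\<close>

lemma lebesgue_decomposition_nn_integral_off: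
  assumes d: "lebesgue_decomposition \<mu> w \<mu>s" and s: "sets \<mu> = sets borel"
    and N: "N \<in> sets borel" "emeasure \<mu>s (- N) = 0"
    and f: "f \<in> borel_measurable borel"
  shows "(\<integral>\<^sup>+z. indicator (- N) z * f z \<partial>\<mu>) = (\<integral>\<^sup>+\<theta>. ennreal (w \<theta>) * (indicator (- N) (cis \<theta>) * f (cis \<theta>)) \<partial>arc_measure)"
proof -
  let ?\<nu> = "distr (density arc_measure (\<lambda>\<theta>. ennreal (w \<theta>))) borel cis"
  have w: "w \<in> borel_measurable borel" and ss: "sets \<mu>s = sets borel"
    and dec: "\<And>A. A \<in> sets borel \<Longrightarrow> emeasure \<mu> A = emeasure ?\<nu> A + emeasure \<mu>s A"
    using d by (auto simp: lebesgue_decomposition_def)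
  have im: "(indicator (- N) :: complex \<Rightarrow> ennreal) \<in> borel_measurable borel"
    using N(1) by (intro borel_measurable_indicator) auto
  have im\<mu>: "(indicator (- N) :: complex \<Rightarrow> ennreal) \<in> borel_measurable \<mu>"
    using N(1) s by (intro borel_measurable_indicator) auto
  have "density \<mu> (indicator (- N)) = density ?\<nu> (indicator (- N))"
  proof (rule measure_eqI)
    show "sets (density \<mu> (indicator (- N))) = sets (density ?\<nu> (indicator (- N)))" using s by simp
    fix A assume "A \<in> sets (density \<mu> (indicator (- N)))"
    then have A: "A \<in> sets borel" using s by simp
    have AN: "- N \<inter> A \<in> sets borel" using A N(1) by auto
    have "emeasure \<mu>s (- N \<inter> A) \<le> emeasure \<mu>s (- N)"
      using N(1) ss by (intro emeasure_mono) auto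
    then have 0: "emeasure \<mu>s (- N \<inter> A) = 0" using N(2) by simp
    have "emeasure (density \<mu> (indicator (- N))) A = emeasure \<mu> (- N \<inter> A)"
      using A AN im\<mu> s by (simp add: emeasure_density indicator_inter_arith[symmetric])
    also have "\<dots> = emeasure ?\<nu> (- N \<inter> A)" using dec[OF AN] 0 by simp
    also have "\<dots> = emeasure (density ?\<nu> (indicator (- N))) A"
      using A AN im by (subst emeasure_density) (simp_all add: indicator_inter_arith[symmetric])
    finally show "emeasure (density \<mu> (indicator (- N))) A = emeasure (density ?\<nu> (indicator (- N))) A" .
  qed
  then have "(\<integral>\<^sup>+z. f z \<partial>density \<mu> (indicator (- N))) = (\<integral>\<^sup>+z. f z \<partial>density ?\<nu> (indicator (- N)))" by simp
  moreover have "(\<integral>\<^sup>+z. f z \<partial>density \<mu> (indicator (- N))) = (\<integral>\<^sup>+z. indicator (- N) z * f z \<partial>\<mu>)"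
    using f im\<mu> measurable_cong_sets[OF s refl] by (intro nn_integral_density) auto
  moreover have "(\<integral>\<^sup>+z. f z \<partial>density ?\<nu> (indicator (- N))) = (\<integral>\<^sup>+z. indicator (- N) z * f z \<partial>?\<nu>)"
    using f im by (intro nn_integral_density) auto
  moreover have "(\<integral>\<^sup>+z. indicator (- N) z * f z \<partial>?\<nu>) = (\<integral>\<^sup>+\<theta>. ennreal (w \<theta>) * (indicator (- N) (cis \<theta>) * f (cis \<theta>)) \<partial>arc_measure)"
  proof -
    have m: "(\<lambda>z. indicator (- N) z * f z) \<in> borel_measurable borel" using f im by measurable
    show ?thesis
      using m w cis_measurable_borel measurable_compose[OF cis_measurable_borel m]
      by (simp add: nn_integral_distr nn_integral_density)
  qed
  ultimately show ?thesis by simp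
qed

lemma Arg2pi_measurable: "Arg2pi \<in> borel_measurable borel"
  unfolding borel_measurable_iff_greater using open_Arg2pi2pi_gt by auto

lemma Arg2pi_cis: "0 \<le> \<theta> \<Longrightarrow> \<theta> < 2 * pi \<Longrightarrow> Arg2pi (cis \<theta>) = \<theta>"
  by (rule Arg2pi_unique[of 1]) (auto simp: cis_conv_exp)

text \<open>Excludes the angle 2 pi, because \<open>Arg2pi\<close> inverts \<open>cis\<close> on the
  half-open interval only.\<close>

lemma AE_arc_measure_lt: "AE \<theta> in arc_measure. 0 \<le> \<theta> \<and> \<theta> < 2 * pi"
proof -
  have "AE \<theta> in arc_measure. \<theta> \<noteq> 2 * pi"
    unfolding arc_measure_density
    using AE_lborel_singleton[of "2 * pi"] by (subst AE_density) auto
  with AE_arc_measure show ?thesis by eventually_elim auto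
qed

text \<open>The negative part of the integrand, since \<open>e2ennreal\<close> sends negative values
  to 0. In \<open>ereal\<close> the product of 0 and minus infinity is 0, so a zero of w at a zero
  of sin contributes nothing.\<close>

definition neg_log_part :: "(real \<Rightarrow> real) \<Rightarrow> real \<Rightarrow> ennreal" where
  "neg_log_part w \<theta> = e2ennreal (- (ereal (sin \<theta> ^ 4) * log_ext (w \<theta>)))"

lemma neg_log_part_pos: "0 < w \<theta> \<Longrightarrow> neg_log_part w \<theta> = ennreal (- (sin \<theta> ^ 4 * ln (w \<theta>)))"
  by (simp add: neg_log_part_def log_ext_def)

lemma neg_log_part_nonpos: "w \<theta> \<le> 0 \<Longrightarrow> neg_log_part w \<theta> = (if sin \<theta> = 0 then 0 else \<top>)"
  by (auto simp: neg_log_part_def log_ext_def e2ennreal_neg)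

text \<open>The inequality sin^4 ln w <= w bounds the integral of the positive part by the mass of
  mu, so only the negative part can produce the value minus infinity. The weight is sin^4 because (1
  - cos) (1 + cos) = sin^2.\<close>

lemma integral_ext_gt_iff:
  assumes d: "lebesgue_decomposition \<mu> w \<mu>s" and \<mu>: "prob_space \<mu>" "sets \<mu> = sets borel"
  shows "integral_ext arc_measure (\<lambda>\<theta>. ereal ((1 - cos \<theta>)^2 * (1 + cos \<theta>)^2) * log_ext (w \<theta>)) > - \<infinity>
    \<longleftrightarrow> (\<integral>\<^sup>+\<theta>. neg_log_part w \<theta> \<partial>arc_measure) < \<infinity>"
proof -
  interpret prob_space \<mu> by fact
  have s: "(1 - cos \<theta>)^2 * (1 + cos \<theta>)^2 = sin \<theta> ^ 4" for \<theta> :: real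
  proof -
    have "(1 - cos \<theta>)^2 * (1 + cos \<theta>)^2 = (1 - (cos \<theta>)\<^sup>2)\<^sup>2"
      by (simp add: power2_eq_square algebra_simps)
    also have "1 - (cos \<theta>)\<^sup>2 = (sin \<theta>)\<^sup>2" by (simp add: sin_squared_eq)
    finally show ?thesis by simp
  qed
  have le: "e2ennreal (ereal (sin \<theta> ^ 4) * log_ext (w \<theta>)) \<le> ennreal (w \<theta>) * 1" for \<theta>
  proof (cases "0 < w \<theta>")
    case True
    have "sin \<theta> ^ 4 * ln (w \<theta>) \<le> sin \<theta> ^ 4 * w \<theta>"
      using ln_le_minus_one[OF True] by (intro mult_left_mono) auto
    also have "\<dots> \<le> 1 * w \<theta>" using True by (intro mult_right_mono sin_power4_le_1) auto
    finally show ?thesis using True by (simp add: log_ext_def ennreal_leI)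
  next
    case False
    then have "ereal (sin \<theta> ^ 4) * log_ext (w \<theta>) \<le> 0"
      by (cases "sin \<theta> = 0") (auto simp: log_ext_def)
    then show ?thesis by (simp add: e2ennreal_neg)
  qed
  have "(\<integral>\<^sup>+\<theta>. e2ennreal (ereal (sin \<theta> ^ 4) * log_ext (w \<theta>)) \<partial>arc_measure) \<le> (\<integral>\<^sup>+\<theta>. ennreal (w \<theta>) * 1 \<partial>arc_measure)"
    by (rule nn_integral_mono) (rule le)
  also have "\<dots> \<le> (\<integral>\<^sup>+z. 1 \<partial>\<mu>)"
    by (rule lebesgue_decomposition_nn_integral_le[OF d \<mu>(2)]) auto
  also have "\<dots> = 1" using emeasure_space_1 by simp
  finally have P: "(\<integral>\<^sup>+\<theta>. e2ennreal (ereal (sin \<theta> ^ 4) * log_ext (w \<theta>)) \<partial>arc_measure) \<le> 1" .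
  have "- \<infinity> < enn2ereal x - enn2ereal y \<longleftrightarrow> y < \<infinity>" if "x \<le> 1" for x y :: ennreal
  proof -
    have "x < top" using that by (auto intro: le_less_trans)
    then show ?thesis
      by (cases x; cases y) (auto simp: enn2ereal_ennreal less_top)
  qed
  from this[OF P] show ?thesis
    unfolding integral_ext_def neg_log_part_def s by simp
qed

text \<open>The loss in ln x <= x at x = w / w_n is at most 1: on the circle 1 / w_n = |Phi_n|^2 /
  N, so the integral of w / w_n is at most that of |Phi_n|^2 / N over mu, and N is the squared norm
  of Phi_n there.\<close>

lemma sin4_entropy_bdd_below:
  assumes \<mu>: "nontrivial_circle_prob \<mu>" and d: "lebesgue_decomposition \<mu> w \<mu>s" and a: "a = verblunsky \<mu>"
    and fin: "(\<integral>\<^sup>+\<theta>. neg_log_part w \<theta> \<partial>arc_measure) < \<infinity>"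
  shows "bdd_below (range (disc_seq.sin4_entropy a))"
proof -
  interpret disc_seq a using verblunsky_Phi[OF \<mu>] by unfold_locales (simp add: a)
  interpret M: circle_meas \<mu> by (rule nontrivial_circle_meas) fact
  have w: "w \<in> borel_measurable borel" and w0: "\<And>\<theta>. \<theta> \<in> {0..2 * pi} \<Longrightarrow> 0 \<le> w \<theta>"
    using d by (auto simp: lebesgue_decomposition_def)
  have "(\<lambda>\<theta>. log_ext (w \<theta>)) \<in> borel_measurable borel"
    unfolding log_ext_def using w by measurable
  then have vm: "neg_log_part w \<in> borel_measurable arc_measure"
    unfolding neg_log_part_def[abs_def] by measurable
  \<comment> \<open>\<open>enn2real\<close> sends infinity to 0, which by the finiteness assumption
    happens on a null set only.\<close>
  define L where "L \<theta> = enn2real (neg_log_part w \<theta>)" for \<theta>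
  have AEfin: "AE \<theta> in arc_measure. neg_log_part w \<theta> \<noteq> \<infinity>"
    by (rule nn_integral_noteq_infinite[OF vm]) (use fin in auto)
  have Lint: "integrable arc_measure L"
  proof (rule integrableI_nonneg)
    show "L \<in> borel_measurable arc_measure" unfolding L_def using vm by measurable
    have "(\<integral>\<^sup>+\<theta>. ennreal (L \<theta>) \<partial>arc_measure) = (\<integral>\<^sup>+\<theta>. neg_log_part w \<theta> \<partial>arc_measure)"
    proof (rule nn_integral_cong_AE)
      show "AE \<theta> in arc_measure. ennreal (L \<theta>) = neg_log_part w \<theta>"
        using AEfin by eventually_elim (simp add: L_def less_top)
    qed
    then show "(\<integral>\<^sup>+\<theta>. ennreal (L \<theta>) \<partial>arc_measure) < \<infinity>" using fin by simp
  qed (simp add: L_def)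
  have "- sin4_entropy n \<le> 1 + (\<integral>\<theta>. L \<theta> \<partial>arc_measure)" for n
  proof -
    define N where "N = (\<Prod>j<n. 1 - (cmod (a j))\<^sup>2)"
    have N: "N > 0" unfolding N_def using one_minus_pos by (intro prod_pos) auto
    have wd: "w \<theta> / bs_density n \<theta> = w \<theta> * ((cmod (poly (Phi a n) (cis \<theta>)))\<^sup>2 / N)" for \<theta>
      by (simp add: bs_density_def N_def norm_Phis_circle)
    have tot: "measure \<mu> UNIV = 1"
      using \<mu> prob_space.prob_space[of \<mu>] by (simp add: nontrivial_circle_prob_def)
    have orth: "M.orth k (Phi a k)" for k unfolding a by (rule verblunsky_Phi(1)[OF \<mu>])
    have sq: "M.sqnorm (Phi a n) = N" using M.sqnorm_Phi[of n a] orth tot by (simp add: N_def)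
    have nn: "(\<integral>\<^sup>+\<theta>. ennreal (w \<theta> / bs_density n \<theta>) \<partial>arc_measure) \<le> ennreal 1"
    proof -
      have i: "integrable \<mu> (\<lambda>z. (cmod (poly (Phi a n) z))\<^sup>2 / N)"
        using N by (intro M.integrable_cont continuous_intros) auto
      have "(\<integral>\<^sup>+\<theta>. ennreal (w \<theta> / bs_density n \<theta>) \<partial>arc_measure)
         = (\<integral>\<^sup>+\<theta>. ennreal (w \<theta>) * ennreal ((cmod (poly (Phi a n) (cis \<theta>)))\<^sup>2 / N) \<partial>arc_measure)"
        unfolding wd using N by (intro nn_integral_cong ennreal_mult'') auto
      also have "\<dots> \<le> (\<integral>\<^sup>+z. ennreal ((cmod (poly (Phi a n) z))\<^sup>2 / N) \<partial>\<mu>)"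
      proof (rule lebesgue_decomposition_nn_integral_le[OF d M.sets_M])
        have "(\<lambda>z. (cmod (poly (Phi a n) z))\<^sup>2 / N) \<in> borel_measurable borel"
          using N by (intro borel_measurable_continuous_onI continuous_intros) auto
        then show "(\<lambda>z. ennreal ((cmod (poly (Phi a n) z))\<^sup>2 / N)) \<in> borel_measurable borel" by measurable
      qed
      also have "\<dots> = ennreal (\<integral>z. (cmod (poly (Phi a n) z))\<^sup>2 / N \<partial>\<mu>)"
        using i N by (intro nn_integral_eq_integral) auto
      also have "(\<integral>z. (cmod (poly (Phi a n) z))\<^sup>2 / N \<partial>\<mu>) = M.sqnorm (Phi a n) / N"
        by (simp add: M.sqnorm_def)
      finally show ?thesis using sq N by simp
    qed
    have AE0: "AE \<theta> in arc_measure. 0 \<le> w \<theta> / bs_density n \<theta>"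
      using AE_arc_measure by eventually_elim (use w0 bs_density_pos in \<open>auto intro!: divide_nonneg_pos\<close>)
    have wdm: "(\<lambda>\<theta>. w \<theta> / bs_density n \<theta>) \<in> borel_measurable arc_measure"
      using w bs_density_measurable by measurable
    have wdi: "integrable arc_measure (\<lambda>\<theta>. w \<theta> / bs_density n \<theta>)"
      using nn AE0 wdm by (intro integrableI_nonneg) (auto intro: le_less_trans)
    have "ennreal (\<integral>\<theta>. w \<theta> / bs_density n \<theta> \<partial>arc_measure) \<le> ennreal 1"
      using nn nn_integral_eq_integral[OF wdi AE0] by simp
    then have wd1: "(\<integral>\<theta>. w \<theta> / bs_density n \<theta> \<partial>arc_measure) \<le> 1" by (simp add: ennreal_le_iff)
    have i1: "integrable arc_measure (\<lambda>\<theta>. - (sin \<theta> ^ 4 * ln (bs_density n \<theta>)))"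
      using bs_density_pos[of n] by (intro integrable_arc continuous_intros continuous_bs_density) (auto simp: less_le)
    have "- sin4_entropy n = (\<integral>\<theta>. - (sin \<theta> ^ 4 * ln (bs_density n \<theta>)) \<partial>arc_measure)"
      by (simp add: sin4_entropy_def)
    also have "\<dots> \<le> (\<integral>\<theta>. w \<theta> / bs_density n \<theta> + L \<theta> \<partial>arc_measure)"
    proof (rule integral_mono_AE[OF i1 Bochner_Integration.integrable_add[OF wdi Lint]])
      show "AE \<theta> in arc_measure. - (sin \<theta> ^ 4 * ln (bs_density n \<theta>)) \<le> w \<theta> / bs_density n \<theta> + L \<theta>"
        using AEfin AE0
      proof eventually_elim
        case (elim \<theta>)
        show ?case
        proof (cases "0 < w \<theta>")
          case True
          have D: "0 < bs_density n \<theta>" by (rule bs_density_pos)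
          have "ln (w \<theta>) - ln (bs_density n \<theta>) = ln (w \<theta> / bs_density n \<theta>)"
            using True D by (simp add: ln_div)
          also have "\<dots> \<le> w \<theta> / bs_density n \<theta>"
            using ln_le_minus_one[of "w \<theta> / bs_density n \<theta>"] True D by simp
          finally have "sin \<theta> ^ 4 * (ln (w \<theta>) - ln (bs_density n \<theta>)) \<le> sin \<theta> ^ 4 * (w \<theta> / bs_density n \<theta>)"
            by (intro mult_left_mono) auto
          also have "\<dots> \<le> 1 * (w \<theta> / bs_density n \<theta>)"
            using elim(2) by (intro mult_right_mono sin_power4_le_1)
          finally have "sin \<theta> ^ 4 * ln (w \<theta>) - sin \<theta> ^ 4 * ln (bs_density n \<theta>) \<le> w \<theta> / bs_density n \<theta>"
            by (simp add: algebra_simps)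
          moreover have "- (sin \<theta> ^ 4 * ln (w \<theta>)) \<le> L \<theta>"
            unfolding L_def neg_log_part_pos[of w, OF True]
            by (cases "0 \<le> - (sin \<theta> ^ 4 * ln (w \<theta>))") (simp_all add: ennreal_neg)
          ultimately show ?thesis by linarith
        next
          case False
          \<comment> \<open>Where w is not positive, finiteness of the negative part forces the
            weight to vanish.\<close>
          then have "sin \<theta> = 0" using elim(1) neg_log_part_nonpos[of w \<theta>] by (auto split: if_splits)
          then show ?thesis using elim(2) by (simp add: L_def)
        qed
      qed
    qed
    also have "\<dots> = (\<integral>\<theta>. w \<theta> / bs_density n \<theta> \<partial>arc_measure) + (\<integral>\<theta>. L \<theta> \<partial>arc_measure)"
      by (rule Bochner_Integration.integral_add[OF wdi Lint])
    finally show ?thesis using wd1 by linarith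
  qed
  then have "- (1 + (\<integral>\<theta>. L \<theta> \<partial>arc_measure)) \<le> sin4_entropy n" for n
    by (simp only: minus_le_iff)
  then show ?thesis by (intro bdd_belowI) auto
qed

text \<open>The test function of the dual bound: \<open>1 / y\<close> truncated to \<open>[1, K]\<close>, with value \<open>K\<close> at \<open>y = 0\<close>.\<close>

definition trunc_inv :: "real \<Rightarrow> real \<Rightarrow> real" where
  "trunc_inv K y = max 1 (1 / max y (1 / K))"

lemma trunc_inv_bounds:
  assumes "K \<ge> 1" shows "1 \<le> trunc_inv K y \<and> trunc_inv K y \<le> K"
proof -
  have "1 / max y (1 / K) \<le> 1 / (1 / K)"
    using assms by (intro divide_left_mono) (auto simp: less_max_iff_disj)
  then show ?thesis using assms by (simp add: trunc_inv_def)
qed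

text \<open>For y > 0 the truncation is at most max 1 (1 / y), and y times that is max y 1. The
  bound is independent of K.\<close>

lemma mult_trunc_inv_le: "0 \<le> y \<Longrightarrow> 1 \<le> K \<Longrightarrow> y * trunc_inv K y \<le> y + 1"
  by (auto simp: trunc_inv_def max_def field_simps)

lemma trunc_inv_mono:
  assumes "1 \<le> K" "K \<le> K'" shows "trunc_inv K y \<le> trunc_inv K' y"
proof -
  have "1 / K' \<le> 1 / K" using assms by (intro divide_left_mono) auto
  then have "max y (1 / K') \<le> max y (1 / K)" by auto
  moreover have "0 < max y (1 / K')" using assms by (simp add: less_max_iff_disj)
  ultimately have "1 / max y (1 / K) \<le> 1 / max y (1 / K')" by (intro divide_left_mono) auto
  then show ?thesis unfolding trunc_inv_def by auto
qed

lemma trunc_inv_measurable: "trunc_inv K \<in> borel_measurable borel"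
  unfolding trunc_inv_def[abs_def] by measurable

text \<open>The bound is uniform in K. With the test function equal to 1 on a carrier N of the
  singular part, its integral over mu is at most mu (N) plus the integral of w + 1, hence at most 1
  + 1 + 1. As N is null for arc length, the left hand side does not see the change.\<close>

lemma truncated_neg_log_bound:
  assumes \<mu>: "nontrivial_circle_prob \<mu>" and d: "lebesgue_decomposition \<mu> w \<mu>s" and a: "a = verblunsky \<mu>"
    and C: "\<And>n. - C \<le> disc_seq.sin4_entropy a n" and K: "1 \<le> K"
  shows "(\<integral>\<^sup>+\<theta>. ennreal (sin \<theta> ^ 4 * ln (trunc_inv K (w \<theta>))) \<partial>arc_measure) \<le> ennreal (3 + C)"
proof -
  interpret M: circle_meas \<mu> by (rule nontrivial_circle_meas) fact
  interpret arc: prob_space arc_measure by (rule prob_space_arc_measure)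
  have w: "w \<in> borel_measurable borel" and w0: "\<And>\<theta>. \<theta> \<in> {0..2 * pi} \<Longrightarrow> 0 \<le> w \<theta>"
    using d by (auto simp: lebesgue_decomposition_def)
  obtain N where N: "N \<in> sets borel" "emeasure circle_measure N = 0" "emeasure \<mu>s (- N) = 0"
    using d by (auto simp: lebesgue_decomposition_def)
  have M1: "emeasure \<mu> UNIV = 1"
    using \<mu> prob_space.emeasure_space_1[of \<mu>] by (simp add: nontrivial_circle_prob_def)
  define h where "h z = trunc_inv K (w (Arg2pi z))" for z
  have hm: "h \<in> borel_measurable borel"
    unfolding h_def[abs_def]
    using measurable_compose[OF measurable_compose[OF Arg2pi_measurable w] trunc_inv_measurable] by simp
  define f where "f z = (if z \<in> N then 1 else h z)" for z
  have fm: "f \<in> borel_measurable borel"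
    unfolding f_def[abs_def] using N(1) hm by measurable
  have f: "1 \<le> f z" "f z \<le> K" for z
    using trunc_inv_bounds[OF K] K by (auto simp: f_def h_def)
  have cA: "cis \<in> measurable arc_measure borel" using cis_measurable_borel by simp
  have AEh: "AE \<theta> in arc_measure. h (cis \<theta>) = trunc_inv K (w \<theta>)"
    using AE_arc_measure_lt by eventually_elim (simp add: h_def Arg2pi_cis)
  have "AE z in circle_measure. z \<notin> N"
    by (rule AE_I[of _ _ N]) (use N in \<open>auto simp: circle_measure_def\<close>)
  then have "AE \<theta> in arc_measure. cis \<theta> \<notin> N"
    unfolding circle_measure_def using N(1) cA by (subst (asm) AE_distr_iff) auto
  with AEh have AEf: "AE \<theta> in arc_measure. f (cis \<theta>) = trunc_inv K (w \<theta>)"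
    by eventually_elim (simp add: f_def)
  have w1: "(\<integral>\<^sup>+\<theta>. ennreal (w \<theta>) \<partial>arc_measure) \<le> 1"
    using lebesgue_decomposition_nn_integral_le[OF d M.sets_M, of "\<lambda>z. 1"] M1 by simp
  have "(\<integral>\<^sup>+z. ennreal (f z) \<partial>\<mu>) = (\<integral>\<^sup>+z. indicator N z + indicator (- N) z * ennreal (h z) \<partial>\<mu>)"
    by (intro nn_integral_cong) (auto simp: f_def split: split_indicator)
  also have "\<dots> = emeasure \<mu> N + (\<integral>\<^sup>+z. indicator (- N) z * ennreal (h z) \<partial>\<mu>)"
  proof (subst nn_integral_add)
    show "(\<lambda>z. indicator (- N) z * ennreal (h z)) \<in> borel_measurable \<mu>"
      using N(1) hm by (intro M.borel_measurable_M borel_measurable_times_ennreal borel_measurable_indicator) auto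
  qed (use N(1) M.sets_M in auto)
  also have "(\<integral>\<^sup>+z. indicator (- N) z * ennreal (h z) \<partial>\<mu>)
      = (\<integral>\<^sup>+\<theta>. ennreal (w \<theta>) * (indicator (- N) (cis \<theta>) * ennreal (h (cis \<theta>))) \<partial>arc_measure)"
    by (rule lebesgue_decomposition_nn_integral_off[OF d M.sets_M N(1,3)]) (use hm in measurable)
  also have "\<dots> \<le> (\<integral>\<^sup>+\<theta>. ennreal (w \<theta>) + 1 \<partial>arc_measure)"
  proof (rule nn_integral_mono_AE)
    show "AE \<theta> in arc_measure. ennreal (w \<theta>) * (indicator (- N) (cis \<theta>) * ennreal (h (cis \<theta>))) \<le> ennreal (w \<theta>) + 1"
      using AEh AE_arc_measure
    proof eventually_elim
      case (elim \<theta>)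
      have "ennreal (w \<theta>) * (indicator (- N) (cis \<theta>) * ennreal (h (cis \<theta>))) \<le> ennreal (w \<theta>) * (1 * ennreal (h (cis \<theta>)))"
        by (intro mult_left_mono mult_right_mono) (auto split: split_indicator)
      also have "\<dots> = ennreal (w \<theta> * trunc_inv K (w \<theta>))"
        using w0[OF elim(2)] elim(1) by (simp add: ennreal_mult')
      also have "\<dots> \<le> ennreal (w \<theta> + 1)"
        using mult_trunc_inv_le[OF w0[OF elim(2)] K] by (rule ennreal_leI)
      also have "\<dots> = ennreal (w \<theta>) + 1" using w0[OF elim(2)] by (simp add: ennreal_plus)
      finally show ?case .
    qed
  qed
  also have "\<dots> = (\<integral>\<^sup>+\<theta>. ennreal (w \<theta>) \<partial>arc_measure) + 1"
    using w arc.emeasure_space_1 by (subst nn_integral_add) auto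
  also have "\<dots> \<le> 1 + 1" using w1 by (intro add_mono) auto
  also have "emeasure \<mu> N + (1 + 1) \<le> 1 + (1 + 1)"
    using emeasure_mono[of N UNIV \<mu>] M.sets_M M1 by (intro add_mono) auto
  finally have f3: "(\<integral>\<^sup>+z. ennreal (f z) \<partial>\<mu>) \<le> ennreal 3"
    by (simp add: add_left_mono)
  have fi: "integrable \<mu> f"
  proof (rule M.integrable_bounded[OF fm])
    show "\<bar>f z\<bar> \<le> K" for z using f[of z] by auto
  qed
  have f0: "0 \<le> f z" for z using f(1)[of z] by simp
  have "(\<integral>\<^sup>+z. ennreal (f z) \<partial>\<mu>) = ennreal (\<integral>z. f z \<partial>\<mu>)"
    using f0 by (intro nn_integral_eq_integral[OF fi]) auto
  then have fI: "(\<integral>z. f z \<partial>\<mu>) \<le> 3"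
    using f3 ennreal_le_iff[of 3] by (simp only: zero_le_numeral)
  have "(\<integral>z. Im z ^ 4 * f z \<partial>\<mu>) \<le> (\<integral>z. f z \<partial>\<mu>)"
  proof (rule integral_mono_AE[OF _ fi])
    have le: "AE z in \<mu>. Im z ^ 4 * f z \<le> f z"
      using M.AE_circle
    proof eventually_elim
      case (elim z)
      then show ?case using Im_power4_le_1[OF elim] f0[of z] by (simp add: mult_left_le_one_le)
    qed
    then show "AE z in \<mu>. Im z ^ 4 * f z \<le> f z" .
    show "integrable \<mu> (\<lambda>z. Im z ^ 4 * f z)"
    proof (rule Bochner_Integration.integrable_bound[OF fi])
      show "(\<lambda>z. Im z ^ 4 * f z) \<in> borel_measurable \<mu>" using fm by (intro M.borel_measurable_M) measurable
      show "AE z in \<mu>. norm (Im z ^ 4 * f z) \<le> norm (f z)"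
        using le by eventually_elim (use f0 in \<open>simp add: abs_mult\<close>)
    qed
  qed
  with entropy_dual_bound[OF \<mu> a C fm f] fI
  have bound: "(\<integral>\<theta>. sin \<theta> ^ 4 * ln (f (cis \<theta>)) \<partial>arc_measure) \<le> 3 + C" by linarith
  have "(\<integral>\<^sup>+\<theta>. ennreal (sin \<theta> ^ 4 * ln (trunc_inv K (w \<theta>))) \<partial>arc_measure)
     = (\<integral>\<^sup>+\<theta>. ennreal (sin \<theta> ^ 4 * ln (f (cis \<theta>))) \<partial>arc_measure)"
    by (rule nn_integral_cong_AE) (use AEf in eventually_elim, simp)
  also have "\<dots> = ennreal (\<integral>\<theta>. sin \<theta> ^ 4 * ln (f (cis \<theta>)) \<partial>arc_measure)"
  proof (rule nn_integral_eq_integral)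
    have "(\<lambda>\<theta>. sin \<theta> ^ 4 * ln (f (cis \<theta>))) \<in> borel_measurable arc_measure"
      using measurable_compose[OF cA fm] by simp
    moreover have "\<bar>sin \<theta> ^ 4 * ln (f (cis \<theta>))\<bar> \<le> ln K" for \<theta>
    proof -
      have "sin \<theta> ^ 4 * ln (f (cis \<theta>)) \<le> 1 * ln K"
        using f[of "cis \<theta>"] by (intro mult_mono sin_power4_le_1) auto
      then show ?thesis using f(1)[of "cis \<theta>"] by (simp add: abs_mult)
    qed
    ultimately show "integrable arc_measure (\<lambda>\<theta>. sin \<theta> ^ 4 * ln (f (cis \<theta>)))"
      by (intro arc.integrable_const_bound[of _ "ln K"]) auto
    show "AE \<theta> in arc_measure. 0 \<le> sin \<theta> ^ 4 * ln (f (cis \<theta>))" using f(1) by auto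
  qed
  also have "\<dots> \<le> ennreal (3 + C)" using bound by (rule ennreal_leI)
  finally show ?thesis .
qed

text \<open>As K grows, \<open>trunc_inv K\<close> increases to max 1 (1 / w), whose logarithm is
  the negative part of ln w. At w = 0 it equals K, and the supremum is infinite wherever the weight
  is not 0. The values \<open>Suc m\<close> keep K at least 1.\<close>

lemma neg_log_part_le_SUP:
  "neg_log_part w \<theta> \<le> (SUP m. ennreal (sin \<theta> ^ 4 * ln (trunc_inv (real (Suc m)) (w \<theta>))))"
proof (cases "0 < w \<theta>")
  case True
  obtain m where m: "inverse (real (Suc m)) < w \<theta>" using reals_Archimedean[OF True] by blast
  have "- ln (w \<theta>) \<le> ln (trunc_inv (real (Suc m)) (w \<theta>))"
  proof -
    have "1 / w \<theta> \<le> trunc_inv (real (Suc m)) (w \<theta>)"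
      using m by (simp add: trunc_inv_def max_def inverse_eq_divide)
    then have "ln (1 / w \<theta>) \<le> ln (trunc_inv (real (Suc m)) (w \<theta>))"
      using True by (subst ln_le_cancel_iff) (auto simp: trunc_inv_def less_max_iff_disj)
    then show ?thesis using True by (simp add: ln_div)
  qed
  then have "sin \<theta> ^ 4 * - ln (w \<theta>) \<le> sin \<theta> ^ 4 * ln (trunc_inv (real (Suc m)) (w \<theta>))"
    by (intro mult_left_mono) auto
  then show ?thesis
    unfolding neg_log_part_pos[of w, OF True] by (intro SUP_upper2[of m] ennreal_leI) auto
next
  case False
  show ?thesis
  proof (cases "sin \<theta> = 0")
    case True then show ?thesis using False neg_log_part_nonpos[of w \<theta>] by simp
  next
    case s: False
    have "(SUP m. ennreal (sin \<theta> ^ 4 * ln (trunc_inv (real (Suc m)) (w \<theta>)))) = \<top>"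
    proof (rule ennreal_SUP_eq_top)
      fix n :: nat
      obtain m where m: "exp (real n / sin \<theta> ^ 4) < real m" using reals_Archimedean2 by blast
      have p: "0 < sin \<theta> ^ 4" using s by simp
      have t: "trunc_inv (real (Suc m)) (w \<theta>) = real (Suc m)"
      proof -
        have "0 < 1 / real (Suc m)" by simp
        then have "max (w \<theta>) (1 / real (Suc m)) = 1 / real (Suc m)" using False by (intro max_absorb2) linarith
        then show ?thesis by (simp add: trunc_inv_def)
      qed
      have "real n / sin \<theta> ^ 4 \<le> ln (real (Suc m))"
        using m by (subst ln_ge_iff) auto
      then have "real n \<le> sin \<theta> ^ 4 * ln (real (Suc m))" using p by (simp add: field_simps)
      then have "of_nat n \<le> ennreal (sin \<theta> ^ 4 * ln (trunc_inv (real (Suc m)) (w \<theta>)))"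
        unfolding t by (simp add: ennreal_of_nat_eq_real_of_nat ennreal_leI)
      then show "\<exists>i\<in>UNIV. of_nat n \<le> ennreal (sin \<theta> ^ 4 * ln (trunc_inv (real (Suc i)) (w \<theta>)))" by blast
    qed
    then show ?thesis by (simp only: top_greatest)
  qed
qed

text \<open>Monotone convergence in the truncation level, with the uniform bound of
  \<open>truncated_neg_log_bound\<close>.\<close>

lemma neg_log_part_finite:
  assumes \<mu>: "nontrivial_circle_prob \<mu>" and d: "lebesgue_decomposition \<mu> w \<mu>s" and a: "a = verblunsky \<mu>"
    and bdd: "bdd_below (range (disc_seq.sin4_entropy a))"
  shows "(\<integral>\<^sup>+\<theta>. neg_log_part w \<theta> \<partial>arc_measure) < \<infinity>"
proof -
  obtain c where c: "\<And>n. c \<le> disc_seq.sin4_entropy a n" using bdd by (auto simp: bdd_below_def)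
  define C where "C = - c"
  have C: "- C \<le> disc_seq.sin4_entropy a n" for n using c by (simp add: C_def)
  have w: "w \<in> borel_measurable borel" using d by (simp add: lebesgue_decomposition_def)
  let ?u = "\<lambda>m \<theta>. ennreal (sin \<theta> ^ 4 * ln (trunc_inv (real (Suc m)) (w \<theta>)))"
  have "(\<integral>\<^sup>+\<theta>. neg_log_part w \<theta> \<partial>arc_measure) \<le> (\<integral>\<^sup>+\<theta>. (SUP m. ?u m \<theta>) \<partial>arc_measure)"
    by (rule nn_integral_mono) (rule neg_log_part_le_SUP)
  also have "\<dots> = (SUP m. \<integral>\<^sup>+\<theta>. ?u m \<theta> \<partial>arc_measure)"
  proof (rule nn_integral_monotone_convergence_SUP)
    show "incseq ?u"
    proof (intro incseq_SucI le_funI ennreal_leI mult_left_mono)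
      fix m \<theta>
      have "trunc_inv (real (Suc m)) (w \<theta>) \<le> trunc_inv (real (Suc (Suc m))) (w \<theta>)"
        by (rule trunc_inv_mono) auto
      moreover have "1 \<le> trunc_inv (real (Suc m)) (w \<theta>)" by (simp add: trunc_inv_def)
      ultimately show "ln (trunc_inv (real (Suc m)) (w \<theta>)) \<le> ln (trunc_inv (real (Suc (Suc m))) (w \<theta>))"
        by (subst ln_le_cancel_iff) auto
    qed simp
    show "?u m \<in> borel_measurable arc_measure" for m
      using measurable_compose[OF w trunc_inv_measurable] by simp
  qed
  also have "\<dots> \<le> ennreal (3 + C)"
    by (intro SUP_least truncated_neg_log_bound[OF \<mu> d a C]) simp
  also have "\<dots> < \<infinity>" by simp
  finally show ?thesis .
qed

theorem theorem4p56:
  fixes \<mu> \<mu>s :: "complex measure" and w :: "real \<Rightarrow> real" and \<alpha> :: "nat \<Rightarrow> complex"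
  assumes "nontrivial_circle_prob \<mu>"
    and "lebesgue_decomposition \<mu> w \<mu>s"
    and "\<alpha> = verblunsky \<mu>"
    and "\<alpha> \<in> little_l 8"
    and "(\<lambda>n. left_shift \<alpha> n - \<alpha> n) \<in> little_l 2"
  shows "integral_ext arc_measure
           (\<lambda>\<theta>. ereal ((1 - cos \<theta>)^2 * (1 + cos \<theta>)^2) * log_ext (w \<theta>)) > - \<infinity>
         \<longleftrightarrow> \<alpha> \<in> little_l 6"
proof -
  interpret slow_disc_seq \<alpha>
    using assms verblunsky_Phi[OF assms(1)] by unfold_locales (auto simp: little_l_def left_shift_def)
  have \<mu>: "prob_space \<mu>" "sets \<mu> = sets borel" using assms(1) by (auto simp: nontrivial_circle_prob_def)
  have "(\<integral>\<^sup>+\<theta>. neg_log_part w \<theta> \<partial>arc_measure) < \<infinity> \<longleftrightarrow> bdd_below (range sin4_entropy)"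
    by (rule iffI[OF sin4_entropy_bdd_below[OF assms(1-3)] neg_log_part_finite[OF assms(1-3)]])
  also have "\<dots> \<longleftrightarrow> \<alpha> \<in> little_l 6"
    unfolding bounded_sin4_entropy_iff by (simp add: little_l_def)
  finally show ?thesis unfolding integral_ext_gt_iff[OF assms(2) \<mu>] .
qed

end
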